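(* Let $\mathcal{K}$ be a simplicial complex on $[m]=\{1,\dots,m\}$ and let $\mathbf{k}$ be an arbitrary field. If a partition $\alpha=\{\alpha_1,\dots,\alpha_r\}$ of $[m]$ is nondegenerate for $\mathcal{K}$, then for any integer $q\ge 0$, $$\sum_{L\subseteq [r]} \beta^{\mathbf{k}(\mathcal{K})}_{q+|\omega^{\alpha}_{L}|-|L|,\ \omega^{\alpha}_{L}} \;=\; \sum_{L\subseteq [r]} \dim_{\mathbf{k}} \widetilde{H}^{|L|-q-1}\big(\mathcal{K}|_{\omega^{\alpha}_{L}};\mathbf{k}\big)\;\ge\; \binom{r-\dim(\mathcal{K})-1}{q}.$$ This implies $$\sum_{L\subseteq [r]} \Big(\sum_{j=-1}^{|L|-1} \dim_{\mathbf{k}} \widetilde{H}^{j}\big(\mathcal{K}|_{\omega^{\alpha}_{L}};\mathbf{k}\big)\Big)\;\ge\; 2^{\,r-\dim(\mathcal{K})-1}.$$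
   Context: A simplicial complex $\mathcal{K}$ on $[m]$ is a collection of subsets of $[m]$ closed under taking subsets; it is always assumed that $\varnothing\in\mathcal{K}$ and $\{j\}\in\mathcal{K}$ for every $j\in[m]$. A simplex $\sigma\in\mathcal{K}$ has dimension $|\sigma|-1$, and $\dim(\mathcal{K})$ is the maximal dimension of its simplices. For $\omega\subseteq[m]$, the full subcomplex is $\mathcal{K}|_\omega=\{\sigma\in\mathcal{K}\mid \sigma\subseteq\omega\}$. $\widetilde{H}^{*}(\,\cdot\,;\mathbf{k})$ is reduced simplicial cohomology, with the convention that $\widetilde H^{-1}(\{\varnothing\};\mathbf{k})=\mathbf{k}$ for $\mathcal{K}|_{\varnothing}=\{\varnothing\}$. A partition $\alpha=\{\alpha_1,\dots,\alpha_r\}$ of $[m]$ is a family of pairwise disjoint nonempty subsets with union $[m]$. It is nondegenerate for $\mathcal{K}$ if the two vertices of any $1$-simplex of $\mathcal{K}$ belong to different $\alpha_i$. Put $[r]=\{1,\dots,r\}$ and, for $L\subseteq[r]$, $\omega^{\alpha}_L=\bigcup_{i\in L}\alpha_i\subseteq[m]$. Let $\mathbf{k}[\mathbf{v}]=\mathbf{k}[v_1,\dots,v_m]$ with its $\mathbb{N}^m$-grading. The Stanley–Reisner ring is $\mathbf{k}(\mathcal{K})=\mathbf{k}[\mathbf{v}]/I_{\mathcal{K}}$, where $I_{\mathcal{K}}$ is generated by the monomials $\prod_{j\in\tau}v_j$ for $\tau\subseteq[m]$, $\tau\notin\mathcal{K}$. For $\omega\subseteq[m]$ let $\mathbf{a}_\omega\in\{0,1\}^m$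 be its indicator vector. The multigraded Betti numbers are $\beta^{\mathbf{k}(\mathcal{K})}_{i,\omega}=\dim_{\mathbf{k}}\mathrm{Tor}_i^{\mathbf{k}[\mathbf{v}]}(\mathbf{k}(\mathcal{K}),\mathbf{k})_{\mathbf{a}_\omega}$, $i\in\mathbb{N}$. *)

theory Defs
  imports
    Complex_Main
    "HOL-Algebra.QuotRing"
    "HOL-Algebra.Module"
    "HOL-Library.Poly_Mapping"
    "HOL-Library.Function_Algebras"
    "HOL-Library.Disjoint_Sets"
begin

section \<open>Dimension of a quotient space\<close>

text \<open>
  For subspaces \<open>B \<subseteq> Z\<close> of a vector space with scalar multiplication \<open>s\<close>, the set \<open>S\<close> below is
  a system of representatives of a basis of \<open>Z / B\<close>.
\<close>

definition quotient_basis ::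
    "('k::field \<Rightarrow> 'v::ab_group_add \<Rightarrow> 'v) \<Rightarrow> 'v set \<Rightarrow> 'v set \<Rightarrow> 'v set \<Rightarrow> bool" where
  "quotient_basis s Z B S \<longleftrightarrow>
     S \<subseteq> Z \<and>
     (\<forall>T u. finite T \<and> T \<subseteq> S \<and> (\<Sum>v\<in>T. s (u v) v) \<in> B \<longrightarrow> (\<forall>v\<in>T. u v = 0)) \<and>
     module.span s (S \<union> B) = Z"

definition quotient_dim ::
    "('k::field \<Rightarrow> 'v::ab_group_add \<Rightarrow> 'v) \<Rightarrow> 'v set \<Rightarrow> 'v set \<Rightarrow> nat" where
  "quotient_dim s Z B = card (SOME S. quotient_basis s Z B S)"


section \<open>Simplicial complexes\<close>

definition simplicial_complex :: "nat \<Rightarrow> nat set set \<Rightarrow> bool" where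
  "simplicial_complex m K \<longleftrightarrow>
     K \<subseteq> Pow {1..m} \<and> {} \<in> K \<and> (\<forall>j\<in>{1..m}. {j} \<in> K) \<and>
     (\<forall>\<sigma>\<in>K. \<forall>\<tau>. \<tau> \<subseteq> \<sigma> \<longrightarrow> \<tau> \<in> K)"

definition complex_dim :: "nat set set \<Rightarrow> int" where
  "complex_dim K = Max ((\<lambda>\<sigma>. int (card \<sigma>) - 1) ` K)"

definition full_subcomplex :: "nat set set \<Rightarrow> nat set \<Rightarrow> nat set set" where
  "full_subcomplex K \<omega> = {\<sigma> \<in> K. \<sigma> \<subseteq> \<omega>}"

definition indexed_partition :: "nat \<Rightarrow> nat \<Rightarrow> (nat \<Rightarrow> nat set) \<Rightarrow> bool" where
  "indexed_partition m r \<alpha> \<longleftrightarrow> inj_on \<alpha> {1..r} \<and> partition_on {1..m} (\<alpha> ` {1..r})"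

definition nondegenerate :: "nat set set \<Rightarrow> nat \<Rightarrow> (nat \<Rightarrow> nat set) \<Rightarrow> bool" where
  "nondegenerate K r \<alpha> \<longleftrightarrow>
     (\<forall>x y. x \<noteq> y \<and> {x, y} \<in> K \<longrightarrow> \<not> (\<exists>i\<in>{1..r}. x \<in> \<alpha> i \<and> y \<in> \<alpha> i))"

definition block_union :: "(nat \<Rightarrow> nat set) \<Rightarrow> nat set \<Rightarrow> nat set" where
  "block_union \<alpha> L = (\<Union>i\<in>L. \<alpha> i)"


section \<open>Reduced simplicial cohomology\<close>

text \<open>
  The augmented cochain complex: every simplex is oriented by the order of its vertices, and the
  empty simplex spans degree \<open>-1\<close>.
\<close>

definition cochains :: "nat set set \<Rightarrow> int \<Rightarrow> (nat set \<Rightarrow> 'k::field) set" where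
  "cochains K j = {f. \<forall>\<sigma>. f \<sigma> \<noteq> 0 \<longrightarrow> \<sigma> \<in> K \<and> int (card \<sigma>) = j + 1}"

definition coboundary :: "nat set set \<Rightarrow> (nat set \<Rightarrow> 'k::field) \<Rightarrow> nat set \<Rightarrow> 'k" where
  "coboundary K f \<sigma> =
     (if \<sigma> \<in> K then \<Sum>x\<in>\<sigma>. (-1) ^ card {y \<in> \<sigma>. y < x} * f (\<sigma> - {x}) else 0)"

definition reduced_cohomology_dim :: "'k::field itself \<Rightarrow> nat set set \<Rightarrow> int \<Rightarrow> nat" where
  "reduced_cohomology_dim _ K j =
     quotient_dim (\<lambda>(c::'k) f \<sigma>. c * f \<sigma>)
       {f \<in> cochains K j. coboundary K f = 0}
       (coboundary K ` cochains K (j - 1))"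


section \<open>The polynomial ring and the Stanley--Reisner ring\<close>

text \<open>
  A monomial is its exponent vector, a finitely supported function \<open>nat \<Rightarrow> nat\<close>; the polynomial
  ring in \<open>v\<^sub>1, \<dots>, v\<^sub>m\<close> consists of the polynomials all of whose monomials only involve these
  variables.
\<close>

type_synonym expo = "nat \<Rightarrow>\<^sub>0 nat"
type_synonym 'k mpoly = "expo \<Rightarrow>\<^sub>0 'k"

definition degrees :: "nat \<Rightarrow> expo set" where
  "degrees m = {a. Poly_Mapping.keys a \<subseteq> {1..m}}"

definition polynomial_ring :: "nat \<Rightarrow> ('k::field mpoly) ring" where
  "polynomial_ring m =
     \<lparr>carrier = {p. Poly_Mapping.keys p \<subseteq> degrees m},
      mult = (*), one = 1, zero = 0, add = (+)\<rparr>"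

definition var_poly :: "nat \<Rightarrow> 'k::field mpoly" where
  "var_poly j = Poly_Mapping.single (Poly_Mapping.single j 1) 1"

definition const_poly :: "'k::field \<Rightarrow> 'k mpoly" where
  "const_poly c = Poly_Mapping.single 0 c"

definition indicator_degree :: "nat set \<Rightarrow> expo" where
  "indicator_degree \<omega> = (\<Sum>j\<in>\<omega>. Poly_Mapping.single j 1)"

definition stanley_reisner_ideal :: "nat \<Rightarrow> nat set set \<Rightarrow> ('k::field mpoly) set" where
  "stanley_reisner_ideal m K =
     genideal (polynomial_ring m) {\<Prod>j\<in>\<tau>. var_poly j | \<tau>. \<tau> \<subseteq> {1..m} \<and> \<tau> \<notin> K}"

definition stanley_reisner_ring :: "nat \<Rightarrow> nat set set \<Rightarrow> ('k::field mpoly) set ring" where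
  "stanley_reisner_ring m K = polynomial_ring m Quot stanley_reisner_ideal m K"

definition stanley_reisner_module ::
    "nat \<Rightarrow> nat set set \<Rightarrow> ('k::field mpoly, 'k mpoly set) module" where
  "stanley_reisner_module m K =
     ring.extend (stanley_reisner_ring m K)
       \<lparr>smult = (\<lambda>p X. (stanley_reisner_ideal m K +>\<^bsub>polynomial_ring m\<^esub> p)
                        \<otimes>\<^bsub>stanley_reisner_ring m K\<^esub> X)\<rparr>"

definition stanley_reisner_grading ::
    "nat \<Rightarrow> nat set set \<Rightarrow> expo \<Rightarrow> ('k::field mpoly) set set" where
  "stanley_reisner_grading m K a =
     {stanley_reisner_ideal m K +>\<^bsub>polynomial_ring m\<^esub> p |
        p. p \<in> carrier (polynomial_ring m) \<and> Poly_Mapping.keys p \<subseteq> {a}}"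


section \<open>Multigraded free resolutions\<close>

text \<open>
  The \<open>i\<close>-th module of a resolution is free with basis \<open>e\<^sub>b\<close> for \<open>b < free_rank F i\<close> and
  \<open>e\<^sub>b\<close> has multidegree \<open>basis_deg F i b\<close>. The entry of the matrix of the differential from place
  \<open>i + 1\<close> to place \<open>i\<close> in row \<open>b\<close> and column \<open>c\<close> is \<open>diff_entry F i b c\<close>, and the augmentation maps the
  basis vector \<open>e\<^sub>b\<close> of place \<open>0\<close> to \<open>aug F b\<close>.
\<close>

record (overloaded) ('k::zero, 'm) resolution =
  free_rank :: "nat \<Rightarrow> nat"
  basis_deg :: "nat \<Rightarrow> nat \<Rightarrow> expo"
  diff_entry :: "nat \<Rightarrow> nat \<Rightarrow> nat \<Rightarrow> 'k mpoly"
  aug :: "nat \<Rightarrow> 'm"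

definition free_module :: "nat \<Rightarrow> nat \<Rightarrow> (nat \<Rightarrow> 'k::field mpoly) set" where
  "free_module m n =
     {x. (\<forall>b<n. x b \<in> carrier (polynomial_ring m)) \<and> (\<forall>b\<ge>n. x b = 0)}"

text \<open>
  The map \<open>N\<^sup>n \<rightarrow> N\<^sup>l\<close> given by an \<open>l \<times> n\<close> matrix of polynomials, for a module \<open>N\<close> on which polynomials
  act by \<open>act\<close>. For \<open>act = (*)\<close> it is the map of free modules itself, and in general it is the
  tensor product of that map with \<open>N\<close>.
\<close>

definition matrix_map ::
    "('k::field mpoly \<Rightarrow> 'n::ab_group_add \<Rightarrow> 'n) \<Rightarrow> nat \<Rightarrow> nat \<Rightarrow> (nat \<Rightarrow> nat \<Rightarrow> 'k mpoly) \<Rightarrow>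
     (nat \<Rightarrow> 'n) \<Rightarrow> nat \<Rightarrow> 'n" where
  "matrix_map act l n D x b = (if b < l then \<Sum>c<n. act (D b c) (x c) else 0)"

definition differential ::
    "('k::field, 'm) resolution \<Rightarrow> ('k mpoly \<Rightarrow> 'n::ab_group_add \<Rightarrow> 'n) \<Rightarrow> nat \<Rightarrow>
     (nat \<Rightarrow> 'n) \<Rightarrow> nat \<Rightarrow> 'n" where
  "differential F act i = matrix_map act (free_rank F i) (free_rank F (Suc i)) (diff_entry F i)"

definition augmentation ::
    "('k::field mpoly, 'm) module \<Rightarrow> ('k, 'm) resolution \<Rightarrow> (nat \<Rightarrow> 'k mpoly) \<Rightarrow> 'm" where
  "augmentation M F x = finsum M (\<lambda>b. x b \<odot>\<^bsub>M\<^esub> aug F b) {..<free_rank F 0}"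

text \<open>
  A resolution, by finitely generated multigraded free modules over the polynomial ring and with
  maps of multidegree \<open>0\<close>, of a module \<open>M\<close> with homogeneous components \<open>gr a\<close>. In the second
  condition, the entry in row \<open>b\<close> and column \<open>c\<close> is homogeneous of degree
  \<open>basis_deg F (Suc i) c - basis_deg F i b\<close>.
\<close>

definition free_resolution ::
    "nat \<Rightarrow> ('k::field mpoly, 'm) module \<Rightarrow> (expo \<Rightarrow> 'm set) \<Rightarrow> ('k, 'm) resolution \<Rightarrow> bool" where
  "free_resolution m M gr F \<longleftrightarrow>
     (\<forall>i. \<forall>b<free_rank F i. basis_deg F i b \<in> degrees m) \<and>
     (\<forall>i. \<forall>b<free_rank F i. \<forall>c<free_rank F (Suc i).
        diff_entry F i b c \<in> carrier (polynomial_ring m) \<and>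
        (\<forall>t\<in>Poly_Mapping.keys (diff_entry F i b c). t + basis_deg F i b = basis_deg F (Suc i) c)) \<and>
     (\<forall>b<free_rank F 0. aug F b \<in> carrier M \<and> aug F b \<in> gr (basis_deg F 0 b)) \<and>
     augmentation M F ` free_module m (free_rank F 0) = carrier M \<and>
     {x \<in> free_module m (free_rank F 0). augmentation M F x = \<zero>\<^bsub>M\<^esub>} =
        differential F (*) 0 ` free_module m (free_rank F 1) \<and>
     (\<forall>i. {x \<in> free_module m (free_rank F (Suc i)). differential F (*) i x = 0} =
        differential F (*) (Suc i) ` free_module m (free_rank F (Suc (Suc i))))"


section \<open>Multigraded Tor and Betti numbers\<close>

text \<open>
  The component of multidegree \<open>a\<close> of \<open>F\<^sub>i \<otimes> N = N\<^sup>n\<close>, where \<open>n = free_rank F i\<close> and \<open>N\<close> has the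
  homogeneous components \<open>gr c\<close>.
\<close>

definition tensor_component ::
    "('k::field, 'm) resolution \<Rightarrow> (expo \<Rightarrow> 'n::ab_group_add set) \<Rightarrow> nat \<Rightarrow> expo \<Rightarrow>
     (nat \<Rightarrow> 'n) set" where
  "tensor_component F gr i a =
     {x. (\<forall>b<free_rank F i. x b = 0 \<or> (\<exists>c. a = basis_deg F i b + c \<and> x b \<in> gr c)) \<and>
         (\<forall>b\<ge>free_rank F i. x b = 0)}"

definition tensor_homology_dim ::
    "('k::field, 'm) resolution \<Rightarrow> ('k mpoly \<Rightarrow> 'n::ab_group_add \<Rightarrow> 'n) \<Rightarrow> (expo \<Rightarrow> 'n set) \<Rightarrow>
     nat \<Rightarrow> expo \<Rightarrow> nat" where
  "tensor_homology_dim F act gr i a =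
     quotient_dim (\<lambda>c x b. act (const_poly c) (x b))
       {x \<in> tensor_component F gr i a. i > 0 \<longrightarrow> differential F act (i - 1) x = 0}
       (differential F act i ` tensor_component F gr (Suc i) a)"

text \<open>
  The dimension over the field of the component of multidegree \<open>a\<close> of \<open>Tor\<^sub>i(M, N)\<close>, where \<open>grM\<close> is
  the grading of \<open>M\<close> and the module \<open>N\<close> is given by \<open>actN\<close> and \<open>grN\<close>. Tor is computed from some free
  resolution of \<open>M\<close>, on whose choice it does not depend; for finitely generated \<open>M\<close> one exists
  because the polynomial ring is Noetherian.
\<close>

definition tor_dim ::
    "nat \<Rightarrow> ('k::field mpoly, 'm) module \<Rightarrow> (expo \<Rightarrow> 'm set) \<Rightarrow>
     ('k mpoly \<Rightarrow> 'n::ab_group_add \<Rightarrow> 'n) \<Rightarrow> (expo \<Rightarrow> 'n set) \<Rightarrow> nat \<Rightarrow> expo \<Rightarrow> nat" where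
  "tor_dim m M grM actN grN i a =
     tensor_homology_dim (SOME F. free_resolution m M grM F) actN grN i a"

text \<open>The field as the module on which every variable acts as \<open>0\<close>, placed in multidegree \<open>0\<close>.\<close>

definition residue_action :: "'k::field mpoly \<Rightarrow> 'k \<Rightarrow> 'k" where
  "residue_action p c = Poly_Mapping.lookup p 0 * c"

definition residue_grading :: "expo \<Rightarrow> 'k::field set" where
  "residue_grading a = (if a = 0 then UNIV else {0})"

definition betti :: "'k::field itself \<Rightarrow> nat \<Rightarrow> nat set set \<Rightarrow> nat \<Rightarrow> nat set \<Rightarrow> nat" where
  "betti _ m K i \<omega> =
     tor_dim m (stanley_reisner_module m K :: ('k mpoly, 'k mpoly set) module)
       (stanley_reisner_grading m K) residue_action residue_grading i (indicator_degree \<omega>)"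

end

theory Submission
  imports Defs
begin

text \<open>
  The equality is Hochster's formula, summed over the unions of blocks. The formula says that
  \<open>\<beta>\<^bsub>i,\<omega>\<^esub>\<close> is the dimension of the reduced cohomology of the full subcomplex on \<open>\<omega>\<close> in degree
  \<open>\<bar>\<omega>\<bar> - i - 1\<close> (\<open>betti_eq_reduced_cohomology_dim\<close>); for \<open>i = q + \<bar>\<omega>\<bar> - \<bar>L\<bar>\<close> this degree is
  \<open>\<bar>L\<bar> - q - 1\<close>. The blocks are nonempty, so the subtraction in \<open>i\<close> does not truncate.

  For Hochster's formula let \<open>F\<close> be any multigraded free resolution of the Stanley--Reisner ring. A
  homogeneous map of free modules is given by one scalar matrix, and the component of \<open>F\<close> in the
  degree of a vertex set \<open>\<sigma>\<close> is the coordinate subspace of the generators whose degree is at most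
  \<open>\<sigma>\<close>; multiplication by a variable becomes an inclusion of such subspaces. For fixed \<open>\<omega>\<close>, the
  families indexed by the subsets \<open>\<sigma>\<close> of \<open>\<omega>\<close> with values in the components in degree \<open>\<sigma>\<close> therefore
  form a double complex, with the resolution as one differential and the simplicial coboundary as the
  other (this is the degree-\<open>\<omega>\<close> part of \<open>F\<close> tensored with the Koszul complex). It is exact in the
  first direction because \<open>F\<close> is a resolution, and there its edge is the cochain complex of the full
  subcomplex. It is exact in the second direction because a generator of degree smaller than \<open>\<omega>\<close>
  contributes a cone, and there its edge is the degree-\<open>\<omega>\<close> part of \<open>F\<close> modulo the variables. Zigzags
  through the double complex identify the homology of the two edges (\<open>zigzag_from_first\<close>,
  \<open>zigzag_boundary\<close> and their transposes). Since Tor is defined from a chosen resolution, one has to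
  exist: a bar-type variant of Taylor's resolution does (\<open>stanley_reisner_free_resolution_exists\<close>).

  For the lower bound, nondegeneracy makes every face meet each block at most once, so that a face
  has as many colours (blocks that it meets) as vertices. For a set \<open>I\<close> of colours let
  \<open>T(I)\<close> be the sum, over the sets \<open>L\<close> of other colours, of the dimensions of the cohomology of the
  faces whose colour set lies between \<open>I\<close> and \<open>I \<union> L\<close>, in degree \<open>\<bar>I\<bar> + \<bar>L\<bar> - q - 1\<close>. The sum of the
  theorem is \<open>T({})\<close>. The faces for \<open>I\<close> and \<open>L \<union> {i}\<close> split into those with colour \<open>i\<close>, whose
  cochains form a subcomplex, and those without; the long exact sequence of this pair gives
  \<open>T(I \<union> {i}) \<le> T(I)\<close> (\<open>band_betti_sum_insert_le\<close>). In algebraic terms, localisation does not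
  increase Betti numbers. If \<open>J\<close> is the set of colours of a face of maximal dimension, only faces with
  colour set exactly \<open>J\<close> are left in \<open>T(J)\<close>, all of the same dimension, and each of the sets \<open>L\<close> with
  \<open>q\<close> elements contributes at least \<open>1\<close>: this is the binomial coefficient. Summing over \<open>q\<close> gives the power of two.
\<close>

section \<open>Dimensions of finite quotients\<close>

interpretation fn: vector_space "\<lambda>(c::'k::field) (f::'a \<Rightarrow> 'k) x. c * f x"
  by unfold_locales (auto simp: fun_eq_iff algebra_simps)

lemma sum_fun_apply: "(\<Sum>a\<in>A. f a) x = (\<Sum>a\<in>A. f a x)"
  for f :: "'b \<Rightarrow> 'a \<Rightarrow> 'c::comm_monoid_add"
  by (induction A rule: infinite_finite_induct) auto

lemma fn_finite_support_in_span:
  fixes f :: "'a \<Rightarrow> 'k::field"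
  assumes "finite A" and "\<And>x. f x \<noteq> 0 \<Longrightarrow> x \<in> A"
  shows "f \<in> fn.span ((\<lambda>a x. if x = a then 1 else 0) ` A)"
proof -
  have "f = (\<Sum>a\<in>A. (\<lambda>x. f a * (if x = a then 1 else 0)))"
  proof
    fix x
    have "(\<Sum>a\<in>A. f a * (if x = a then 1 else 0)) = (\<Sum>a\<in>A. if x = a then f x else 0)"
      by (intro sum.cong) auto
    also have "\<dots> = f x"
      using assms by (cases "x \<in> A") auto
    finally show "f x = (\<Sum>a\<in>A. (\<lambda>x. f a * (if x = a then 1 else 0))) x"
      by (simp add: sum_fun_apply)
  qed
  also have "\<dots> \<in> fn.span ((\<lambda>a x. if x = a then 1 else 0) ` A)"
    by (intro fn.span_sum fn.span_scale fn.span_base imageI)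
  finally show ?thesis .
qed

text \<open>
  The support condition is a form of finite dimensionality that is immediate for spaces of cochains
  and of coordinate vectors.
\<close>

definition finite_quotient :: "('a \<Rightarrow> 'k::field) set \<Rightarrow> ('a \<Rightarrow> 'k) set \<Rightarrow> bool" where
  "finite_quotient Z B \<longleftrightarrow> fn.subspace Z \<and> fn.subspace B \<and> B \<subseteq> Z \<and>
     (\<exists>A. finite A \<and> (\<forall>f\<in>Z. \<forall>x. f x \<noteq> 0 \<longrightarrow> x \<in> A))"

abbreviation qdim :: "('a \<Rightarrow> 'k::field) set \<Rightarrow> ('a \<Rightarrow> 'k) set \<Rightarrow> nat" where
  "qdim \<equiv> quotient_dim (\<lambda>c f x. c * f x)"

lemma finite_independent_in_finite_quotient:
  assumes "finite_quotient Z B" "fn.independent S" "S \<subseteq> Z"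
  shows "finite S"
proof -
  obtain A where A: "finite A" "\<And>f x. f \<in> Z \<Longrightarrow> f x \<noteq> 0 \<Longrightarrow> x \<in> A"
    using assms(1) by (auto simp: finite_quotient_def)
  have "S \<subseteq> fn.span ((\<lambda>a x. if x = a then 1 else 0) ` A)"
    using fn_finite_support_in_span[OF A(1)] A(2) assms(3) by blast
  thus ?thesis
    using fn.independent_span_bound assms(2) A(1) by (metis finite_imageI)
qed

lemma quotient_basisD:
  assumes "quotient_basis s Z B S"
  shows "S \<subseteq> Z" "module.span s (S \<union> B) = Z"
    and "\<And>T u v. finite T \<Longrightarrow> T \<subseteq> S \<Longrightarrow> (\<Sum>v\<in>T. s (u v) v) \<in> B \<Longrightarrow> v \<in> T \<Longrightarrow> u v = 0"
  using assms by (simp_all add: quotient_basis_def)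

text \<open>
  A basis of \<open>B\<close> completes a system of representatives of a basis of the quotient to a basis of \<open>Z\<close>,
  so the number of representatives does not depend on the choice.
\<close>

lemma quotient_basis_card:
  fixes Z B S :: "('a \<Rightarrow> 'k::field) set"
  assumes fq: "finite_quotient Z B" and S: "quotient_basis (\<lambda>c f x. c * f x) Z B S"
  shows "finite S" "fn.dim Z = card S + fn.dim B"
proof -
  have sub: "fn.subspace Z" "fn.subspace B" "B \<subseteq> Z"
    using fq by (auto simp: finite_quotient_def)
  have SZ: "S \<subseteq> Z" and Sspan: "fn.span (S \<union> B) = Z"
    and Sind: "\<And>T u v. finite T \<Longrightarrow> T \<subseteq> S \<Longrightarrow> (\<Sum>v\<in>T. (\<lambda>x. u v * v x)) \<in> B \<Longrightarrow> v \<in> T \<Longrightarrow> u v = 0"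
    using quotient_basisD[OF S] by simp_all
  obtain A where A: "A \<subseteq> B" "fn.independent A" "B \<subseteq> fn.span A" "card A = fn.dim B"
    using fn.basis_exists by blast
  have finA: "finite A"
    using finite_independent_in_finite_quotient[OF fq A(2)] A(1) sub by blast
  have spA: "fn.span A = B"
    using A sub by (intro fn.span_subspace) auto
  have disj: "S \<inter> B = {}"
  proof -
    have "s \<notin> B" if "s \<in> S" for s
    proof
      assume "s \<in> B"
      hence "(\<Sum>v\<in>{s}. (\<lambda>x. 1 * v x)) \<in> B" by simp
      from Sind[OF _ _ this] that have "(1 :: 'k) = 0" by blast
      thus False by simp
    qed
    thus ?thesis by blast
  qed
  have ind: "fn.independent (S \<union> A)"
  proof (rule fn.independent_explicit_module[THEN iffD2], intro allI impI)
    fix t u v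
    assume t: "finite t" "t \<subseteq> S \<union> A" "(\<Sum>v\<in>t. (\<lambda>x. u v * v x)) = 0" "v \<in> t"
    have split: "(\<Sum>v\<in>t. (\<lambda>x. u v * v x)) =
        (\<Sum>v\<in>t \<inter> S. (\<lambda>x. u v * v x)) + (\<Sum>v\<in>t - S. (\<lambda>x. u v * v x))"
      by (rule sum.Int_Diff[OF t(1)])
    have tA: "t - S \<subseteq> A" using t(2) by auto
    have inB: "(\<Sum>v\<in>t - S. (\<lambda>x. u v * v x)) \<in> B"
      using tA A(1) sub by (intro fn.subspace_sum fn.subspace_scale) auto
    have "(\<Sum>v\<in>t \<inter> S. (\<lambda>x. u v * v x)) = - (\<Sum>v\<in>t - S. (\<lambda>x. u v * v x))"
      using t(3) split by (simp add: eq_neg_iff_add_eq_0)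
    hence "(\<Sum>v\<in>t \<inter> S. (\<lambda>x. u v * v x)) \<in> B"
      using fn.subspace_neg[OF sub(2) inB] by (simp only:)
    hence S0: "\<And>v. v \<in> t \<inter> S \<Longrightarrow> u v = 0"
      using Sind[of "t \<inter> S" u] t(1) by blast
    hence "(\<Sum>v\<in>t \<inter> S. (\<lambda>x. u v * v x)) = 0"
      by (intro sum.neutral ballI) (simp add: fun_eq_iff)
    hence "(\<Sum>v\<in>t - S. (\<lambda>x. u v * v x)) = 0"
      using split t(3) by simp
    hence "\<And>v. v \<in> t - S \<Longrightarrow> u v = 0"
      using fn.independentD[OF A(2) _ tA] t(1) by blast
    thus "u v = 0" using S0 t(4) by blast
  qed
  have "S \<union> A \<subseteq> Z" using SZ A(1) sub by blast
  hence fin: "finite (S \<union> A)"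
    using finite_independent_in_finite_quotient[OF fq ind] by blast
  thus "finite S" by simp
  have spB: "fn.span B = B" using sub(2) by simp
  have "fn.span (S \<union> A) = Z"
    using Sspan spA spB by (simp only: fn.span_Un)
  hence "fn.dim Z = card (S \<union> A)"
    using fn.dim_span_eq_card_independent[OF ind] by (simp only:)
  also have "\<dots> = card S + card A"
    using disj A(1) fin by (intro card_Un_disjoint) auto
  finally show "fn.dim Z = card S + fn.dim B" using A by simp
qed

text \<open>
  The representatives are the vectors that extend a basis of \<open>B\<close> to one of \<open>Z\<close>.
\<close>

lemma quotient_basis_exists:
  fixes Z B :: "('a \<Rightarrow> 'k::field) set"
  assumes fq: "finite_quotient Z B"
  shows "\<exists>S. quotient_basis (\<lambda>c f x. c * f x) Z B S"
proof -
  have sub: "fn.subspace Z" "fn.subspace B" "B \<subseteq> Z"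
    using fq by (auto simp: finite_quotient_def)
  obtain A where A: "A \<subseteq> B" "fn.independent A" "B \<subseteq> fn.span A" "card A = fn.dim B"
    using fn.basis_exists by blast
  have spA: "fn.span A = B"
    using A sub by (intro fn.span_subspace) auto
  obtain A' where A': "A \<subseteq> A'" "A' \<subseteq> Z" "fn.independent A'" "Z \<subseteq> fn.span A'"
    using fn.maximal_independent_subset_extend[of A Z] A sub by blast
  have finA': "finite A'"
    using finite_independent_in_finite_quotient[OF fq A'(3) A'(2)] .
  have "fn.span ((A' - A) \<union> B) = Z"
  proof (rule fn.span_subspace)
    show "A' - A \<union> B \<subseteq> Z" using A' sub by blast
    have "A' \<subseteq> A' - A \<union> B" using A by blast
    thus "Z \<subseteq> fn.span (A' - A \<union> B)" using A'(4) fn.span_mono by blast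
  qed (fact sub)
  moreover have "u v = 0"
    if T: "finite T" "T \<subseteq> A' - A" "(\<Sum>v\<in>T. (\<lambda>x. u v * v x)) \<in> B" and v: "v \<in> T" for T u v
  proof -
    have "finite A" using finA' A'(1) finite_subset by blast
    then obtain w where w: "(\<Sum>v\<in>T. (\<lambda>x. u v * v x)) = (\<Sum>a\<in>A. (\<lambda>x. w a * a x))"
      using T(3) spA fn.span_finite[of A] by auto
    define z where "z v = (if v \<in> A then - w v else u v)" for v
    have "(\<Sum>v\<in>T \<union> A. (\<lambda>x. z v * v x)) = (\<Sum>v\<in>T. (\<lambda>x. z v * v x)) + (\<Sum>v\<in>A. (\<lambda>x. z v * v x))"
      using T \<open>finite A\<close> by (intro sum.union_disjoint) auto
    also have "(\<Sum>v\<in>T. (\<lambda>x. z v * v x)) = (\<Sum>v\<in>T. (\<lambda>x. u v * v x))"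
      using T(2) by (intro sum.cong) (auto simp: z_def)
    also have "(\<Sum>v\<in>A. (\<lambda>x. z v * v x)) = - (\<Sum>v\<in>A. (\<lambda>x. w v * v x))"
      unfolding sum_negf[symmetric] by (intro sum.cong) (auto simp: z_def fun_eq_iff)
    finally have "(\<Sum>v\<in>T \<union> A. (\<lambda>x. z v * v x)) = 0"
      by (simp only: w add.right_inverse)
    hence "z v = 0"
      using fn.independentD[OF A'(3), of "T \<union> A" z v] T v \<open>finite A\<close> A'(1) by blast
    moreover have "v \<notin> A" using T v by auto
    ultimately show ?thesis by (simp add: z_def)
  qed
  ultimately have "quotient_basis (\<lambda>c f x. c * f x) Z B (A' - A)"
    unfolding quotient_basis_def using A'(2) by blast
  thus ?thesis ..
qed

lemma qdim_basis:
  fixes Z B :: "('a \<Rightarrow> 'k::field) set"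
  assumes "finite_quotient Z B"
  obtains S where "quotient_basis (\<lambda>c f x. c * f x) Z B S" "card S = qdim Z B"
  using someI_ex[OF quotient_basis_exists[OF assms]] unfolding quotient_dim_def by metis

lemma dim_eq_qdim_add_dim:
  fixes Z B :: "('a \<Rightarrow> 'k::field) set"
  assumes "finite_quotient Z B"
  shows "fn.dim Z = qdim Z B + fn.dim B"
  using qdim_basis[OF assms] quotient_basis_card[OF assms] by metis

lemma qdim_trans:
  fixes Z U B :: "('a \<Rightarrow> 'k::field) set"
  assumes "finite_quotient Z U" "finite_quotient U B"
  shows "qdim Z B = qdim Z U + qdim U B"
proof -
  have "finite_quotient Z B"
    using assms unfolding finite_quotient_def by blast
  from dim_eq_qdim_add_dim[OF this] dim_eq_qdim_add_dim[OF assms(1)] dim_eq_qdim_add_dim[OF assms(2)]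
  show ?thesis by linarith
qed

text \<open>
  Partners of a basis of the first quotient are independent in the second, because the relation is
  linear and reflects membership in the subspaces that are divided out. Relations take the place of
  maps because a zigzag is determined by its start only up to boundaries.
\<close>

lemma qdim_le_by_relation:
  fixes Z B :: "('a \<Rightarrow> 'k::field) set" and Z' B' :: "('b \<Rightarrow> 'k) set"
  assumes fq: "finite_quotient Z B" and fq': "finite_quotient Z' B'"
    and add: "\<And>x y x' y'. R x x' \<Longrightarrow> R y y' \<Longrightarrow> R (x + y) (x' + y')"
    and scale: "\<And>c x x'. R x x' \<Longrightarrow> R (\<lambda>t. c * x t) (\<lambda>t. c * x' t)"
    and total: "\<And>x. x \<in> Z \<Longrightarrow> \<exists>x'\<in>Z'. R x x'"
    and reflect: "\<And>x x'. R x x' \<Longrightarrow> x \<in> Z \<Longrightarrow> x' \<in> B' \<Longrightarrow> x \<in> B"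
  shows "qdim Z B \<le> qdim Z' B'"
proof -
  have sub: "fn.subspace Z" "fn.subspace B" "B \<subseteq> Z"
    using fq by (auto simp: finite_quotient_def)
  have sub': "fn.subspace Z'" "fn.subspace B'" "B' \<subseteq> Z'"
    using fq' by (auto simp: finite_quotient_def)
  obtain S where S: "quotient_basis (\<lambda>c f x. c * f x) Z B S" "card S = qdim Z B"
    using qdim_basis[OF fq] .
  have finS: "finite S" using quotient_basis_card[OF fq S(1)] by simp
  have SZ: "S \<subseteq> Z"
    and Sind: "\<And>T u v. finite T \<Longrightarrow> T \<subseteq> S \<Longrightarrow> (\<Sum>v\<in>T. (\<lambda>x. u v * v x)) \<in> B \<Longrightarrow> v \<in> T \<Longrightarrow> u v = 0"
    using quotient_basisD[OF S(1)] by simp_all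
  define g where "g s = (SOME x'. x' \<in> Z' \<and> R s x')" for s
  have g: "g s \<in> Z' \<and> R s (g s)" if "s \<in> S" for s
    unfolding g_def using total[of s] SZ that by (intro someI_ex[of "\<lambda>x'. x' \<in> Z' \<and> R s x'"]) blast
  \<comment> \<open>Totality gives \<open>0\<close> some partner, which is then scaled by \<open>0\<close>.\<close>
  have R0: "R 0 0"
  proof -
    obtain x' where "R 0 x'" using total[of 0] fn.subspace_0[OF sub(1)] by blast
    from scale[OF this, of 0] show ?thesis by (simp add: zero_fun_def)
  qed
  have Rsum: "R (\<Sum>v\<in>T. (\<lambda>x. u v * v x)) (\<Sum>v\<in>T. (\<lambda>x. u v * g v x))" if "T \<subseteq> S" for T u
    using finite_subset[OF that finS] that
  proof (induction T rule: finite_induct)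
    case empty
    show ?case using R0 by (simp only: sum.empty)
  next
    case (insert v T)
    have "R (\<Sum>v\<in>T. (\<lambda>x. u v * v x)) (\<Sum>v\<in>T. (\<lambda>x. u v * g v x))" and "R v (g v)"
      using insert.IH insert.prems g by blast+
    from add[OF scale[OF this(2), of "u v"] this(1)] show ?case
      by (simp only: sum.insert[OF insert.hyps])
  qed
  have ind: "u v = 0" if "T \<subseteq> S" "(\<Sum>v\<in>T. (\<lambda>x. u v * g v x)) \<in> B'" "v \<in> T" for T u v
  proof -
    have "(\<Sum>v\<in>T. (\<lambda>x. u v * v x)) \<in> Z"
      using that SZ sub by (intro fn.subspace_sum fn.subspace_scale) auto
    hence "(\<Sum>v\<in>T. (\<lambda>x. u v * v x)) \<in> B"
      using reflect[OF Rsum] that by blast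
    thus ?thesis using Sind[of T u v] finS that finite_subset by blast
  qed
  have inj: "inj_on g S"
  proof (rule inj_onI, rule ccontr)
    fix s t assume st: "s \<in> S" "t \<in> S" "g s = g t" "s \<noteq> t"
    have "(\<Sum>v\<in>{s, t}. (\<lambda>x. (if v = s then 1 else -1) * g v x)) = 0"
      using st by (auto simp: fun_eq_iff)
    hence "(if s = s then 1 else -1 :: 'k) = 0"
      using ind[of "{s, t}" "\<lambda>v. if v = s then 1 else -1" s] st fn.subspace_0[OF sub'(2)] by auto
    thus False by simp
  qed
  have S'ind: "u v = 0"
    if T: "T \<subseteq> g ` S" "(\<Sum>v\<in>T. (\<lambda>x. u v * v x)) \<in> B'" and v: "v \<in> T" for T u v
  proof -
    obtain T0 where T0: "T0 \<subseteq> S" "T = g ` T0" using T(1) by (auto simp: subset_image_iff)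
    obtain w where w: "w \<in> T0" "v = g w" using T0 v by auto
    have "inj_on g T0" using inj T0(1) inj_on_subset by blast
    hence "(\<Sum>v\<in>T. (\<lambda>x. u v * v x)) = (\<Sum>v\<in>T0. (\<lambda>x. u (g v) * g v x))"
      unfolding T0 by (subst sum.reindex) (auto simp: o_def)
    hence "u (g w) = 0"
      using ind[of T0 "\<lambda>v. u (g v)" w] T0(1) w T(2) by simp
    thus ?thesis using w by simp
  qed
  define Y where "Y = fn.span (g ` S \<union> B')"
  have Y: "Y \<subseteq> Z'"
    unfolding Y_def using g sub' by (intro fn.span_minimal) auto
  have fqY: "finite_quotient Y B'"
    using fq' Y unfolding finite_quotient_def Y_def
    by (auto intro: fn.span_base) blast
  have qb: "quotient_basis (\<lambda>c f x. c * f x) Y B' (g ` S)"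
    unfolding quotient_basis_def
  proof (intro conjI allI impI)
    show "g ` S \<subseteq> Y" unfolding Y_def by (auto intro: fn.span_base)
  next
    fix T u
    assume "finite T \<and> T \<subseteq> g ` S \<and> (\<Sum>v\<in>T. (\<lambda>x. u v * v x)) \<in> B'"
    thus "\<forall>v\<in>T. u v = 0" using S'ind[of T u] by blast
  qed (simp add: Y_def)
  have "finite_quotient Z' Y"
    using fq' Y unfolding finite_quotient_def Y_def by auto
  hence "fn.dim Y \<le> fn.dim Z'" using dim_eq_qdim_add_dim by fastforce
  moreover have "fn.dim Y = card (g ` S) + fn.dim B'"
    using quotient_basis_card[OF fqY qb] by simp
  moreover have "fn.dim Z' = qdim Z' B' + fn.dim B'"
    using dim_eq_qdim_add_dim[OF fq'] .
  ultimately show ?thesis using card_image[OF inj] S(2) by simp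
qed

lemma qdim_zero_space: "qdim {0} {0 :: 'a \<Rightarrow> 'k::field} = 0"
proof -
  have "finite_quotient {0} {0 :: 'a \<Rightarrow> 'k}"
    by (auto simp: finite_quotient_def)
  from dim_eq_qdim_add_dim[OF this] show ?thesis by simp
qed


section \<open>Cochains on convex families of sets\<close>

abbreviation (input) hdim :: "'k::field itself \<Rightarrow> nat set set \<Rightarrow> int \<Rightarrow> nat" where
  "hdim \<equiv> reduced_cohomology_dim"

definition incidence_sign :: "nat set \<Rightarrow> nat \<Rightarrow> 'k::field" where
  "incidence_sign \<sigma> x = (-1) ^ card {y \<in> \<sigma>. y < x}"

lemma coboundary_eq:
  "coboundary P f \<sigma> = (if \<sigma> \<in> P then \<Sum>x\<in>\<sigma>. incidence_sign \<sigma> x * f (\<sigma> - {x}) else 0)"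
  by (simp add: coboundary_def incidence_sign_def)

lemma incidence_sign_insert:
  assumes "finite \<sigma>" "x \<notin> \<sigma>"
  shows "incidence_sign (insert x \<sigma>) y = (if x < y then - incidence_sign \<sigma> y else incidence_sign \<sigma> y :: 'k::field)"
proof -
  have "{z \<in> insert x \<sigma>. z < y} = (if x < y then insert x {z \<in> \<sigma>. z < y} else {z \<in> \<sigma>. z < y})"
    by auto
  thus ?thesis using assms by (simp add: incidence_sign_def)
qed

lemma incidence_sign_square: "incidence_sign \<sigma> x * incidence_sign \<sigma> x = (1 :: 'k::field)"
  by (simp add: incidence_sign_def flip: power_mult_distrib)

lemma coboundary_add: "coboundary P (f + g) = coboundary P f + coboundary P g"
  by (rule ext) (simp add: coboundary_eq sum.distrib algebra_simps)

lemma coboundary_diff: "coboundary P (f - g) = coboundary P f - coboundary P g"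
  by (rule ext) (simp add: coboundary_eq sum_subtractf algebra_simps)

lemma coboundary_scale: "coboundary P (\<lambda>\<tau>. c * f \<tau>) = (\<lambda>\<sigma>. c * coboundary P f \<sigma>)"
  by (rule ext) (simp add: coboundary_eq sum_distrib_left algebra_simps)

lemma coboundary_zero: "coboundary P (\<lambda>\<tau>. 0) = (\<lambda>\<sigma>. 0)"
  by (rule ext) (simp add: coboundary_eq)

text \<open>
  On a family that is closed under adding and removing the vertex \<open>x\<close>, insertion of \<open>x\<close> is a
  contracting homotopy.
\<close>

lemma coboundary_cone_exact:
  fixes f :: "nat set \<Rightarrow> 'k::field"
  assumes fin: "\<And>\<sigma>. \<sigma> \<in> P \<Longrightarrow> finite \<sigma>"
    and cone: "\<And>\<sigma>. x \<notin> \<sigma> \<Longrightarrow> insert x \<sigma> \<in> P \<longleftrightarrow> \<sigma> \<in> P"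
    and supp: "\<And>\<sigma>. f \<sigma> \<noteq> 0 \<Longrightarrow> \<sigma> \<in> P"
    and cocycle: "\<And>\<sigma>. coboundary P f \<sigma> = 0"
  shows "coboundary P (\<lambda>\<sigma>. if x \<notin> \<sigma> then incidence_sign \<sigma> x * f (insert x \<sigma>) else 0) = f"
    (is "coboundary P ?g = f")
proof
  fix \<sigma>
  consider "\<sigma> \<notin> P" | "\<sigma> \<in> P" "x \<in> \<sigma>" | "\<sigma> \<in> P" "x \<notin> \<sigma>" by blast
  thus "coboundary P ?g \<sigma> = f \<sigma>"
  proof cases
    case 1
    thus ?thesis using supp[of \<sigma>] by (auto simp: coboundary_eq)
  next
    case 2
    hence "coboundary P ?g \<sigma> =
        (\<Sum>y\<in>\<sigma>. if y = x then incidence_sign \<sigma> x * (incidence_sign (\<sigma> - {x}) x * f \<sigma>) else 0)"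
      unfolding coboundary_eq by (auto intro!: sum.cong simp: insert_absorb)
    also have "\<dots> = incidence_sign \<sigma> x * incidence_sign (\<sigma> - {x}) x * f \<sigma>"
      using 2 fin by simp
    also have "incidence_sign (\<sigma> - {x}) x = (incidence_sign \<sigma> x :: 'k)"
      using incidence_sign_insert[where ?'k = 'k, of "\<sigma> - {x}" x x] 2 fin by (simp add: insert_absorb)
    finally show ?thesis by (simp add: incidence_sign_square)
  next
    case 3
    note f3 = fin[OF 3(1)]
    have "0 = coboundary P f (insert x \<sigma>)" using cocycle by simp
    also have "\<dots> = (\<Sum>y\<in>insert x \<sigma>. incidence_sign (insert x \<sigma>) y * f (insert x \<sigma> - {y}))"
      using cone 3 by (simp add: coboundary_eq)
    also have "\<dots> = incidence_sign \<sigma> x * f \<sigma> +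
        (\<Sum>y\<in>\<sigma>. incidence_sign (insert x \<sigma>) y * f (insert x (\<sigma> - {y})))"
      using 3 f3 incidence_sign_insert[where ?'k = 'k, OF f3 3(2), of x]
      by (auto intro!: sum.cong simp: insert_Diff_if)
    finally have e: "incidence_sign \<sigma> x * f \<sigma> =
        - (\<Sum>y\<in>\<sigma>. incidence_sign (insert x \<sigma>) y * f (insert x (\<sigma> - {y})))"
      by (simp add: eq_neg_iff_add_eq_0)
    have "coboundary P ?g \<sigma> =
        (\<Sum>y\<in>\<sigma>. incidence_sign \<sigma> y * (incidence_sign (\<sigma> - {y}) x * f (insert x (\<sigma> - {y}))))"
      using 3 by (auto simp: coboundary_eq intro!: sum.cong)
    also have "\<dots> = (\<Sum>y\<in>\<sigma>. - incidence_sign \<sigma> x *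
        (incidence_sign (insert x \<sigma>) y * f (insert x (\<sigma> - {y}))))"
    proof (intro sum.cong refl)
      fix y assume y: "y \<in> \<sigma>"
      have "incidence_sign \<sigma> x = (if y < x then - incidence_sign (\<sigma> - {y}) x else incidence_sign (\<sigma> - {y}) x :: 'k)"
        using incidence_sign_insert[where ?'k = 'k, of "\<sigma> - {y}" y x] f3 y by (simp add: insert_absorb)
      moreover have "x \<noteq> y" using y 3 by auto
      ultimately show "incidence_sign \<sigma> y * (incidence_sign (\<sigma> - {y}) x * f (insert x (\<sigma> - {y}))) =
          - incidence_sign \<sigma> x * (incidence_sign (insert x \<sigma>) y * f (insert x (\<sigma> - {y})))"
        using incidence_sign_insert[where ?'k = 'k, OF f3 3(2), of y] by (auto split: if_splits)
    qed
    also have "\<dots> = incidence_sign \<sigma> x *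
        - (\<Sum>y\<in>\<sigma>. incidence_sign (insert x \<sigma>) y * f (insert x (\<sigma> - {y})))"
      by (simp add: sum_distrib_left sum_negf)
    also have "\<dots> = f \<sigma>"
      by (simp add: incidence_sign_square flip: e mult.assoc)
    finally show ?thesis .
  qed
qed

text \<open>
  Convexity makes the coboundary square to zero: if a set and the result of removing two of its vertices belong
  to the family, so do both sets in between. Differences of simplicial complexes are convex, so the
  definition of reduced cohomology, applied to convex families, covers relative cohomology too.
\<close>

definition convex_family :: "nat set set \<Rightarrow> bool" where
  "convex_family P \<longleftrightarrow> finite P \<and> (\<forall>\<sigma>\<in>P. finite \<sigma>) \<and>
     (\<forall>\<sigma>\<in>P. \<forall>\<rho>\<in>P. \<forall>\<tau>. \<sigma> \<subseteq> \<tau> \<longrightarrow> \<tau> \<subseteq> \<rho> \<longrightarrow> \<tau> \<in> P)"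

lemma convex_family_subset:
  assumes "convex_family P" "Q \<subseteq> P"
    and "\<And>\<sigma> \<rho> \<tau>. \<sigma> \<in> Q \<Longrightarrow> \<rho> \<in> Q \<Longrightarrow> \<sigma> \<subseteq> \<tau> \<Longrightarrow> \<tau> \<subseteq> \<rho> \<Longrightarrow> \<tau> \<in> P \<Longrightarrow> \<tau> \<in> Q"
  shows "convex_family Q"
  unfolding convex_family_def
proof (intro conjI ballI allI impI)
  show "finite Q" using assms(1,2) finite_subset unfolding convex_family_def by blast
  show "finite \<sigma>" if "\<sigma> \<in> Q" for \<sigma>
    using assms(1,2) that unfolding convex_family_def by blast
  fix \<sigma> \<rho> \<tau> assume a: "\<sigma> \<in> Q" "\<rho> \<in> Q" "\<sigma> \<subseteq> \<tau>" "\<tau> \<subseteq> \<rho>"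
  have "\<tau> \<in> P" using assms(1,2) a unfolding convex_family_def by blast
  thus "\<tau> \<in> Q" using assms(3) a by blast
qed

lemma incidence_sign_swap:
  assumes "finite \<rho>" "x \<in> \<rho>" "y \<in> \<rho>" "x < y"
  shows "incidence_sign \<rho> y * incidence_sign (\<rho> - {y}) x =
    - (incidence_sign \<rho> x * incidence_sign (\<rho> - {x}) y :: 'k::field)"
  using incidence_sign_insert[where ?'k = 'k, of "\<rho> - {y}" y x]
    incidence_sign_insert[where ?'k = 'k, of "\<rho> - {x}" x y] assms
  by (simp add: insert_absorb)

text \<open>
  The summands for the two orders of removing two vertices cancel; the sum is split by the order
  of the two vertices, since in characteristic \<open>2\<close> a sum that equals its negative need not vanish.
\<close>

lemma coboundary_coboundary:
  fixes f :: "nat set \<Rightarrow> 'k::field"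
  assumes P: "convex_family P" and supp: "\<And>\<sigma>. f \<sigma> \<noteq> 0 \<Longrightarrow> \<sigma> \<in> P"
  shows "coboundary P (coboundary P f) = (\<lambda>_. 0)"
proof
  fix \<rho>
  show "coboundary P (coboundary P f) \<rho> = 0"
  proof (cases "\<rho> \<in> P")
    case True
    hence fin: "finite \<rho>" using P by (auto simp: convex_family_def)
    define t where "t = (\<lambda>(x, y). incidence_sign \<rho> x * incidence_sign (\<rho> - {x}) y * f (\<rho> - {x} - {y}))"
    define U where "U = {(x, y). x \<in> \<rho> \<and> y \<in> \<rho> \<and> x < y}"
    have finU: "finite U" by (rule finite_subset[of _ "\<rho> \<times> \<rho>"]) (auto simp: U_def fin)
    have in_P: "\<rho> - {x} \<in> P" if "f (\<rho> - {x} - {y}) \<noteq> 0" for x y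
    proof -
      have "\<rho> - {x} - {y} \<in> P" using supp that by blast
      moreover have "\<rho> - {x} - {y} \<subseteq> \<rho> - {x}" "\<rho> - {x} \<subseteq> \<rho>" by auto
      ultimately show ?thesis using P True unfolding convex_family_def by blast
    qed
    have "coboundary P (coboundary P f) \<rho> =
        (\<Sum>x\<in>\<rho>. incidence_sign \<rho> x * coboundary P f (\<rho> - {x}))"
      using True by (simp add: coboundary_eq)
    also have "\<dots> = (\<Sum>x\<in>\<rho>. \<Sum>y\<in>\<rho> - {x}. t (x, y))"
    proof (rule sum.cong[OF refl])
      fix x assume "x \<in> \<rho>"
      show "incidence_sign \<rho> x * coboundary P f (\<rho> - {x}) = (\<Sum>y\<in>\<rho> - {x}. t (x, y))"
      proof (cases "\<rho> - {x} \<in> P")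
        case True
        thus ?thesis by (simp add: coboundary_eq t_def sum_distrib_left mult.assoc)
      next
        case False
        hence "t (x, y) = 0" for y using in_P[of x y] by (auto simp: t_def)
        thus ?thesis using False by (simp add: coboundary_eq)
      qed
    qed
    also have "\<dots> = sum t (Sigma \<rho> (\<lambda>x. \<rho> - {x}))"
      using fin by (subst sum.Sigma) auto
    also have "Sigma \<rho> (\<lambda>x. \<rho> - {x}) = U \<union> prod.swap ` U"
      by (force simp: U_def image_iff)
    also have "sum t (U \<union> prod.swap ` U) = sum t U + sum t (prod.swap ` U)"
      using finU by (intro sum.union_disjoint) (auto simp: U_def)
    also have "sum t (prod.swap ` U) = (\<Sum>p\<in>U. t (prod.swap p))"
      by (subst sum.reindex) (auto simp: o_def)
    also have "\<dots> = (\<Sum>p\<in>U. - t p)"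
    proof (intro sum.cong refl)
      fix p assume "p \<in> U"
      then obtain x y where p: "p = (x, y)" "x \<in> \<rho>" "y \<in> \<rho>" "x < y" by (auto simp: U_def)
      have "\<rho> - {y} - {x} = \<rho> - {x} - {y}" by auto
      thus "t (prod.swap p) = - t p"
        using incidence_sign_swap[OF fin p(2-4), where ?'k = 'k] by (simp add: t_def p)
    qed
    finally show ?thesis by (simp add: sum_negf)
  qed (simp add: coboundary_eq)
qed

lemma cochains_subspace: "fn.subspace (cochains P j)"
  unfolding fn.subspace_def cochains_def by auto (metis add.right_neutral)+

abbreviation cocycles :: "nat set set \<Rightarrow> int \<Rightarrow> (nat set \<Rightarrow> 'k::field) set" where
  "cocycles P j \<equiv> {f \<in> cochains P j. coboundary P f = 0}"

abbreviation coboundaries :: "nat set set \<Rightarrow> int \<Rightarrow> (nat set \<Rightarrow> 'k::field) set" where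
  "coboundaries P j \<equiv> coboundary P ` cochains P (j - 1)"

lemma hdim_eq: "hdim TYPE('k::field) P j = qdim (cocycles P j) (coboundaries P j :: (nat set \<Rightarrow> 'k) set)"
  by (simp add: reduced_cohomology_dim_def)

lemma coboundary_in_cochains:
  assumes "\<And>\<sigma>. \<sigma> \<in> P \<Longrightarrow> finite \<sigma>" "f \<in> cochains P (j - 1)"
  shows "coboundary P f \<in> cochains P j"
  unfolding cochains_def
proof (intro CollectI allI impI)
  fix \<sigma> assume nz: "coboundary P f \<sigma> \<noteq> 0"
  hence s: "\<sigma> \<in> P" by (auto simp: coboundary_eq split: if_splits)
  with nz have "(\<Sum>x\<in>\<sigma>. incidence_sign \<sigma> x * f (\<sigma> - {x})) \<noteq> 0"
    by (simp add: coboundary_eq)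
  from sum.not_neutral_contains_not_neutral[OF this]
  obtain x where x: "x \<in> \<sigma>" "f (\<sigma> - {x}) \<noteq> 0" by auto
  have "int (card (\<sigma> - {x})) = j" using assms(2) x by (auto simp: cochains_def)
  thus "\<sigma> \<in> P \<and> int (card \<sigma>) = j + 1"
    using s x assms(1) card_Suc_Diff1[of \<sigma> x] by auto
qed

lemma cocycles_subspace: "fn.subspace (cocycles P j)"
  using cochains_subspace[of P j]
  unfolding fn.subspace_def
  by (auto simp: coboundary_add coboundary_scale coboundary_zero zero_fun_def)

lemma coboundaries_subspace:
  "fn.subspace (coboundaries P j :: (nat set \<Rightarrow> 'k::field) set)"
proof (rule fn.subspaceI)
  show "0 \<in> (coboundaries P j :: (nat set \<Rightarrow> 'k) set)"
    using fn.subspace_0[OF cochains_subspace, of P "j - 1"]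
    by (intro image_eqI[of _ _ 0]) (simp_all add: zero_fun_def coboundary_zero)
next
  fix x y :: "nat set \<Rightarrow> 'k"
  assume "x \<in> coboundaries P j" "y \<in> coboundaries P j"
  then obtain f g where fg: "f \<in> cochains P (j - 1)" "g \<in> cochains P (j - 1)"
    and "x = coboundary P f" "y = coboundary P g" by blast
  hence "x + y = coboundary P (f + g)" by (simp only: coboundary_add)
  thus "x + y \<in> coboundaries P j"
    using fn.subspace_add[OF cochains_subspace fg] by (rule image_eqI)
next
  fix c and x :: "nat set \<Rightarrow> 'k"
  assume "x \<in> coboundaries P j"
  thus "(\<lambda>t. c * x t) \<in> coboundaries P j"
    using fn.subspace_scale[OF cochains_subspace[of P "j - 1"]]
    by (auto simp flip: coboundary_scale intro!: imageI)
qed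

lemma coboundaries_subset_cocycles:
  assumes "convex_family P"
  shows "coboundaries P j \<subseteq> cocycles P j"
proof -
  have "coboundary P f \<in> cocycles P j" if "f \<in> cochains P (j - 1)" for f
    using coboundary_in_cochains[OF _ that] coboundary_coboundary[OF assms, of f] assms that
    by (auto simp: convex_family_def cochains_def zero_fun_def)
  thus ?thesis by blast
qed

lemma finite_quotient_cohomology:
  assumes "convex_family P"
  shows "finite_quotient (cocycles P j) (coboundaries P j :: (nat set \<Rightarrow> 'k::field) set)"
  unfolding finite_quotient_def
proof (intro conjI)
  show "\<exists>A. finite A \<and> (\<forall>f\<in>cocycles P j. \<forall>x. f x \<noteq> 0 \<longrightarrow> x \<in> A)"
    using assms by (intro exI[of _ P]) (auto simp: convex_family_def cochains_def)
qed (fact cocycles_subspace coboundaries_subspace coboundaries_subset_cocycles[OF assms])+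

lemma finite_quotient_between:
  assumes "finite_quotient Z B" "fn.subspace U" "B \<subseteq> U" "U \<subseteq> Z"
  shows "finite_quotient Z U" "finite_quotient U B"
proof -
  obtain A where "finite A" "\<forall>f\<in>Z. \<forall>x. f x \<noteq> 0 \<longrightarrow> x \<in> A"
    using assms(1) by (auto simp: finite_quotient_def)
  hence "\<exists>A. finite A \<and> (\<forall>f\<in>U. \<forall>x. f x \<noteq> 0 \<longrightarrow> x \<in> A)" using assms(4) by auto
  thus "finite_quotient Z U" "finite_quotient U B"
    using assms by (simp_all add: finite_quotient_def)
qed

definition restrict_cochain :: "nat set set \<Rightarrow> (nat set \<Rightarrow> 'k::field) \<Rightarrow> nat set \<Rightarrow> 'k" where
  "restrict_cochain A f \<sigma> = (if \<sigma> \<in> A then f \<sigma> else 0)"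

text \<open>
  This is a part of the long exact sequence of a pair. The cochains supported on an
  up-closed part \<open>B\<close> form a subcomplex whose quotient is the complex of \<open>A\<close>. A cohomology class of \<open>B\<close>
  either survives in the cohomology of \<open>P\<close> or is the image of a class of \<open>A\<close> under the connecting map.
\<close>

lemma hdim_subcomplex_le:
  assumes P: "convex_family P" and AB: "P = A \<union> B" "A \<inter> B = {}"
    and up: "\<And>\<sigma> \<tau>. \<sigma> \<in> B \<Longrightarrow> \<sigma> \<subseteq> \<tau> \<Longrightarrow> \<tau> \<in> P \<Longrightarrow> \<tau> \<in> B"
  shows "hdim TYPE('k::field) B j \<le> hdim TYPE('k) P j + hdim TYPE('k) A (j - 1)"
proof -
  have finP: "finite \<sigma>" if "\<sigma> \<in> P" for \<sigma> using P that by (auto simp: convex_family_def)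
  have AP: "A \<subseteq> P" and BP: "B \<subseteq> P" using AB by auto
  have B: "convex_family B"
    using P BP by (rule convex_family_subset) (rule up)
  have A: "convex_family A"
  proof (rule convex_family_subset[OF P AP])
    fix \<sigma> \<rho> \<tau> assume "\<sigma> \<in> A" "\<rho> \<in> A" "\<sigma> \<subseteq> \<tau>" "\<tau> \<subseteq> \<rho>" "\<tau> \<in> P"
    thus "\<tau> \<in> A" using up[of \<tau> \<rho>] AP AB by blast
  qed
  have dB: "coboundary P f = coboundary B f"
    if "f \<in> cochains B i" for f :: "nat set \<Rightarrow> 'k" and i
  proof
    fix \<sigma>
    have "f (\<sigma> - {x}) = 0" if "\<sigma> \<in> P" "\<sigma> \<notin> B" for x
      using up[of "\<sigma> - {x}" \<sigma>] that \<open>f \<in> cochains B i\<close> unfolding cochains_def by blast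
    thus "coboundary P f \<sigma> = coboundary B f \<sigma>"
      using BP by (auto simp: coboundary_eq)
  qed
  have dA: "coboundary A (restrict_cochain A f) \<sigma> = coboundary P f \<sigma>"
    if "\<sigma> \<in> A" "f \<in> cochains P i" for \<sigma> i and f :: "nat set \<Rightarrow> 'k"
  proof -
    have "restrict_cochain A f (\<sigma> - {x}) = f (\<sigma> - {x})" for x
    proof (cases "\<sigma> - {x} \<in> A")
      case False
      have "\<sigma> - {x} \<notin> B" using up[of "\<sigma> - {x}" \<sigma>] that(1) AP AB by blast
      hence "f (\<sigma> - {x}) = 0" using that(2) False AB unfolding cochains_def by blast
      thus ?thesis by (simp add: restrict_cochain_def)
    qed (simp add: restrict_cochain_def)
    thus ?thesis using that(1) AP by (auto simp: coboundary_eq)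
  qed
  have split: "f = restrict_cochain A f + restrict_cochain B f"
    "restrict_cochain A f \<in> cochains A i" "restrict_cochain B f \<in> cochains B i"
    if "f \<in> cochains P i" for f :: "nat set \<Rightarrow> 'k" and i
    using that AB by (auto simp: restrict_cochain_def cochains_def fun_eq_iff split: if_splits)
  have AinP: "f \<in> cochains P i" if "f \<in> cochains A i" for f :: "nat set \<Rightarrow> 'k" and i
    using that AP by (auto simp: cochains_def)
  have BinP: "f \<in> cochains P i" if "f \<in> cochains B i" for f :: "nat set \<Rightarrow> 'k" and i
    using that BP by (auto simp: cochains_def)

  \<comment> \<open>Represents the kernel of the map from the cohomology of \<open>B\<close> to that of \<open>P\<close>.\<close>
  define U :: "(nat set \<Rightarrow> 'k) set" where "U = cocycles B j \<inter> coboundaries P j"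
  have subU: "fn.subspace U"
    unfolding U_def by (intro fn.subspace_inter cocycles_subspace coboundaries_subspace)
  have BU: "coboundaries B j \<subseteq> U"
  proof -
    have "coboundary B f \<in> coboundaries P j" if "f \<in> cochains B (j - 1)" for f :: "nat set \<Rightarrow> 'k"
      using dB[OF that] BinP[OF that] by (metis image_eqI)
    thus ?thesis using coboundaries_subset_cocycles[OF B, of j] unfolding U_def by blast
  qed
  note fqB = finite_quotient_cohomology[OF B, of j, where ?'k = 'k]
  have UB: "U \<subseteq> cocycles B j" by (simp add: U_def)
  note fq1 = finite_quotient_between(1)[OF fqB subU BU UB]
  note fq2 = finite_quotient_between(2)[OF fqB subU BU UB]
  have "qdim (cocycles B j) U \<le> qdim (cocycles P j) (coboundaries P j :: (nat set \<Rightarrow> 'k) set)"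
  proof (rule qdim_le_by_relation[where R = "\<lambda>x y. x = y \<and> x \<in> cocycles B j",
        OF fq1 finite_quotient_cohomology[OF P]])
    fix x :: "nat set \<Rightarrow> 'k" assume "x \<in> cocycles B j"
    thus "\<exists>x'\<in>cocycles P j. x = x' \<and> x \<in> cocycles B j"
      using dB[of x j] BinP[of x j] by auto
  next
    fix x y x' y' :: "nat set \<Rightarrow> 'k"
    assume "x = x' \<and> x \<in> cocycles B j" "y = y' \<and> y \<in> cocycles B j"
    hence e: "x = x'" "y = y'" and xy: "x \<in> cocycles B j" "y \<in> cocycles B j"
      by blast+
    show "x + y = x' + y' \<and> x + y \<in> cocycles B j"
      using fn.subspace_add[OF cocycles_subspace xy] e by (simp only: simp_thms)
  next
    fix c and x x' :: "nat set \<Rightarrow> 'k"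
    assume "x = x' \<and> x \<in> cocycles B j"
    hence e: "x = x'" and x: "x \<in> cocycles B j" by blast+
    show "(\<lambda>t. c * x t) = (\<lambda>t. c * x' t) \<and> (\<lambda>t. c * x t) \<in> cocycles B j"
      using fn.subspace_scale[OF cocycles_subspace x] e by (simp only: simp_thms)
  qed (auto simp: U_def)
  moreover have "qdim U (coboundaries B j) \<le>
      qdim (cocycles A (j - 1)) (coboundaries A (j - 1) :: (nat set \<Rightarrow> 'k) set)"
  proof (rule qdim_le_by_relation[OF fq2 finite_quotient_cohomology[OF A],
        where R = "\<lambda>u a. a \<in> cochains A (j - 1) \<and> (\<exists>b\<in>cochains B (j - 1). u = coboundary P (a + b))"])
    fix x y x' y' :: "nat set \<Rightarrow> 'k"
    assume "x' \<in> cochains A (j - 1) \<and> (\<exists>b\<in>cochains B (j - 1). x = coboundary P (x' + b))"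
      and "y' \<in> cochains A (j - 1) \<and> (\<exists>b\<in>cochains B (j - 1). y = coboundary P (y' + b))"
    then obtain b b' where b: "x' \<in> cochains A (j - 1)" "y' \<in> cochains A (j - 1)"
      "b \<in> cochains B (j - 1)" "b' \<in> cochains B (j - 1)"
      "x = coboundary P (x' + b)" "y = coboundary P (y' + b')" by blast
    have "x + y = coboundary P ((x' + y') + (b + b'))"
      unfolding b(5,6) coboundary_add by (simp only: ac_simps)
    thus "x' + y' \<in> cochains A (j - 1) \<and>
        (\<exists>b\<in>cochains B (j - 1). x + y = coboundary P ((x' + y') + b))"
      using fn.subspace_add[OF cochains_subspace b(1,2)] fn.subspace_add[OF cochains_subspace b(3,4)]
      by (intro conjI bexI)
  next
    fix c and x x' :: "nat set \<Rightarrow> 'k"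
    assume "x' \<in> cochains A (j - 1) \<and> (\<exists>b\<in>cochains B (j - 1). x = coboundary P (x' + b))"
    then obtain b where b: "x' \<in> cochains A (j - 1)" "b \<in> cochains B (j - 1)"
      "x = coboundary P (x' + b)" by blast
    have "(\<lambda>t. c * x t) = coboundary P ((\<lambda>t. c * x' t) + (\<lambda>t. c * b t))"
      unfolding b(3) coboundary_scale[symmetric]
      by (rule arg_cong[where f = "coboundary P"]) (simp add: fun_eq_iff algebra_simps)
    thus "(\<lambda>t. c * x' t) \<in> cochains A (j - 1) \<and>
        (\<exists>b\<in>cochains B (j - 1). (\<lambda>t. c * x t) = coboundary P ((\<lambda>t. c * x' t) + b))"
      using fn.subspace_scale[OF cochains_subspace b(1)] fn.subspace_scale[OF cochains_subspace b(2)]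
      by (intro conjI bexI)
  next
    fix u :: "nat set \<Rightarrow> 'k" assume u: "u \<in> U"
    then obtain f where f: "f \<in> cochains P (j - 1)" "u = coboundary P f"
      by (auto simp: U_def)
    have "coboundary A (restrict_cochain A f) \<sigma> = 0" for \<sigma>
    proof (cases "\<sigma> \<in> A")
      case True
      have "u \<sigma> = 0" using u True AB(2) unfolding U_def cochains_def by blast
      thus ?thesis using dA[OF True f(1)] f(2) by simp
    qed (simp add: coboundary_eq)
    hence "restrict_cochain A f \<in> cocycles A (j - 1)"
      using split(2)[OF f(1)] by (simp add: fun_eq_iff)
    moreover have "u = coboundary P (restrict_cochain A f + restrict_cochain B f)"
      using f(2) split(1)[OF f(1)] by simp
    ultimately show "\<exists>a\<in>cocycles A (j - 1). a \<in> cochains A (j - 1) \<and>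
        (\<exists>b\<in>cochains B (j - 1). u = coboundary P (a + b))"
      using split(2,3)[OF f(1)] by blast
  next
    fix u a :: "nat set \<Rightarrow> 'k"
    assume "a \<in> cochains A (j - 1) \<and> (\<exists>b\<in>cochains B (j - 1). u = coboundary P (a + b))"
      and "a \<in> coboundaries A (j - 1)"
    then obtain a' b where a': "a' \<in> cochains A (j - 1 - 1)" "a = coboundary A a'"
      and b: "b \<in> cochains B (j - 1)" "u = coboundary P (a + b)" by blast
    define h where "h = coboundary P a'"
    have h: "h \<in> cochains P (j - 1)"
      unfolding h_def using coboundary_in_cochains[OF finP AinP[OF a'(1)]] by blast
    have "restrict_cochain A h = a"
    proof
      fix \<sigma>
      have "restrict_cochain A a' = a'"
        using a'(1) by (auto simp: restrict_cochain_def cochains_def fun_eq_iff)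
      thus "restrict_cochain A h \<sigma> = a \<sigma>"
        using dA[OF _ AinP[OF a'(1)], of \<sigma>] a'(2)
        by (cases "\<sigma> \<in> A") (simp_all add: restrict_cochain_def h_def coboundary_eq)
    qed
    hence hs: "h = a + restrict_cochain B h" using split(1)[OF h] by simp
    have "coboundary P h = (\<lambda>_. 0)"
      unfolding h_def
      by (rule coboundary_coboundary[OF P]) (use AinP[OF a'(1)] in \<open>auto simp: cochains_def\<close>)
    hence "u = coboundary P (a + b) - coboundary P h"
      unfolding b(2) by (simp add: fun_eq_iff)
    also have "\<dots> = coboundary P ((a + b) - (a + restrict_cochain B h))"
      unfolding coboundary_diff[symmetric] using hs by simp
    also have "(a + b) - (a + restrict_cochain B h) = b - restrict_cochain B h"
      by (simp add: fun_eq_iff)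
    finally have "u = coboundary P (b - restrict_cochain B h)" .
    moreover have bh: "b - restrict_cochain B h \<in> cochains B (j - 1)"
      using fn.subspace_diff[OF cochains_subspace b(1) split(3)[OF h]] .
    ultimately show "u \<in> coboundaries B j" using dB[OF bh] by blast
  qed
  moreover have "hdim TYPE('k) B j = qdim (cocycles B j) U + qdim U (coboundaries B j)"
    unfolding hdim_eq by (rule qdim_trans[OF fq1 fq2])
  ultimately show ?thesis unfolding hdim_eq by linarith
qed

lemma hdim_empty_degree:
  assumes "\<And>\<sigma>. \<sigma> \<in> P \<Longrightarrow> int (card \<sigma>) \<noteq> j + 1" and "convex_family P"
  shows "hdim TYPE('k::field) P j = 0"
proof -
  have "cochains P j \<subseteq> {0 :: nat set \<Rightarrow> 'k}"
    using assms(1) by (fastforce simp: cochains_def)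
  hence "cocycles P j = {0 :: nat set \<Rightarrow> 'k}"
    using fn.subspace_0[OF cocycles_subspace[of P j]] by blast
  moreover have "coboundaries P j = {0 :: nat set \<Rightarrow> 'k}"
    using calculation coboundaries_subset_cocycles[OF assms(2), of j]
      fn.subspace_0[OF coboundaries_subspace[of P j]] by blast
  ultimately show ?thesis by (simp add: hdim_eq qdim_zero_space)
qed

text \<open>
  All sets have the same size, so every cochain is a cocycle and only \<open>0\<close> is a coboundary.
\<close>

lemma hdim_antichain_pos:
  assumes "\<And>\<sigma>. \<sigma> \<in> P \<Longrightarrow> card \<sigma> = d" "convex_family P" "\<sigma>\<^sub>0 \<in> P"
  shows "hdim TYPE('k::field) P (int d - 1) \<ge> 1"
proof -
  have "cochains P (int d - 1 - 1) \<subseteq> {0 :: nat set \<Rightarrow> 'k}"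
    using assms(1) by (fastforce simp: cochains_def)
  hence B0: "coboundaries P (int d - 1) \<subseteq> {0 :: nat set \<Rightarrow> 'k}"
    by (auto simp: coboundary_eq fun_eq_iff)
  define f :: "nat set \<Rightarrow> 'k" where "f \<sigma> = (if \<sigma> = \<sigma>\<^sub>0 then 1 else 0)" for \<sigma>
  have f: "f \<in> cochains P (int d - 1)" using assms by (auto simp: f_def cochains_def)
  have "coboundary P f \<sigma> = 0" for \<sigma>
  proof (rule ccontr)
    assume "coboundary P f \<sigma> \<noteq> 0"
    moreover have "coboundary P f \<in> cochains P (int d - 1 + 1)"
      using coboundary_in_cochains[of P f "int d - 1 + 1"] f assms(2) by (auto simp: convex_family_def)
    ultimately show False using assms(1) by (fastforce simp: cochains_def)
  qed
  hence "f \<in> cocycles P (int d - 1)" using f by (simp add: fun_eq_iff)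
  moreover have "f \<noteq> 0" by (auto simp: f_def fun_eq_iff)
  ultimately have nt: "\<not> cocycles P (int d - 1) \<subseteq> {0 :: nat set \<Rightarrow> 'k}" by blast
  note fq = finite_quotient_cohomology[OF assms(2), of "int d - 1", where ?'k = 'k]
  show ?thesis
  proof (rule ccontr)
    assume "\<not> ?thesis"
    hence "qdim (cocycles P (int d - 1)) (coboundaries P (int d - 1) :: (nat set \<Rightarrow> 'k) set) = 0"
      by (simp add: hdim_eq)
    moreover obtain S where S: "quotient_basis (\<lambda>c f x. c * f x) (cocycles P (int d - 1))
        (coboundaries P (int d - 1) :: (nat set \<Rightarrow> 'k) set) S"
      "card S = qdim (cocycles P (int d - 1)) (coboundaries P (int d - 1) :: (nat set \<Rightarrow> 'k) set)"
      by (rule qdim_basis[OF fq])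
    ultimately have "S = {}" using quotient_basis_card(1)[OF fq S(1)] by simp
    hence "cocycles P (int d - 1) = fn.span (coboundaries P (int d - 1) :: (nat set \<Rightarrow> 'k) set)"
      using quotient_basisD(2)[OF S(1)] by simp
    also have "\<dots> = coboundaries P (int d - 1)"
      using coboundaries_subspace[of P "int d - 1", where ?'k = 'k] by (simp only: fn.span_eq_iff)
    finally show False using nt B0 by simp
  qed
qed


section \<open>The colour filtration\<close>

text \<open>
  The function \<open>c\<close> assigns to a face its set of colours. The bands with \<open>I = {}\<close> are full subcomplexes,
  and adding colours to \<open>I\<close> is the combinatorial form of inverting the corresponding variables.
\<close>

definition colour_band :: "nat set set \<Rightarrow> (nat set \<Rightarrow> nat set) \<Rightarrow> nat set \<Rightarrow> nat set \<Rightarrow> nat set set" where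
  "colour_band K c I L = {\<sigma> \<in> K. I \<subseteq> c \<sigma> \<and> c \<sigma> \<subseteq> I \<union> L}"

lemma convex_colour_band:
  assumes "convex_family K" "mono c"
  shows "convex_family (colour_band K c I L)"
proof (rule convex_family_subset[OF assms(1)])
  fix \<sigma> \<rho> \<tau> assume a: "\<sigma> \<in> colour_band K c I L" "\<rho> \<in> colour_band K c I L" "\<sigma> \<subseteq> \<tau>" "\<tau> \<subseteq> \<rho>" "\<tau> \<in> K"
  have "c \<sigma> \<subseteq> c \<tau>" "c \<tau> \<subseteq> c \<rho>" using monoD[OF assms(2)] a by blast+
  thus "\<tau> \<in> colour_band K c I L" using a unfolding colour_band_def by blast
qed (auto simp: colour_band_def)

lemma hdim_colour_band_le:
  assumes "convex_family K" "mono c" "i \<notin> I" "i \<notin> L"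
  shows "hdim TYPE('k::field) (colour_band K c (insert i I) L) j
    \<le> hdim TYPE('k) (colour_band K c I (insert i L)) j + hdim TYPE('k) (colour_band K c I L) (j - 1)"
proof (rule hdim_subcomplex_le)
  show "convex_family (colour_band K c I (insert i L))" by (rule convex_colour_band) fact+
  show "colour_band K c I (insert i L) = colour_band K c I L \<union> colour_band K c (insert i I) L"
    "colour_band K c I L \<inter> colour_band K c (insert i I) L = {}"
    using assms(3,4) by (auto simp: colour_band_def)
next
  fix \<sigma> \<tau>
  assume a: "\<sigma> \<in> colour_band K c (insert i I) L" "\<sigma> \<subseteq> \<tau>" "\<tau> \<in> colour_band K c I (insert i L)"
  have "c \<sigma> \<subseteq> c \<tau>" using monoD[OF assms(2)] a by blast
  thus "\<tau> \<in> colour_band K c (insert i I) L"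
    using a by (auto simp: colour_band_def)
qed

definition band_betti_sum ::
    "'k::field itself \<Rightarrow> nat set set \<Rightarrow> (nat set \<Rightarrow> nat set) \<Rightarrow> nat set \<Rightarrow> nat \<Rightarrow> nat set \<Rightarrow> nat" where
  "band_betti_sum k K c R q I =
     (\<Sum>L\<in>Pow (R - I). hdim k (colour_band K c I L) (int (card I) + int (card L) - int q - 1))"

lemma sum_Pow_insert:
  assumes "finite M" "i \<notin> M"
  shows "(\<Sum>L\<in>Pow (insert i M). f L) = (\<Sum>L\<in>Pow M. f L + f (insert i L))"
proof -
  have "(\<Sum>L\<in>Pow (insert i M). f L) = (\<Sum>L\<in>Pow M. f L) + (\<Sum>L\<in>insert i ` Pow M. f L)"
    unfolding Pow_insert using assms by (intro sum.union_disjoint) auto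
  also have "(\<Sum>L\<in>insert i ` Pow M. f L) = (\<Sum>L\<in>Pow M. f (insert i L))"
    using assms by (subst sum.reindex) (auto simp: inj_on_def insert_ident)
  finally show ?thesis by (simp add: sum.distrib)
qed

text \<open>
  The sets \<open>L\<close> not containing \<open>i\<close> and their unions with \<open>{i}\<close> supply exactly the two terms that bound a
  term of the left-hand side in \<open>hdim_colour_band_le\<close>.
\<close>

lemma band_betti_sum_insert_le:
  assumes K: "convex_family K" "mono c" and R: "finite R" "I \<subseteq> R" "i \<in> R - I"
  shows "band_betti_sum TYPE('k::field) K c R q (insert i I) \<le> band_betti_sum TYPE('k) K c R q I"
proof -
  define M where "M = R - insert i I"
  have M: "finite M" "i \<notin> M" "insert i M = R - I" using R by (auto simp: M_def)
  have finI: "finite I" using R finite_subset by blast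
  have "band_betti_sum TYPE('k) K c R q (insert i I) =
      (\<Sum>L\<in>Pow M. hdim TYPE('k) (colour_band K c (insert i I) L) (int (card I) + int (card L) - int q))"
    unfolding band_betti_sum_def M_def using R finI by (intro sum.cong) (auto simp: add_diff_eq)
  also have "\<dots> \<le> (\<Sum>L\<in>Pow M.
      hdim TYPE('k) (colour_band K c I L) (int (card I) + int (card L) - int q - 1) +
      hdim TYPE('k) (colour_band K c I (insert i L)) (int (card I) + int (card (insert i L)) - int q - 1))"
  proof (rule sum_mono)
    fix L assume L: "L \<in> Pow M"
    hence "finite L" "i \<notin> L" using M finite_subset by auto
    thus "hdim TYPE('k) (colour_band K c (insert i I) L) (int (card I) + int (card L) - int q) \<le>
      hdim TYPE('k) (colour_band K c I L) (int (card I) + int (card L) - int q - 1) +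
      hdim TYPE('k) (colour_band K c I (insert i L)) (int (card I) + int (card (insert i L)) - int q - 1)"
      using hdim_colour_band_le[OF K, of i I L "int (card I) + int (card L) - int q", where ?'k = 'k] R(3)
      by (simp add: algebra_simps)
  qed
  also have "\<dots> = band_betti_sum TYPE('k) K c R q I"
    unfolding band_betti_sum_def M(3)[symmetric] sum_Pow_insert[OF M(1,2)] ..
  finally show ?thesis .
qed

lemma band_betti_sum_le:
  assumes K: "convex_family K" "mono c" and R: "finite R" "J \<subseteq> R"
  shows "band_betti_sum TYPE('k::field) K c R q J \<le> band_betti_sum TYPE('k) K c R q {}"
  using finite_subset[OF R(2,1)] R(2)
proof (induction J rule: finite_induct)
  case (insert i J)
  thus ?case
    using band_betti_sum_insert_le[OF K R(1), of J i q, where ?'k = 'k] by fastforce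
qed simp

text \<open>
  A face with all the colours of the largest face has no further colours, because it
  has no more vertices. The band is thus an antichain, in the degree that belongs to the sets \<open>L\<close>
  with \<open>q\<close> elements.
\<close>

lemma band_betti_sum_facet:
  assumes K: "convex_family K" and R: "finite R"
    and c: "\<And>\<sigma>. \<sigma> \<in> K \<Longrightarrow> card (c \<sigma>) = card \<sigma> \<and> c \<sigma> \<subseteq> R" "mono c"
    and facet: "\<sigma>\<^sub>0 \<in> K" "\<And>\<sigma>. \<sigma> \<in> K \<Longrightarrow> card \<sigma> \<le> card \<sigma>\<^sub>0"
  shows "(card R - card \<sigma>\<^sub>0) choose q \<le> band_betti_sum TYPE('k::field) K c R q (c \<sigma>\<^sub>0)"
proof -
  define J where "J = c \<sigma>\<^sub>0"
  have J: "J \<subseteq> R" "card J = card \<sigma>\<^sub>0" using c facet by (auto simp: J_def)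
  have finJ: "finite J" using J(1) R finite_subset by blast
  have finRJ: "finite (R - J)" using R by simp
  have one: "1 \<le> hdim TYPE('k) (colour_band K c J L) (int (card J) + int (card L) - int q - 1)"
    if L: "L \<in> Pow (R - J)" "card L = q" for L
  proof -
    have "card \<sigma> = card J" if "\<sigma> \<in> colour_band K c J L" for \<sigma>
    proof -
      have s: "\<sigma> \<in> K" "J \<subseteq> c \<sigma>" using that by (auto simp: colour_band_def)
      have "card J \<le> card (c \<sigma>)"
        using c(1)[OF s(1)] R finite_subset s(2) card_mono by metis
      thus ?thesis using c(1)[OF s(1)] facet(2)[OF s(1)] J(2) by linarith
    qed
    moreover have "\<sigma>\<^sub>0 \<in> colour_band K c J L" using facet by (auto simp: colour_band_def J_def)
    ultimately have "1 \<le> hdim TYPE('k) (colour_band K c J L) (int (card J) - 1)"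
      using hdim_antichain_pos[OF _ convex_colour_band[OF K c(2)]] by blast
    thus ?thesis using L by simp
  qed
  have "(card R - card \<sigma>\<^sub>0) choose q = card {L. L \<subseteq> R - J \<and> card L = q}"
    using n_subsets[OF finRJ, of q] card_Diff_subset[OF finJ J(1)] J(2) by simp
  also have "\<dots> = (\<Sum>L | L \<subseteq> R - J \<and> card L = q. 1)" by simp
  also have "\<dots> \<le> (\<Sum>L | L \<subseteq> R - J \<and> card L = q.
      hdim TYPE('k) (colour_band K c J L) (int (card J) + int (card L) - int q - 1))"
    using one by (intro sum_mono) blast
  also have "\<dots> \<le> (\<Sum>L\<in>Pow (R - J).
      hdim TYPE('k) (colour_band K c J L) (int (card J) + int (card L) - int q - 1))"
    using finRJ by (intro sum_mono2) auto
  finally show ?thesis unfolding band_betti_sum_def J_def .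
qed


section \<open>Zigzags in exact double complexes\<close>

text \<open>
  The double complex is a commuting grid in the first quadrant with both differentials lowering an
  index. Each differential is exact wherever its index is positive; at index \<open>0\<close> the
  cokernels of \<open>d\<close> and of \<open>e\<close> are the two edge complexes.
\<close>

locale exact_double_complex =
  fixes C :: "nat \<Rightarrow> nat \<Rightarrow> 'v::ab_group_add set"
    and d e :: "nat \<Rightarrow> nat \<Rightarrow> 'v \<Rightarrow> 'v"
  assumes diff_closed: "x \<in> C a b \<Longrightarrow> y \<in> C a b \<Longrightarrow> x - y \<in> C a b"
    and d_closed: "x \<in> C (Suc a) b \<Longrightarrow> d a b x \<in> C a b"
    and e_closed: "x \<in> C a (Suc b) \<Longrightarrow> e a b x \<in> C a b"
    and d_diff: "x \<in> C (Suc a) b \<Longrightarrow> y \<in> C (Suc a) b \<Longrightarrow> d a b (x - y) = d a b x - d a b y"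
    and e_diff: "x \<in> C a (Suc b) \<Longrightarrow> y \<in> C a (Suc b) \<Longrightarrow> e a b (x - y) = e a b x - e a b y"
    and commute: "x \<in> C (Suc a) (Suc b) \<Longrightarrow> d a b (e (Suc a) b x) = e a b (d a (Suc b) x)"
    and d_d: "x \<in> C (Suc (Suc a)) b \<Longrightarrow> d a b (d (Suc a) b x) = 0"
    and e_e: "x \<in> C a (Suc (Suc b)) \<Longrightarrow> e a b (e a (Suc b) x) = 0"
    and d_exact: "x \<in> C (Suc a) b \<Longrightarrow> d a b x = 0 \<Longrightarrow> x \<in> d (Suc a) b ` C (Suc (Suc a)) b"
    and e_exact: "x \<in> C a (Suc b) \<Longrightarrow> e a b x = 0 \<Longrightarrow> x \<in> e a (Suc b) ` C a (Suc (Suc b))"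
begin

text \<open>
  A zigzag is a cycle of the total complex up to signs, which the commuting (rather than anticommuting)
  squares make unnecessary.
\<close>

definition zigzag :: "nat \<Rightarrow> (nat \<Rightarrow> 'v) \<Rightarrow> bool" where
  "zigzag i f \<longleftrightarrow> (\<forall>a\<le>i. f a \<in> C a (i - a)) \<and>
     (\<forall>a<i. d a (i - Suc a) (f (Suc a)) = e a (i - Suc a) (f a))"

text \<open>
  The next entry of a zigzag is a \<open>d\<close>-preimage of the \<open>e\<close>-image of the last one. The premise \<open>cyc\<close> says that
  \<open>x\<close> represents a cycle of the cokernel of \<open>d\<close>; it supplies the first step, where exactness of \<open>d\<close> is not
  available.
\<close>

lemma zigzag_from_first:
  assumes x: "x \<in> C 0 i" and cyc: "\<And>b. i = Suc b \<Longrightarrow> e 0 b x \<in> d 0 b ` C (Suc 0) b"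
  shows "\<exists>f. zigzag i f \<and> f 0 = x"
proof -
  have "\<exists>f. f 0 = x \<and> (\<forall>a\<le>k. f a \<in> C a (i - a)) \<and>
      (\<forall>a<k. d a (i - Suc a) (f (Suc a)) = e a (i - Suc a) (f a))" if "k \<le> i" for k
    using that
  proof (induction k)
    case 0
    thus ?case using x by (intro exI[of _ "\<lambda>_. x"]) simp
  next
    case (Suc k)
    then obtain f where f: "f 0 = x" "\<And>a. a \<le> k \<Longrightarrow> f a \<in> C a (i - a)"
      "\<And>a. a < k \<Longrightarrow> d a (i - Suc a) (f (Suc a)) = e a (i - Suc a) (f a)" by auto
    define b where "b = i - Suc k"
    have b: "i - k = Suc b" using Suc.prems by (simp add: b_def)
    have fk: "f k \<in> C k (Suc b)" using f(2)[of k] b by simp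
    have "e k b (f k) \<in> d k b ` C (Suc k) b"
    proof (cases k)
      case 0
      thus ?thesis using cyc[of b] b f(1) by simp
    next
      case (Suc l)
      have l: "i - l = Suc (Suc b)" using b Suc by simp
      have "d l b (e k b (f k)) = e l b (d l (Suc b) (f k))"
        using commute[of "f k" l b] fk Suc by simp
      also have "d l (Suc b) (f k) = e l (Suc b) (f l)"
        using f(3)[of l] Suc b by simp
      also have "e l b \<dots> = 0" using e_e[of "f l" l b] f(2)[of l] Suc l by simp
      finally show ?thesis using d_exact[of "e k b (f k)" l b] e_closed[OF fk] Suc by simp
    qed
    then obtain y where y: "y \<in> C (Suc k) b" "d k b y = e k b (f k)" by auto
    show ?case
    proof (intro exI[of _ "f(Suc k := y)"] conjI allI impI)
      show "(f(Suc k := y)) a \<in> C a (i - a)" if "a \<le> Suc k" for a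
        using that f(2) y(1) by (cases "a = Suc k") (auto simp: b_def)
      show "d a (i - Suc a) ((f(Suc k := y)) (Suc a)) = e a (i - Suc a) ((f(Suc k := y)) a)"
        if "a < Suc k" for a
        using that f(3) y(2) by (cases "a = k") (auto simp: b_def)
    qed (simp add: f(1))
  qed
  from this[of i] show ?thesis unfolding zigzag_def by auto
qed

text \<open>
  If the start of a zigzag is a boundary modulo the image of \<open>d\<close>, then so is every later entry: subtracting
  the \<open>e\<close>-image of the \<open>d\<close>-witness leaves a \<open>d\<close>-cycle.
\<close>

lemma zigzag_boundary:
  assumes f: "zigzag i f"
    and "f 0 = e 0 i u + d 0 i v" "u \<in> C 0 (Suc i)" "v \<in> C (Suc 0) i"
  shows "\<exists>u\<in>C i (Suc 0). \<exists>v\<in>C (Suc i) 0. f i = e i 0 u + d i 0 v"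
proof -
  have "\<exists>u\<in>C a (Suc (i - a)). \<exists>v\<in>C (Suc a) (i - a). f a = e a (i - a) u + d a (i - a) v"
    if "a \<le> i" for a
    using that
  proof (induction a)
    case 0
    thus ?case using assms(2-4) by auto
  next
    case (Suc a)
    define b where "b = i - Suc a"
    have b: "i - a = Suc b" using Suc.prems by (simp add: b_def)
    obtain u v where uv: "u \<in> C a (Suc (Suc b))" "v \<in> C (Suc a) (Suc b)"
      "f a = e a (Suc b) u + d a (Suc b) v"
      using Suc.IH Suc.prems b by auto
    have fS: "f (Suc a) \<in> C (Suc a) b" and fa: "f a \<in> C a (Suc b)"
      using f Suc.prems b unfolding zigzag_def b_def by (auto dest: spec[of _ a])
    have fd: "d a b (f (Suc a)) = e a b (f a)"
      using f Suc.prems unfolding zigzag_def b_def by auto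
    let ?g = "f (Suc a) - e (Suc a) b v"
    have g: "?g \<in> C (Suc a) b" using diff_closed[OF fS e_closed[OF uv(2)]] .
    have "d a b ?g = e a b (f a) - e a b (d a (Suc b) v)"
      using d_diff[OF fS e_closed[OF uv(2)]] commute[OF uv(2)] fd by simp
    also have "\<dots> = e a b (f a - d a (Suc b) v)"
      using e_diff[OF fa d_closed[OF uv(2)]] by simp
    also have "\<dots> = 0" using e_e[OF uv(1)] uv(3) by simp
    finally obtain w where "w \<in> C (Suc (Suc a)) b" "?g = d (Suc a) b w"
      using d_exact[OF g] by auto
    moreover have "f (Suc a) = e (Suc a) b v + ?g" by simp
    ultimately show ?case using uv(2) unfolding b_def[symmetric] by metis
  qed
  from this[of i] show ?thesis by simp
qed

end

text \<open>
  The axioms are symmetric in the two differentials, so each of the two lemmas above also holds with the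
  start and the end of a zigzag exchanged.
\<close>

sublocale exact_double_complex \<subseteq> transpose:
  exact_double_complex "\<lambda>a b. C b a" "\<lambda>a b. e b a" "\<lambda>a b. d b a"
  by unfold_locales
    (use diff_closed d_closed e_closed d_diff e_diff commute d_d e_e d_exact e_exact in auto)

context exact_double_complex
begin

lemma zigzag_reverse:
  assumes "transpose.zigzag i f"
  shows "zigzag i (\<lambda>a. f (i - a))"
  unfolding zigzag_def
proof (intro conjI allI impI)
  fix a assume "a \<le> i"
  thus "f (i - a) \<in> C a (i - a)"
    using assms unfolding transpose.zigzag_def by (auto dest: spec[of _ "i - a"])
next
  fix a assume a: "a < i"
  hence "e a (i - Suc a) (f (Suc (i - Suc a))) = d a (i - Suc a) (f (i - Suc a))"
    using assms unfolding transpose.zigzag_def by (auto dest: spec[of _ "i - Suc a"])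
  thus "d a (i - Suc a) (f (i - Suc a)) = e a (i - Suc a) (f (i - a))"
    using a by (simp add: Suc_diff_Suc)
qed

lemma zigzag_from_last:
  assumes x: "x \<in> C i 0" and cyc: "\<And>a. i = Suc a \<Longrightarrow> d a 0 x \<in> e a 0 ` C a (Suc 0)"
  shows "\<exists>f. zigzag i f \<and> f i = x"
proof -
  obtain f where "transpose.zigzag i f" "f 0 = x"
    using transpose.zigzag_from_first[OF x cyc] by blast
  thus ?thesis using zigzag_reverse by (intro exI[of _ "\<lambda>a. f (i - a)"]) auto
qed

end

lemma (in exact_double_complex) zigzag_boundary_last:
  assumes f: "zigzag i f"
    and "f i = e i 0 u + d i 0 v" "u \<in> C i (Suc 0)" "v \<in> C (Suc i) 0"
  shows "\<exists>u\<in>C 0 (Suc i). \<exists>v\<in>C (Suc 0) i. f 0 = e 0 i u + d 0 i v"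
proof -
  have "transpose.zigzag i (\<lambda>a. f (i - a))"
    unfolding transpose.zigzag_def
  proof (intro conjI allI impI)
    fix a assume "a \<le> i"
    thus "f (i - a) \<in> C (i - a) a" using f unfolding zigzag_def by (auto dest: spec[of _ "i - a"])
  next
    fix a assume a: "a < i"
    hence "d (i - Suc a) a (f (Suc (i - Suc a))) = e (i - Suc a) a (f (i - Suc a))"
      using f unfolding zigzag_def by (auto dest: spec[of _ "i - Suc a"])
    thus "e (i - Suc a) a (f (i - Suc a)) = d (i - Suc a) a (f (i - a))"
      using a by (simp add: Suc_diff_Suc)
  qed
  from transpose.zigzag_boundary[OF this, of v u] assms(2-4) show ?thesis
    by (force simp: add.commute)
qed


section \<open>Strands of maps of graded free modules\<close>

abbreviation (input) lookup where "lookup \<equiv> Poly_Mapping.lookup"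
abbreviation (input) keys where "keys \<equiv> Poly_Mapping.keys"
abbreviation (input) single where "single \<equiv> Poly_Mapping.single"

definition exp_le :: "expo \<Rightarrow> expo \<Rightarrow> bool" where
  "exp_le c a \<longleftrightarrow> (\<forall>x. lookup c x \<le> lookup a x)"

lemma exp_le_diff_add: "exp_le c a \<Longrightarrow> a - c + c = a"
  by (rule poly_mapping_eqI) (simp add: exp_le_def lookup_add lookup_minus)

lemma exp_le_add [simp]: "exp_le c (t + c)" "exp_le c (c + t)"
  by (simp_all add: exp_le_def lookup_add)

lemma exp_le_refl [simp]: "exp_le c c"
  by (simp add: exp_le_def)

lemma exp_le_trans: "exp_le a b \<Longrightarrow> exp_le b c \<Longrightarrow> exp_le a c"
  unfolding exp_le_def using order_trans by blast

lemma exp_le_antisym: "exp_le a b \<Longrightarrow> exp_le b a \<Longrightarrow> a = b"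
  by (rule poly_mapping_eqI) (simp add: exp_le_def order_antisym)

lemma exp_diff_eq_0_iff:
  assumes "exp_le c a"
  shows "a - c = 0 \<longleftrightarrow> c = a"
proof
  assume "a - c = 0"
  thus "c = a" using exp_le_diff_add[OF assms] by simp
qed simp

lemma lookup_single_mult:
  fixes p :: "'k::field mpoly"
  shows "lookup (single t z * p) s =
    (if exp_le t s then z * lookup p (s - t) else 0)"
proof -
  have w: "(\<Sum>q. (lookup p q when s = t + q)) =
      (if exp_le t s then lookup p (s - t) else 0)"
  proof (cases "exp_le t s")
    case True
    hence "s = t + q \<longleftrightarrow> q = s - t" for q
      using exp_le_diff_add[OF True] by (metis add.commute add_diff_cancel_left')
    thus ?thesis using True by simp
  next
    case False
    hence "s \<noteq> t + q" for q by auto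
    thus ?thesis using False by simp
  qed
  have "lookup (single t z * p) s =
      (\<Sum>l. (z * (\<Sum>q. (lookup p q when s = l + q)) when l = t))"
    unfolding lookup_mult lookup_single by (intro Sum_any.cong) (simp add: when_def)
  also have "\<dots> = z * (\<Sum>q. (lookup p q when s = t + q))"
    by simp
  finally show ?thesis unfolding w by simp
qed

lemma degrees_add: "a \<in> degrees m \<Longrightarrow> b \<in> degrees m \<Longrightarrow> a + b \<in> degrees m"
  using keys_add[of a b] by (auto simp: degrees_def)

lemma degrees_diff: "a \<in> degrees m \<Longrightarrow> a - b \<in> degrees m"
  by (force simp: degrees_def in_keys_iff lookup_minus)

text \<open>
  The component of degree \<open>a\<close> of a vector of polynomials: in degree \<open>a\<close> the free module has one basis
  element for each generator of degree at most \<open>a\<close>, so the component is a vector of scalars.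
\<close>

definition strand :: "(nat \<Rightarrow> expo) \<Rightarrow> expo \<Rightarrow> (nat \<Rightarrow> 'k::field mpoly) \<Rightarrow> nat \<Rightarrow> 'k" where
  "strand g a x b = (if exp_le (g b) a then lookup (x b) (a - g b) else 0)"

definition strand_space :: "nat \<Rightarrow> (nat \<Rightarrow> expo) \<Rightarrow> expo \<Rightarrow> (nat \<Rightarrow> 'k::field) set" where
  "strand_space n g a = {u. \<forall>b. u b \<noteq> 0 \<longrightarrow> b < n \<and> exp_le (g b) a}"

definition strand_vector :: "(nat \<Rightarrow> expo) \<Rightarrow> expo \<Rightarrow> (nat \<Rightarrow> 'k::field) \<Rightarrow> nat \<Rightarrow> 'k mpoly" where
  "strand_vector g a u b = (if exp_le (g b) a then single (a - g b) (u b) else 0)"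

definition scalar_map :: "nat \<Rightarrow> nat \<Rightarrow> (nat \<Rightarrow> nat \<Rightarrow> 'k::field) \<Rightarrow> (nat \<Rightarrow> 'k) \<Rightarrow> nat \<Rightarrow> 'k" where
  "scalar_map l n A u b = (if b < l then \<Sum>c<n. A b c * u c else 0)"

text \<open>
  A homogeneous matrix of degree \<open>0\<close> has multiples of one monomial as entries; \<open>A\<close> consists of the scalars.
\<close>

definition homogeneous_matrix ::
    "nat \<Rightarrow> nat \<Rightarrow> (nat \<Rightarrow> expo) \<Rightarrow> (nat \<Rightarrow> expo) \<Rightarrow> (nat \<Rightarrow> nat \<Rightarrow> 'k::field) \<Rightarrow> (nat \<Rightarrow> nat \<Rightarrow> 'k mpoly) \<Rightarrow> bool"
  where
  "homogeneous_matrix l n g h A D \<longleftrightarrow> (\<forall>b<l. \<forall>c<n.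
     D b c = single (h c - g b) (A b c) \<and> (A b c \<noteq> 0 \<longrightarrow> exp_le (g b) (h c)))"

lemma strand_eqI:
  assumes "\<And>a. strand g a x b = strand g a y b"
  shows "x b = y b"
proof (rule poly_mapping_eqI)
  fix t
  show "lookup (x b) t = lookup (y b) t"
    using assms[of "t + g b"] by (simp add: strand_def)
qed

lemma strand_in_strand_space:
  "x \<in> free_module m n \<Longrightarrow> strand g a x \<in> strand_space n g a"
  by (auto simp: strand_space_def strand_def free_module_def not_less[symmetric] split: if_splits)

lemma strand_outside_degrees:
  assumes "x \<in> free_module m n" "\<And>b. b < n \<Longrightarrow> g b \<in> degrees m" "a \<notin> degrees m"
  shows "strand g a x b = 0"
proof (rule ccontr)
  assume nz: "strand g a x b \<noteq> 0"
  hence b: "b < n" "exp_le (g b) a"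
    using strand_in_strand_space[OF assms(1), of g a] by (auto simp: strand_space_def)
  have "a - g b \<in> keys (x b)"
    using nz b(2) by (simp add: strand_def in_keys_iff)
  hence "a - g b \<in> degrees m"
    using assms(1) b(1) by (auto simp: free_module_def polynomial_ring_def)
  thus False using degrees_add[OF _ assms(2)[OF b(1)]] exp_le_diff_add[OF b(2)] assms(3) by fastforce
qed

lemma strand_strand_vector:
  assumes "u \<in> strand_space n g a"
  shows "strand g a' (strand_vector g a u) b = (if a' = a then u b else 0)"
proof -
  have "a - g b \<noteq> a' - g b" if "exp_le (g b) a" "exp_le (g b) a'" "a' \<noteq> a"
    using that exp_le_diff_add by metis
  thus ?thesis using assms
    by (auto simp: strand_def strand_vector_def strand_space_def lookup_single when_def)
qed

lemma strand_vector_in_free_module: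
  assumes "u \<in> strand_space n g a" "a \<in> degrees m"
  shows "strand_vector g a u \<in> free_module m n"
proof -
  have "u b = 0" if "n \<le> b" for b using assms(1) that by (auto simp: strand_space_def)
  thus ?thesis using degrees_diff[OF assms(2)]
    by (auto simp: free_module_def strand_vector_def polynomial_ring_def)
qed

lemma strand_sum: "strand g a (\<lambda>b. \<Sum>i\<in>A. x i b) b = (\<Sum>i\<in>A. strand g a (x i) b)"
  by (simp add: strand_def lookup_sum)

text \<open>
  The monomial of an entry shifts the exponent at which a coefficient is read by just the difference
  of the degrees of the two generators; so the scalars act on the strands, the same way in every degree.
\<close>

lemma strand_matrix_map:
  assumes "homogeneous_matrix l n g h A D"
  shows "strand g a (matrix_map (*) l n D x) b = scalar_map l n A (strand h a x) b"
proof (cases "b < l")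
  case True
  have "(if exp_le (g b) a then lookup (D b c * x c) (a - g b) else 0) =
      A b c * strand h a x c" if c: "c < n" for c
  proof (cases "A b c = 0")
    case False
    have D: "D b c = single (h c - g b) (A b c)" and gh: "exp_le (g b) (h c)"
      using assms True c False by (auto simp: homogeneous_matrix_def)
    show ?thesis
    proof (cases "exp_le (h c) a")
      case True
      have le: "exp_le (g b) a" using exp_le_trans[OF gh True] .
      have "exp_le (h c - g b) (a - g b)" and "a - g b - (h c - g b) = a - h c"
        using True gh le by (auto simp: exp_le_def lookup_minus diff_le_mono intro!: poly_mapping_eqI)
      thus ?thesis using True le D by (simp add: lookup_single_mult strand_def)
    next
      case False
      have "\<not> exp_le (h c - g b) (a - g b)" if "exp_le (g b) a"
      proof
        assume le: "exp_le (h c - g b) (a - g b)"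
        have "lookup (h c) z \<le> lookup a z" for z
          using le that gh unfolding exp_le_def lookup_minus
          by (metis diff_le_mono le_add_diff_inverse2 add_le_mono1)
        thus False using False by (simp add: exp_le_def)
      qed
      thus ?thesis using D False by (simp add: lookup_single_mult strand_def)
    qed
  next
    case z: True
    have "D b c = 0" using assms True c z by (auto simp: homogeneous_matrix_def)
    thus ?thesis using z by simp
  qed
  hence "(\<Sum>c<n. if exp_le (g b) a then lookup (D b c * x c) (a - g b) else 0) =
      (\<Sum>c<n. A b c * strand h a x c)"
    by (intro sum.cong) auto
  moreover have "strand g a (matrix_map (*) l n D x) b =
      (\<Sum>c<n. if exp_le (g b) a then lookup (D b c * x c) (a - g b) else 0)"
    using True by (simp add: strand_def matrix_map_def lookup_sum)
  ultimately show ?thesis using True by (simp add: scalar_map_def)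
qed (simp add: strand_def matrix_map_def scalar_map_def)

lemma scalar_map_in_strand_space:
  assumes "homogeneous_matrix l n g h A D" "u \<in> strand_space n h a"
  shows "scalar_map l n A u \<in> strand_space l g a"
proof -
  have "b < l \<and> exp_le (g b) a" if nz: "scalar_map l n A u b \<noteq> 0" for b
  proof -
    have b: "b < l" using nz by (auto simp: scalar_map_def split: if_splits)
    hence "(\<Sum>c<n. A b c * u c) \<noteq> 0" using nz by (simp add: scalar_map_def)
    from sum.not_neutral_contains_not_neutral[OF this]
    obtain c where "c < n" "A b c \<noteq> 0" "u c \<noteq> 0" by auto
    thus ?thesis using assms b exp_le_trans
      unfolding homogeneous_matrix_def strand_space_def by blast
  qed
  thus ?thesis by (simp add: strand_space_def)
qed

lemma polynomial_ring_add: "p \<in> carrier (polynomial_ring m) \<Longrightarrow> q \<in> carrier (polynomial_ring m) \<Longrightarrow>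
    p + q \<in> carrier (polynomial_ring m)"
  using keys_add[of p q] by (auto simp: polynomial_ring_def)

lemma polynomial_ring_mult:
  assumes "p \<in> carrier (polynomial_ring m)" "q \<in> carrier (polynomial_ring m)"
  shows "p * q \<in> carrier (polynomial_ring m)"
proof -
  have "{s + t | s t. s \<in> keys p \<and> t \<in> keys q} \<subseteq> degrees m"
    using assms by (auto simp: polynomial_ring_def intro!: degrees_add)
  thus ?thesis using keys_mult[of p q] by (auto simp: polynomial_ring_def)
qed

lemma polynomial_ring_sum:
  assumes "\<And>i. i \<in> A \<Longrightarrow> f i \<in> carrier (polynomial_ring m)"
  shows "sum f A \<in> carrier (polynomial_ring m)"
  using assms
proof (induction A rule: infinite_finite_induct)
  case (insert x F)
  thus ?case by (simp add: polynomial_ring_add)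
qed (auto simp: polynomial_ring_def)

lemma matrix_map_in_free_module:
  assumes "homogeneous_matrix l n g h A D" "\<And>c. c < n \<Longrightarrow> h c \<in> degrees m" "x \<in> free_module m n"
  shows "matrix_map (*) l n D x \<in> free_module m l"
  unfolding free_module_def
proof (intro CollectI conjI allI impI)
  fix b assume b: "b < l"
  have "D b c * x c \<in> carrier (polynomial_ring m)" if "c < n" for c
  proof (rule polynomial_ring_mult)
    have "h c - g b \<in> degrees m" using degrees_diff[OF assms(2)[OF that]] .
    thus "D b c \<in> carrier (polynomial_ring m)"
      using assms(1) b that by (auto simp: homogeneous_matrix_def polynomial_ring_def)
    show "x c \<in> carrier (polynomial_ring m)" using assms(3) that by (auto simp: free_module_def)
  qed
  thus "matrix_map (*) l n D x b \<in> carrier (polynomial_ring m)"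
    using b by (auto simp: matrix_map_def intro!: polynomial_ring_sum)
qed (simp add: matrix_map_def)

text \<open>
  Exactness of homogeneous maps can be tested in each degree separately. The set \<open>K\<close> stands for the kernel of a map
  that is itself described degree by degree, which covers both the differentials and the augmentation.
  From polynomials to strands one reads off coefficients; conversely preimages of the finitely many
  nonzero components are added up.
\<close>

lemma kernel_image_strandwise:
  fixes D :: "nat \<Rightarrow> nat \<Rightarrow> 'k::field mpoly"
  assumes hom: "homogeneous_matrix l n g h A D"
    and deg: "\<And>b. b < l \<Longrightarrow> g b \<in> degrees m" "\<And>c. c < n \<Longrightarrow> h c \<in> degrees m"
    and K: "\<And>x. x \<in> K \<longleftrightarrow> x \<in> free_module m l \<and> (\<forall>a\<in>degrees m. strand g a x \<in> k a)"
    and k: "\<And>a. a \<in> degrees m \<Longrightarrow> k a \<subseteq> strand_space l g a" "\<And>a. a \<in> degrees m \<Longrightarrow> (\<lambda>_. 0) \<in> k a"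
  shows "K = matrix_map (*) l n D ` free_module m n \<longleftrightarrow>
    (\<forall>a\<in>degrees m. k a = scalar_map l n A ` strand_space n h a)"
proof (intro iffI ballI equalityI subsetI)
  fix a u
  assume eq: "K = matrix_map (*) l n D ` free_module m n" and a: "a \<in> degrees m" and u: "u \<in> k a"
  have us: "u \<in> strand_space l g a" using k(1) a u by blast
  have "strand g a' (strand_vector g a u) \<in> k a'" if "a' \<in> degrees m" for a'
  proof -
    have "strand g a' (strand_vector g a u) = (if a' = a then u else (\<lambda>_. 0))"
      using strand_strand_vector[OF us] by (simp add: fun_eq_iff)
    thus ?thesis using u k(2) that by simp
  qed
  hence "strand_vector g a u \<in> K"
    using K strand_vector_in_free_module[OF us a] by blast
  then obtain y where y: "y \<in> free_module m n" "strand_vector g a u = matrix_map (*) l n D y"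
    using eq by blast
  have "u = scalar_map l n A (strand h a y)"
    using strand_matrix_map[OF hom, of a y] strand_strand_vector[OF us, of a] y(2)
    by (simp add: fun_eq_iff)
  thus "u \<in> scalar_map l n A ` strand_space n h a"
    using strand_in_strand_space[OF y(1)] by blast
next
  fix a u
  assume eq: "K = matrix_map (*) l n D ` free_module m n" and a: "a \<in> degrees m"
    and "u \<in> scalar_map l n A ` strand_space n h a"
  then obtain v where v: "v \<in> strand_space n h a" "u = scalar_map l n A v" by blast
  have "matrix_map (*) l n D (strand_vector h a v) \<in> K"
    using eq strand_vector_in_free_module[OF v(1) a] by blast
  hence "strand g a (matrix_map (*) l n D (strand_vector h a v)) \<in> k a" using K a by blast
  moreover have "strand h a (strand_vector h a v) = v"
    using strand_strand_vector[OF v(1), of a] by (simp add: fun_eq_iff)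
  moreover have "strand g a (matrix_map (*) l n D (strand_vector h a v)) =
      scalar_map l n A (strand h a (strand_vector h a v))"
    using strand_matrix_map[OF hom] by blast
  ultimately show "u \<in> k a" using v(2) by simp
next
  fix x
  assume ex: "\<forall>a\<in>degrees m. k a = scalar_map l n A ` strand_space n h a" and "x \<in> K"
  hence x: "x \<in> free_module m l" "\<And>a. a \<in> degrees m \<Longrightarrow> strand g a x \<in> k a" using K by auto
  define w where "w a = (SOME v. v \<in> strand_space n h a \<and> scalar_map l n A v = strand g a x)" for a
  have w: "w a \<in> strand_space n h a \<and> scalar_map l n A (w a) = strand g a x" if "a \<in> degrees m" for a
  proof -
    have "\<exists>v. v \<in> strand_space n h a \<and> scalar_map l n A v = strand g a x"
      using ex x(2)[OF that] that by (metis imageE)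
    from someI_ex[OF this] show ?thesis unfolding w_def .
  qed
  \<comment> \<open>The degrees of the nonzero components; only finitely many monomials occur.\<close>
  define S where "S = {a \<in> degrees m. \<exists>b. strand g a x b \<noteq> 0}"
  have "S \<subseteq> (\<Union>b<l. (\<lambda>t. t + g b) ` keys (x b))"
  proof
    fix a assume "a \<in> S"
    then obtain b where b: "strand g a x b \<noteq> 0" by (auto simp: S_def)
    hence "b < l" "exp_le (g b) a" "a - g b \<in> keys (x b)"
      using strand_in_strand_space[OF x(1), of g a]
      by (auto simp: strand_space_def strand_def in_keys_iff split: if_splits)
    thus "a \<in> (\<Union>b<l. (\<lambda>t. t + g b) ` keys (x b))"
      using exp_le_diff_add[of "g b" a] by (auto intro!: bexI[of _ b] image_eqI[of _ _ "a - g b"])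
  qed
  hence finS: "finite S" by (rule finite_subset) simp
  define y where "y c = (\<Sum>a\<in>S. strand_vector h a (w a) c)" for c
  have y: "y \<in> free_module m n"
  proof -
    have v: "strand_vector h a (w a) \<in> free_module m n" if "a \<in> S" for a
      using strand_vector_in_free_module[of "w a" n h a m] w[of a] that by (auto simp: S_def)
    show ?thesis unfolding free_module_def y_def
    proof (intro CollectI conjI allI impI)
      show "(\<Sum>a\<in>S. strand_vector h a (w a) b) \<in> carrier (polynomial_ring m)" if "b < n" for b
        using v that by (intro polynomial_ring_sum) (auto simp: free_module_def)
      show "(\<Sum>a\<in>S. strand_vector h a (w a) b) = 0" if "b \<ge> n" for b
        using v that by (intro sum.neutral) (auto simp: free_module_def)
    qed
  qed
  have sy: "strand h a y = (if a \<in> S then w a else (\<lambda>_. 0))" for a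
  proof
    fix c
    have "strand h a y c = (\<Sum>a'\<in>S. strand h a (strand_vector h a' (w a')) c)"
      unfolding y_def by (rule strand_sum)
    also have "\<dots> = (\<Sum>a'\<in>S. if a' = a then w a c else 0)"
    proof (rule sum.cong[OF refl])
      fix a' assume "a' \<in> S"
      hence "w a' \<in> strand_space n h a'" using w by (auto simp: S_def)
      from strand_strand_vector[OF this, of a c]
      show "strand h a (strand_vector h a' (w a')) c = (if a' = a then w a c else 0)" by auto
    qed
    also have "\<dots> = (if a \<in> S then w a c else 0)" using finS by simp
    finally show "strand h a y c = (if a \<in> S then w a else (\<lambda>_. 0)) c" by simp
  qed
  have "matrix_map (*) l n D y b = x b" for b
  proof (rule strand_eqI)
    fix a
    have "strand g a (matrix_map (*) l n D y) b = scalar_map l n A (strand h a y) b"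
      by (rule strand_matrix_map[OF hom])
    also have "\<dots> = strand g a x b"
    proof (cases "a \<in> S")
      case True
      thus ?thesis using w sy by (simp add: S_def)
    next
      case False
      have "strand g a x b = 0"
        using False strand_outside_degrees[OF x(1) deg(1), where b = b] by (auto simp: S_def)
      thus ?thesis using False sy by (simp add: scalar_map_def)
    qed
    finally show "strand g a (matrix_map (*) l n D y) b = strand g a x b" .
  qed
  thus "x \<in> matrix_map (*) l n D ` free_module m n" using y by (metis ext image_eqI)
next
  fix x
  assume ex: "\<forall>a\<in>degrees m. k a = scalar_map l n A ` strand_space n h a"
    and "x \<in> matrix_map (*) l n D ` free_module m n"
  then obtain y where y: "y \<in> free_module m n" "x = matrix_map (*) l n D y" by blast
  have "strand g a x \<in> k a" if "a \<in> degrees m" for a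
  proof -
    have "strand g a x = scalar_map l n A (strand h a y)"
      unfolding y(2) by (rule ext, rule strand_matrix_map[OF hom])
    thus ?thesis using ex that strand_in_strand_space[OF y(1), of h a] by simp
  qed
  thus "x \<in> K" using K y matrix_map_in_free_module[OF hom deg(2) y(1)] by blast
qed


section \<open>The Stanley--Reisner module\<close>

lemma polynomial_ring_sel [simp]:
  "p \<oplus>\<^bsub>polynomial_ring m\<^esub> q = p + q" "p \<otimes>\<^bsub>polynomial_ring m\<^esub> q = p * q"
  "\<zero>\<^bsub>polynomial_ring m\<^esub> = 0" "\<one>\<^bsub>polynomial_ring m\<^esub> = 1"
  by (simp_all add: polynomial_ring_def)

lemma polynomial_ring_zero: "0 \<in> carrier (polynomial_ring m)"
  and polynomial_ring_one: "1 \<in> carrier (polynomial_ring m)"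
  by (simp_all add: polynomial_ring_def degrees_def)

lemma polynomial_ring_cring: "cring (polynomial_ring m :: 'k::field mpoly ring)"
proof (rule cringI)
  show "abelian_group (polynomial_ring m :: 'k mpoly ring)"
  proof (rule abelian_groupI)
    fix p :: "'k mpoly" assume "p \<in> carrier (polynomial_ring m)"
    thus "\<exists>q\<in>carrier (polynomial_ring m). q \<oplus>\<^bsub>polynomial_ring m\<^esub> p = \<zero>\<^bsub>polynomial_ring m\<^esub>"
      by (intro bexI[of _ "- p"]) (auto simp: polynomial_ring_def in_keys_iff)
  qed (simp_all add: polynomial_ring_add add.assoc add.commute polynomial_ring_zero)
  show "Group.comm_monoid (polynomial_ring m :: 'k mpoly ring)"
    by unfold_locales
      (simp_all add: polynomial_ring_mult mult.assoc mult.commute polynomial_ring_one)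
qed (simp add: distrib_right)

lemma lookup_indicator_degree:
  "finite \<omega> \<Longrightarrow> lookup (indicator_degree \<omega>) j = (if j \<in> \<omega> then 1 else 0)"
  by (auto simp: indicator_degree_def lookup_sum lookup_single when_def)

lemma keys_indicator_degree: "finite \<omega> \<Longrightarrow> keys (indicator_degree \<omega>) = \<omega>"
  by (auto simp: in_keys_iff lookup_indicator_degree split: if_splits)

lemma prod_var_poly: "(\<Prod>j\<in>\<tau>. var_poly j) = (single (indicator_degree \<tau>) 1 :: 'k::field mpoly)"
  by (induction \<tau> rule: infinite_finite_induct)
    (simp_all add: indicator_degree_def var_poly_def mult_single)

lemma mpoly_eq_sum_terms: "p = (\<Sum>t\<in>keys p. single t (lookup p t))"
  for p :: "'k::field mpoly"
proof (rule poly_mapping_eqI)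
  fix s
  have "lookup (\<Sum>t\<in>keys p. single t (lookup p t)) s =
      (\<Sum>t\<in>keys p. if t = s then lookup p s else 0)"
    by (auto simp: lookup_sum lookup_single when_def intro!: sum.cong)
  also have "\<dots> = lookup p s" by (auto simp: in_keys_iff)
  finally show "lookup p s =
      lookup (\<Sum>t\<in>keys p. single t (lookup p t)) s" ..
qed

text \<open>
  The Stanley--Reisner ideal as a set of polynomials: those without a monomial supported on a face.
\<close>

definition nonface_polys :: "nat \<Rightarrow> nat set set \<Rightarrow> 'k::field mpoly set" where
  "nonface_polys m K = {p \<in> carrier (polynomial_ring m). \<forall>t\<in>keys p. keys t \<notin> K}"

lemma nonface_polys_ideal:
  assumes K: "\<And>\<sigma> \<tau>. \<sigma> \<in> K \<Longrightarrow> \<tau> \<subseteq> \<sigma> \<Longrightarrow> \<tau> \<in> K"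
  shows "ideal (nonface_polys m K :: 'k::field mpoly set) (polynomial_ring m)"
proof -
  interpret R: cring "polynomial_ring m :: 'k mpoly ring" by (rule polynomial_ring_cring)
  have neg: "\<ominus>\<^bsub>polynomial_ring m\<^esub> p = - p" if "p \<in> carrier (polynomial_ring m)" for p :: "'k mpoly"
    using that by (intro R.minus_equality) (auto simp: polynomial_ring_def in_keys_iff)
  have mult: "q * p \<in> nonface_polys m K"
    if "p \<in> nonface_polys m K" "q \<in> carrier (polynomial_ring m)" for p q :: "'k mpoly"
  proof -
    have "keys t \<notin> K" if t_key: "t \<in> keys (q * p)" for t
    proof -
      obtain s u where t: "t = s + u" "u \<in> keys p"
        using keys_mult[of q p] t_key by blast
      have "keys u \<subseteq> keys t"
        by (auto simp: t(1) in_keys_iff lookup_add)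
      moreover have "keys u \<notin> K"
        using \<open>p \<in> nonface_polys m K\<close> t(2) by (simp add: nonface_polys_def)
      ultimately show ?thesis using K by blast
    qed
    moreover have "q * p \<in> carrier (polynomial_ring m)"
      using that by (intro polynomial_ring_mult) (simp_all add: nonface_polys_def)
    ultimately show ?thesis by (simp add: nonface_polys_def)
  qed
  show ?thesis
  proof (rule idealI[OF R.ring_axioms])
    show "subgroup (nonface_polys m K) (add_monoid (polynomial_ring m :: 'k mpoly ring))"
    proof (rule R.add.subgroupI)
      show "nonface_polys m K \<subseteq> carrier (polynomial_ring m :: 'k mpoly ring)"
        by (auto simp: nonface_polys_def)
      have "(0 :: 'k mpoly) \<in> nonface_polys m K" by (simp add: nonface_polys_def polynomial_ring_def)
      thus "nonface_polys m K \<noteq> ({} :: 'k mpoly set)" by blast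
    next
      fix p :: "'k mpoly" assume p: "p \<in> nonface_polys m K"
      hence "- p \<in> nonface_polys m K"
        by (auto simp: nonface_polys_def polynomial_ring_def in_keys_iff subset_iff)
      thus "\<ominus>\<^bsub>polynomial_ring m\<^esub> p \<in> nonface_polys m K"
        using neg p by (simp add: nonface_polys_def)
    next
      fix p q :: "'k mpoly" assume "p \<in> nonface_polys m K" "q \<in> nonface_polys m K"
      thus "p \<oplus>\<^bsub>polynomial_ring m\<^esub> q \<in> nonface_polys m K"
        using keys_add[of p q] polynomial_ring_add[of p m q] by (auto simp: nonface_polys_def)
    qed
  next
    fix p q :: "'k mpoly" assume "p \<in> nonface_polys m K" "q \<in> carrier (polynomial_ring m)"
    from mult[OF this] show "q \<otimes>\<^bsub>polynomial_ring m\<^esub> p \<in> nonface_polys m K"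
      "p \<otimes>\<^bsub>polynomial_ring m\<^esub> q \<in> nonface_polys m K" by (simp_all add: mult.commute)
  qed
qed

text \<open>
  A monomial whose support \<open>\<tau>\<close> is not a face is a multiple of the squarefree generator of \<open>\<tau>\<close>.
\<close>

lemma stanley_reisner_ideal_eq:
  assumes K: "simplicial_complex m K"
  shows "stanley_reisner_ideal m K = (nonface_polys m K :: 'k::field mpoly set)"
proof -
  interpret R: cring "polynomial_ring m :: 'k mpoly ring" by (rule polynomial_ring_cring)
  have down: "\<And>\<sigma> \<tau>. \<sigma> \<in> K \<Longrightarrow> \<tau> \<subseteq> \<sigma> \<Longrightarrow> \<tau> \<in> K"
    using K by (auto simp: simplicial_complex_def)
  let ?S = "{\<Prod>j\<in>\<tau>. var_poly j | \<tau>. \<tau> \<subseteq> {1..m} \<and> \<tau> \<notin> K} :: 'k mpoly set"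
  have fin: "finite \<tau>" if "\<tau> \<subseteq> {1..m}" for \<tau> using that finite_subset by blast
  have gen: "single (indicator_degree \<tau>) 1 \<in> (nonface_polys m K :: 'k mpoly set)"
    if "\<tau> \<subseteq> {1..m}" "\<tau> \<notin> K" for \<tau>
    using that fin[OF that(1)]
    by (simp add: nonface_polys_def polynomial_ring_def degrees_def keys_indicator_degree)
  have "?S \<subseteq> nonface_polys m K" using gen by (auto simp: prod_var_poly)
  moreover have "p \<in> J" if J: "ideal J (polynomial_ring m)" "?S \<subseteq> J" and p: "p \<in> nonface_polys m K" for J p
  proof -
    interpret J: ideal J "polynomial_ring m :: 'k mpoly ring" by (rule J(1))
    have mem: "single t (lookup p t) \<in> J"
      if t: "t \<in> keys p" for t
    proof -
      let ?\<tau> = "keys t"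
      have \<tau>: "?\<tau> \<subseteq> {1..m}" "?\<tau> \<notin> K"
        using p t by (auto simp: nonface_polys_def polynomial_ring_def degrees_def)
      have le: "exp_le (indicator_degree ?\<tau>) t"
        by (auto simp: exp_le_def lookup_indicator_degree in_keys_iff)
      have "(\<Prod>j\<in>?\<tau>. var_poly j) \<in> J" using J(2) \<tau> by blast
      hence "single (indicator_degree ?\<tau>) 1 \<in> J" unfolding prod_var_poly .
      moreover have "t - indicator_degree ?\<tau> \<in> degrees m"
        using \<tau>(1) by (intro degrees_diff) (simp add: degrees_def)
      hence "single (t - indicator_degree ?\<tau>) (lookup p t) \<in>
          carrier (polynomial_ring m)" by (simp add: polynomial_ring_def)
      ultimately have "single (t - indicator_degree ?\<tau>) (lookup p t) *
          single (indicator_degree ?\<tau>) 1 \<in> J"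
        using J.I_l_closed by (simp only: polynomial_ring_sel)
      thus ?thesis by (simp add: mult_single exp_le_diff_add[OF le])
    qed
    have "(\<Sum>t\<in>A. single t (lookup p t)) \<in> J"
      if "A \<subseteq> keys p" for A
      using finite_subset[OF that finite_keys] that
    proof (induction A rule: finite_induct)
      case empty
      thus ?case using J.zero_closed by simp
    next
      case (insert t A)
      thus ?case using J.a_closed[of "single t (lookup p t)"] mem by simp
    qed
    from this[OF order_refl] show ?thesis by (subst mpoly_eq_sum_terms[of p])
  qed
  ultimately show ?thesis
    unfolding stanley_reisner_ideal_def genideal_def using nonface_polys_ideal[OF down]
    by (intro equalityI Inter_lower Inter_greatest subsetI) auto
qed

lemma coset_eq: "I +>\<^bsub>polynomial_ring m\<^esub> p = {i + p | i. i \<in> I}"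
  by (auto simp: a_r_coset_def')

lemma coset_eq_iff:
  assumes I: "I = nonface_polys m K"
    and p: "p \<in> carrier (polynomial_ring m)" and q: "q \<in> carrier (polynomial_ring m)"
  shows "I +>\<^bsub>polynomial_ring m\<^esub> p = I +>\<^bsub>polynomial_ring m\<^esub> q \<longleftrightarrow>
    (\<forall>a\<in>degrees m. keys a \<in> K \<longrightarrow> lookup p a = lookup q a)"
proof -
  have I_iff: "i \<in> I \<longleftrightarrow> i \<in> carrier (polynomial_ring m) \<and>
      (\<forall>a\<in>degrees m. keys a \<in> K \<longrightarrow> lookup i a = 0)" for i
    by (auto simp: I nonface_polys_def polynomial_ring_def in_keys_iff subset_iff)
  have minus: "r - s \<in> carrier (polynomial_ring m)"
    if "r \<in> carrier (polynomial_ring m)" "s \<in> carrier (polynomial_ring m)" for r s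
  proof -
    have "- s \<in> carrier (polynomial_ring m)"
      using that by (auto simp: polynomial_ring_def in_keys_iff subset_iff)
    thus ?thesis using polynomial_ring_add[OF that(1)] by fastforce
  qed
  show ?thesis
  proof
    assume "I +>\<^bsub>polynomial_ring m\<^esub> p = I +>\<^bsub>polynomial_ring m\<^esub> q"
    moreover have "0 + p \<in> I +>\<^bsub>polynomial_ring m\<^esub> p"
      unfolding coset_eq using I_iff[of 0] by (force simp: polynomial_ring_def)
    ultimately obtain i where "i \<in> I" "p = i + q" unfolding coset_eq by auto
    thus "\<forall>a\<in>degrees m. keys a \<in> K \<longrightarrow> lookup p a = lookup q a"
      using I_iff[of i] by (simp add: lookup_add)
  next
    assume eq: "\<forall>a\<in>degrees m. keys a \<in> K \<longrightarrow> lookup p a = lookup q a"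
    have "i + (p - q) \<in> I \<and> i + (q - p) \<in> I" if "i \<in> I" for i
      using that eq I_iff p q by (simp add: minus polynomial_ring_add lookup_add lookup_minus)
    moreover have "i + p = (i + (p - q)) + q" "i + q = (i + (q - p)) + p" for i by simp_all
    ultimately show "I +>\<^bsub>polynomial_ring m\<^esub> p = I +>\<^bsub>polynomial_ring m\<^esub> q"
      unfolding coset_eq by blast
  qed
qed

context
  fixes m :: nat and K :: "nat set set"
  assumes K: "simplicial_complex m K"
begin

abbreviation "SR_ideal \<equiv> stanley_reisner_ideal m K :: 'k::field mpoly set"
abbreviation "SR_class p \<equiv> stanley_reisner_ideal m K +>\<^bsub>polynomial_ring m\<^esub> p"
abbreviation "SR \<equiv> stanley_reisner_module m K :: ('k::field mpoly, 'k mpoly set) module"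

lemma SR_ideal_ideal: "ideal (SR_ideal :: 'k::field mpoly set) (polynomial_ring m)"
  unfolding stanley_reisner_ideal_eq[OF K]
  using K by (intro nonface_polys_ideal) (auto simp: simplicial_complex_def)

lemma SR_sel:
  "carrier SR = carrier (polynomial_ring m Quot SR_ideal)"
  "add SR = add (polynomial_ring m Quot SR_ideal)"
  "zero SR = zero (polynomial_ring m Quot SR_ideal)"
  "smult SR p X = SR_class p \<otimes>\<^bsub>polynomial_ring m Quot SR_ideal\<^esub> X"
  by (simp_all add: stanley_reisner_module_def stanley_reisner_ring_def ring.extend_def)

lemma SR_carrier: "carrier (SR :: ('k::field mpoly, 'k mpoly set) module) =
    (\<lambda>p. SR_class p) ` carrier (polynomial_ring m)"
  unfolding SR_sel by (auto simp: FactRing_def A_RCOSETS_def')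

lemma SR_add:
  fixes p q :: "'k::field mpoly"
  assumes "p \<in> carrier (polynomial_ring m)" "q \<in> carrier (polynomial_ring m)"
  shows "SR_class p \<oplus>\<^bsub>SR\<^esub> SR_class q = SR_class (p + q)"
proof -
  interpret I: ideal "SR_ideal :: 'k mpoly set" "polynomial_ring m" by (rule SR_ideal_ideal)
  show ?thesis using I.a_rcos_sum[OF assms] by (simp add: SR_sel FactRing_def)
qed

lemma SR_zero: "\<zero>\<^bsub>SR\<^esub> = SR_class (0 :: 'k::field mpoly)"
  by (simp add: SR_sel FactRing_def coset_eq)

lemma SR_smult:
  fixes p q :: "'k::field mpoly"
  assumes "p \<in> carrier (polynomial_ring m)" "q \<in> carrier (polynomial_ring m)"
  shows "p \<odot>\<^bsub>SR\<^esub> SR_class q = SR_class (p * q)"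
proof -
  interpret I: ideal "SR_ideal :: 'k mpoly set" "polynomial_ring m" by (rule SR_ideal_ideal)
  show ?thesis using I.rcoset_mult_add[OF assms] by (simp add: SR_sel FactRing_def)
qed

lemma SR_abelian_monoid: "abelian_monoid (SR :: ('k::field mpoly, 'k mpoly set) module)"
proof (rule abelian_monoidI)
  show "\<zero>\<^bsub>SR\<^esub> \<in> carrier (SR :: ('k mpoly, 'k mpoly set) module)"
    unfolding SR_zero SR_carrier by (intro imageI) (simp add: polynomial_ring_def)
qed (unfold SR_carrier SR_zero, (elim imageE,
    simp add: SR_add polynomial_ring_add polynomial_ring_zero ac_simps)+)

lemma SR_finsum:
  fixes f :: "'b \<Rightarrow> 'k::field mpoly"
  assumes "finite A" "\<And>b. b \<in> A \<Longrightarrow> f b \<in> carrier (polynomial_ring m)"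
    "\<And>b. b \<in> A \<Longrightarrow> X b = SR_class (f b)"
  shows "finsum SR X A = SR_class (sum f A)"
proof -
  interpret M: abelian_monoid "SR :: ('k mpoly, 'k mpoly set) module" by (rule SR_abelian_monoid)
  show ?thesis using assms
  proof (induction A rule: finite_induct)
    case empty
    show ?case by (simp add: SR_zero)
  next
    case (insert b A)
    have "X \<in> A \<rightarrow> carrier SR" "X b \<in> carrier SR"
      using insert.prems by (auto simp: SR_carrier)
    hence "finsum SR X (insert b A) = X b \<oplus>\<^bsub>SR\<^esub> finsum SR X A"
      using insert.hyps by simp
    thus ?case using insert by (simp add: SR_add polynomial_ring_sum)
  qed
qed

text \<open>
  The augmentation is represented by the polynomial \<open>e\<close>, whose coefficient at \<open>a\<close> is a scalar functional of the
  component of degree \<open>a\<close>.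
\<close>

lemma SR_augmentation:
  fixes F :: "('k::field, 'k mpoly set) resolution"
  assumes "x \<in> free_module m (free_rank F 0)"
    and "\<And>b. b < free_rank F 0 \<Longrightarrow> basis_deg F 0 b \<in> degrees m \<and>
      aug F b = SR_class (single (basis_deg F 0 b) (\<mu> b))"
  defines "e \<equiv> \<Sum>b<free_rank F 0. single (basis_deg F 0 b) (\<mu> b) * x b"
  shows "augmentation SR F x = SR_class e" "e \<in> carrier (polynomial_ring m)"
    "lookup e a = (\<Sum>b<free_rank F 0. \<mu> b * strand (basis_deg F 0) a x b)"
proof -
  have s: "single (basis_deg F 0 b) (\<mu> b) \<in> carrier (polynomial_ring m)"
    if "b < free_rank F 0" for b
    using assms(2)[OF that] by (simp add: polynomial_ring_def)
  have x: "x b \<in> carrier (polynomial_ring m)" if "b < free_rank F 0" for b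
    using assms(1) that by (simp add: free_module_def)
  show "augmentation SR F x = SR_class e"
    unfolding augmentation_def e_def
    by (rule SR_finsum) (simp_all add: assms(2) SR_smult s x polynomial_ring_mult mult.commute)
  show "e \<in> carrier (polynomial_ring m)"
    unfolding e_def by (rule polynomial_ring_sum) (simp add: s x polynomial_ring_mult)
  show "lookup e a = (\<Sum>b<free_rank F 0. \<mu> b * strand (basis_deg F 0) a x b)"
    unfolding e_def lookup_sum lookup_single_mult strand_def by (intro sum.cong) auto
qed

lemma SR_grading_eq:
  assumes "X \<in> stanley_reisner_grading m K a" "a \<in> degrees m"
  shows "\<exists>c. X = SR_class (single a (c :: 'k::field))"
proof -
  obtain p :: "'k mpoly" where p: "X = SR_class p" "keys p \<subseteq> {a}"
    using assms(1) by (auto simp: stanley_reisner_grading_def)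
  have "p = single a (lookup p a)"
    using p(2) by (intro poly_mapping_eqI) (auto simp: lookup_single when_def in_keys_iff)
  then obtain c where "p = single a c" by blast
  thus ?thesis using p(1) by blast
qed

end


section \<open>Free resolutions in terms of strands\<close>

text \<open>
  The Stanley--Reisner module has dimension \<open>1\<close> in the degrees supported on a face and is zero in all
  others, where the kernel of the augmentation is everything.
\<close>

definition aug_kernel ::
    "nat set set \<Rightarrow> nat \<Rightarrow> (nat \<Rightarrow> expo) \<Rightarrow> (nat \<Rightarrow> 'k::field) \<Rightarrow> expo \<Rightarrow> (nat \<Rightarrow> 'k) set" where
  "aug_kernel K n g \<mu> a =
     {u \<in> strand_space n g a. keys a \<in> K \<longrightarrow> (\<Sum>b<n. \<mu> b * u b) = 0}"

text \<open>
  The data of a resolution reduced to ranks, degrees and scalars, together with exactness in every degree.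
\<close>

definition exact_strands ::
    "nat \<Rightarrow> nat set set \<Rightarrow> (nat \<Rightarrow> nat) \<Rightarrow> (nat \<Rightarrow> nat \<Rightarrow> expo) \<Rightarrow>
     (nat \<Rightarrow> nat \<Rightarrow> nat \<Rightarrow> 'k::field) \<Rightarrow> (nat \<Rightarrow> 'k) \<Rightarrow> bool" where
  "exact_strands m K n g A \<mu> \<longleftrightarrow>
     (\<forall>i. \<forall>b<n i. \<forall>c<n (Suc i). A i b c \<noteq> 0 \<longrightarrow> exp_le (g i b) (g (Suc i) c)) \<and>
     (\<forall>a\<in>degrees m.
        (keys a \<in> K \<longrightarrow> (\<exists>u\<in>strand_space (n 0) (g 0) a. (\<Sum>b<n 0. \<mu> b * u b) = 1)) \<and>
        aug_kernel K (n 0) (g 0) \<mu> a = scalar_map (n 0) (n 1) (A 0) ` strand_space (n 1) (g 1) a \<and>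
        (\<forall>i. {u \<in> strand_space (n (Suc i)) (g (Suc i)) a. scalar_map (n i) (n (Suc i)) (A i) u = 0} =
           scalar_map (n (Suc i)) (n (Suc (Suc i))) (A (Suc i)) `
             strand_space (n (Suc (Suc i))) (g (Suc (Suc i))) a))"

text \<open>
  By homogeneity this is the only coefficient of the entry that can be nonzero.
\<close>

definition scalar_entry :: "('k::field, 'm) resolution \<Rightarrow> nat \<Rightarrow> nat \<Rightarrow> nat \<Rightarrow> 'k" where
  "scalar_entry F i b c =
     lookup (diff_entry F i b c) (basis_deg F (Suc i) c - basis_deg F i b)"

definition multigraded_maps :: "nat \<Rightarrow> nat set set \<Rightarrow> ('k::field, 'k mpoly set) resolution \<Rightarrow> (nat \<Rightarrow> 'k) \<Rightarrow> bool" where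
  "multigraded_maps m K F \<mu> \<longleftrightarrow>
     (\<forall>i. \<forall>b<free_rank F i. basis_deg F i b \<in> degrees m) \<and>
     (\<forall>i. homogeneous_matrix (free_rank F i) (free_rank F (Suc i)) (basis_deg F i) (basis_deg F (Suc i))
        (scalar_entry F i) (diff_entry F i)) \<and>
     (\<forall>b<free_rank F 0. aug F b = SR_class m K (single (basis_deg F 0 b) (\<mu> b)))"

lemma kernel_eq_image_iff:
  assumes "multigraded_maps m K (F :: ('k::field, 'k mpoly set) resolution) \<mu>"
  shows "{x \<in> free_module m (free_rank F (Suc i)). differential F (*) i x = 0} =
        differential F (*) (Suc i) ` free_module m (free_rank F (Suc (Suc i))) \<longleftrightarrow>
      (\<forall>a\<in>degrees m. {u \<in> strand_space (free_rank F (Suc i)) (basis_deg F (Suc i)) a.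
          scalar_map (free_rank F i) (free_rank F (Suc i)) (scalar_entry F i) u = 0} =
        scalar_map (free_rank F (Suc i)) (free_rank F (Suc (Suc i))) (scalar_entry F (Suc i)) `
          strand_space (free_rank F (Suc (Suc i))) (basis_deg F (Suc (Suc i))) a)"
proof -
  have deg: "\<And>i b. b < free_rank F i \<Longrightarrow> basis_deg F i b \<in> degrees m"
    and hom: "\<And>i. homogeneous_matrix (free_rank F i) (free_rank F (Suc i)) (basis_deg F i)
      (basis_deg F (Suc i)) (scalar_entry F i) (diff_entry F i)"
    using assms by (auto simp: multigraded_maps_def)
  have "differential F (*) i x = 0 \<longleftrightarrow> (\<forall>a\<in>degrees m.
      scalar_map (free_rank F i) (free_rank F (Suc i)) (scalar_entry F i) (strand (basis_deg F (Suc i)) a x) = 0)"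
    if x: "x \<in> free_module m (free_rank F (Suc i))" for x
  proof
    assume "differential F (*) i x = 0"
    hence "strand (basis_deg F i) a (differential F (*) i x) b = 0" for a b by (simp add: strand_def)
    thus "\<forall>a\<in>degrees m. scalar_map (free_rank F i) (free_rank F (Suc i)) (scalar_entry F i)
        (strand (basis_deg F (Suc i)) a x) = 0"
      unfolding differential_def by (simp add: strand_matrix_map[OF hom] fun_eq_iff)
  next
    assume z: "\<forall>a\<in>degrees m. scalar_map (free_rank F i) (free_rank F (Suc i)) (scalar_entry F i)
        (strand (basis_deg F (Suc i)) a x) = 0"
    have dx: "differential F (*) i x \<in> free_module m (free_rank F i)"
      unfolding differential_def by (rule matrix_map_in_free_module[OF hom deg x])
    have "differential F (*) i x b = (0 :: nat \<Rightarrow> 'k mpoly) b" for b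
    proof (rule strand_eqI)
      fix a
      have "strand (basis_deg F i) a (differential F (*) i x) b = 0"
      proof (cases "a \<in> degrees m")
        case True
        thus ?thesis using z unfolding differential_def by (simp add: strand_matrix_map[OF hom])
      next
        case False
        thus ?thesis by (intro strand_outside_degrees[OF dx]) (auto simp: deg)
      qed
      thus "strand (basis_deg F i) a (differential F (*) i x) b = strand (basis_deg F i) a 0 b"
        by (simp add: strand_def)
    qed
    thus "differential F (*) i x = 0" by (rule ext)
  qed
  hence K: "x \<in> {x \<in> free_module m (free_rank F (Suc i)). differential F (*) i x = 0} \<longleftrightarrow>
      x \<in> free_module m (free_rank F (Suc i)) \<and> (\<forall>a\<in>degrees m. strand (basis_deg F (Suc i)) a x \<in>
        {u \<in> strand_space (free_rank F (Suc i)) (basis_deg F (Suc i)) a.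
          scalar_map (free_rank F i) (free_rank F (Suc i)) (scalar_entry F i) u = 0})" for x
    using strand_in_strand_space[of x m "free_rank F (Suc i)" "basis_deg F (Suc i)"] by auto
  show ?thesis
    unfolding differential_def[of F "(*)" "Suc i"]
    by (rule kernel_image_strandwise[OF hom deg deg K])
      (auto simp: strand_space_def scalar_map_def fun_eq_iff)
qed

lemma augmentation_element:
  assumes SC: "simplicial_complex m K"
    and F: "multigraded_maps m K (F :: ('k::field, 'k mpoly set) resolution) \<mu>"
    and x: "x \<in> free_module m (free_rank F 0)"
  shows "\<exists>e\<in>carrier (polynomial_ring m).
    augmentation (stanley_reisner_module m K) F x = SR_class m K e \<and>
    (\<forall>a. lookup e a = (\<Sum>b<free_rank F 0. \<mu> b * strand (basis_deg F 0) a x b))"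
proof -
  have aug: "\<And>b. b < free_rank F 0 \<Longrightarrow> basis_deg F 0 b \<in> degrees m \<and>
      aug F b = SR_class m K (single (basis_deg F 0 b) (\<mu> b))"
    using F by (auto simp: multigraded_maps_def)
  let ?e = "\<Sum>b<free_rank F 0. single (basis_deg F 0 b) (\<mu> b) * x b"
  have "augmentation (stanley_reisner_module m K) F x = SR_class m K ?e"
    by (rule SR_augmentation(1)[OF SC x]) (rule aug)
  moreover have "?e \<in> carrier (polynomial_ring m)"
    by (rule SR_augmentation(2)[OF SC x]) (rule aug)
  moreover have "lookup ?e a = (\<Sum>b<free_rank F 0. \<mu> b * strand (basis_deg F 0) a x b)" for a
    by (rule SR_augmentation(3)[OF SC x]) (rule aug)
  ultimately show ?thesis by blast
qed

lemma augmentation_kernel_eq_image_iff: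
  assumes SC: "simplicial_complex m K"
    and F: "multigraded_maps m K (F :: ('k::field, 'k mpoly set) resolution) \<mu>"
  shows "{x \<in> free_module m (free_rank F 0).
          augmentation (stanley_reisner_module m K) F x = \<zero>\<^bsub>stanley_reisner_module m K\<^esub>} =
        differential F (*) 0 ` free_module m (free_rank F 1) \<longleftrightarrow>
      (\<forall>a\<in>degrees m. aug_kernel K (free_rank F 0) (basis_deg F 0) \<mu> a =
        scalar_map (free_rank F 0) (free_rank F 1) (scalar_entry F 0) `
          strand_space (free_rank F 1) (basis_deg F 1) a)"
proof -
  have deg: "\<And>i b. b < free_rank F i \<Longrightarrow> basis_deg F i b \<in> degrees m"
    and hom: "\<And>i. homogeneous_matrix (free_rank F i) (free_rank F (Suc i)) (basis_deg F i)
      (basis_deg F (Suc i)) (scalar_entry F i) (diff_entry F i)"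
    using F by (auto simp: multigraded_maps_def)
  have "augmentation (stanley_reisner_module m K) F x = \<zero>\<^bsub>stanley_reisner_module m K\<^esub> \<longleftrightarrow>
      (\<forall>a\<in>degrees m. keys a \<in> K \<longrightarrow>
        (\<Sum>b<free_rank F 0. \<mu> b * strand (basis_deg F 0) a x b) = 0)"
    if x: "x \<in> free_module m (free_rank F 0)" for x
  proof -
    obtain e where e: "augmentation (stanley_reisner_module m K) F x = SR_class m K e"
      "e \<in> carrier (polynomial_ring m)"
      "\<And>a. lookup e a = (\<Sum>b<free_rank F 0. \<mu> b * strand (basis_deg F 0) a x b)"
      using augmentation_element[OF SC F x] by blast
    show ?thesis
      unfolding e(1) SR_zero[OF SC]
        coset_eq_iff[OF stanley_reisner_ideal_eq[OF SC] e(2) polynomial_ring_zero] e(3) by simp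
  qed
  hence K: "x \<in> {x \<in> free_module m (free_rank F 0).
          augmentation (stanley_reisner_module m K) F x = \<zero>\<^bsub>stanley_reisner_module m K\<^esub>} \<longleftrightarrow>
      x \<in> free_module m (free_rank F 0) \<and>
      (\<forall>a\<in>degrees m. strand (basis_deg F 0) a x \<in> aug_kernel K (free_rank F 0) (basis_deg F 0) \<mu> a)" for x
    using strand_in_strand_space[of x m "free_rank F 0" "basis_deg F 0"] by (auto simp: aug_kernel_def)
  show ?thesis
    unfolding differential_def One_nat_def
    by (rule kernel_image_strandwise[OF hom deg deg K])
      (auto simp: aug_kernel_def strand_space_def)
qed

text \<open>
  All that Hochster's formula needs to know about a resolution.
\<close>

lemma free_resolution_exact_strands:
  assumes SC: "simplicial_complex m K"
    and F: "free_resolution m (stanley_reisner_module m K) (stanley_reisner_grading m K)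
      (F :: ('k::field, 'k mpoly set) resolution)"
  shows "\<exists>\<mu>. multigraded_maps m K F \<mu> \<and>
    exact_strands m K (free_rank F) (basis_deg F) (scalar_entry F) \<mu>"
proof -
  have deg: "\<And>i b. b < free_rank F i \<Longrightarrow> basis_deg F i b \<in> degrees m"
    and entry: "\<And>i b c t. b < free_rank F i \<Longrightarrow> c < free_rank F (Suc i) \<Longrightarrow>
      t \<in> keys (diff_entry F i b c) \<Longrightarrow> t + basis_deg F i b = basis_deg F (Suc i) c"
    and aug: "\<And>b. b < free_rank F 0 \<Longrightarrow> aug F b \<in> stanley_reisner_grading m K (basis_deg F 0 b)"
    using F by (simp_all add: free_resolution_def)
  have surj: "augmentation (stanley_reisner_module m K) F ` free_module m (free_rank F 0) =
      carrier (stanley_reisner_module m K)"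
    and ker0: "{x \<in> free_module m (free_rank F 0).
          augmentation (stanley_reisner_module m K) F x = \<zero>\<^bsub>stanley_reisner_module m K\<^esub>} =
        differential F (*) 0 ` free_module m (free_rank F 1)"
    and ker: "\<And>i. {x \<in> free_module m (free_rank F (Suc i)). differential F (*) i x = 0} =
        differential F (*) (Suc i) ` free_module m (free_rank F (Suc (Suc i)))"
    using F unfolding free_resolution_def by blast+
  have "\<forall>b<free_rank F 0. \<exists>c. aug F b = SR_class m K (single (basis_deg F 0 b) c)"
    using SR_grading_eq[OF SC aug deg] by blast
  then obtain \<mu> where \<mu>: "\<And>b. b < free_rank F 0 \<Longrightarrow>
      aug F b = SR_class m K (single (basis_deg F 0 b) (\<mu> b))"
    by metis
  have hom: "homogeneous_matrix (free_rank F i) (free_rank F (Suc i)) (basis_deg F i)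
      (basis_deg F (Suc i)) (scalar_entry F i) (diff_entry F i)" for i
    unfolding homogeneous_matrix_def
  proof (intro allI impI conjI)
    fix b c assume bc: "b < free_rank F i" "c < free_rank F (Suc i)"
    have t: "t = basis_deg F (Suc i) c - basis_deg F i b" if "t \<in> keys (diff_entry F i b c)" for t
      using entry[OF bc that] by (metis add_diff_cancel_right')
    show "diff_entry F i b c =
        single (basis_deg F (Suc i) c - basis_deg F i b) (scalar_entry F i b c)"
      using t by (intro poly_mapping_eqI) (auto simp: lookup_single when_def scalar_entry_def in_keys_iff)
    show "exp_le (basis_deg F i b) (basis_deg F (Suc i) c)" if "scalar_entry F i b c \<noteq> 0"
      using entry[OF bc, of "basis_deg F (Suc i) c - basis_deg F i b"] that exp_le_add(1)
      by (metis in_keys_iff scalar_entry_def)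
  qed
  have mg: "multigraded_maps m K F \<mu>"
    using deg hom \<mu> by (simp add: multigraded_maps_def)
  have "\<exists>u\<in>strand_space (free_rank F 0) (basis_deg F 0) a. (\<Sum>b<free_rank F 0. \<mu> b * u b) = 1"
    if a: "a \<in> degrees m" "keys a \<in> K" for a
  proof -
    have s: "single a (1 :: 'k) \<in> carrier (polynomial_ring m)"
      using a by (simp add: polynomial_ring_def)
    hence "SR_class m K (single a (1 :: 'k)) \<in> carrier (stanley_reisner_module m K)"
      unfolding SR_carrier[OF SC] by (rule imageI)
    then obtain x where x: "x \<in> free_module m (free_rank F 0)"
      "SR_class m K (single a (1 :: 'k)) = augmentation (stanley_reisner_module m K) F x"
      using surj by (metis imageE)
    obtain e where e: "augmentation (stanley_reisner_module m K) F x = SR_class m K e"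
      "e \<in> carrier (polynomial_ring m)"
      "\<And>a. lookup e a = (\<Sum>b<free_rank F 0. \<mu> b * strand (basis_deg F 0) a x b)"
      using augmentation_element[OF SC mg x(1)] by blast
    have "\<forall>a'\<in>degrees m. keys a' \<in> K \<longrightarrow>
        lookup (single a (1 :: 'k)) a' = lookup e a'"
      using x(2) unfolding e(1) coset_eq_iff[OF stanley_reisner_ideal_eq[OF SC] s e(2)] .
    hence "(\<Sum>b<free_rank F 0. \<mu> b * strand (basis_deg F 0) a x b) = 1"
      using a e(3) by (metis lookup_single_eq)
    thus ?thesis using strand_in_strand_space[OF x(1)] by (rule bexI)
  qed
  moreover have "\<forall>i. \<forall>b<free_rank F i. \<forall>c<free_rank F (Suc i). scalar_entry F i b c \<noteq> 0 \<longrightarrow>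
      exp_le (basis_deg F i b) (basis_deg F (Suc i) c)"
    using hom unfolding homogeneous_matrix_def by blast
  ultimately have "exact_strands m K (free_rank F) (basis_deg F) (scalar_entry F) \<mu>"
    using ker0[unfolded augmentation_kernel_eq_image_iff[OF SC mg]]
      ker[unfolded kernel_eq_image_iff[OF mg]]
    unfolding exact_strands_def by (intro conjI ballI allI impI; blast)
  thus ?thesis using mg by blast
qed


section \<open>A free resolution of the Stanley--Reisner ring\<close>

text \<open>
  The \<open>i\<close>-th module has one generator for each sequence of \<open>i\<close> nonfaces; its degree is the union of
  the sequence. The differential is the alternating sum of the removals of one term. Sequences are encoded as numbers \<open>b\<close>
  below \<open>N ^ i\<close>, written in base \<open>N\<close>: the first term is \<open>b mod N\<close> and the remaining sequence is
  \<open>b div N\<close>. Unlike in Taylor's resolution, which uses subsets of the generators, no signs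
  depending on an order are needed, at the price of a resolution that in general does not stop.
\<close>

primrec bar_support :: "(nat \<Rightarrow> nat set) \<Rightarrow> nat \<Rightarrow> nat \<Rightarrow> nat \<Rightarrow> nat set" where
  "bar_support G N 0 b = {}"
| "bar_support G N (Suc i) b = G (b mod N) \<union> bar_support G N i (b div N)"

text \<open>
  Removing the first term of \<open>c\<close> gives \<open>c div N\<close>; the other removals keep the first term and are
  removals from \<open>c div N\<close>, with the opposite sign.
\<close>

primrec bar_entry :: "nat \<Rightarrow> nat \<Rightarrow> nat \<Rightarrow> nat \<Rightarrow> 'k::field" where
  "bar_entry N 0 b c = (if b = c div N then 1 else 0)"
| "bar_entry N (Suc i) b c =
     (if b = c div N then 1 else 0) - (if b mod N = c mod N then bar_entry N i (b div N) (c div N) else 0)"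

lemma sum_over_last_digit:
  fixes f :: "nat \<Rightarrow> 'k::field"
  assumes "g < N"
  shows "(\<Sum>c<N ^ Suc i. if c mod N = g then f (c div N) else 0) = (\<Sum>e<N ^ i. f e)"
proof -
  have "(\<Sum>c<N ^ Suc i. if c mod N = g then f (c div N) else 0) =
      (\<Sum>c\<in>{c. c < N ^ Suc i \<and> c mod N = g}. f (c div N))"
    by (subst sum.inter_filter[symmetric]) (auto intro!: sum.cong)
  also have "\<dots> = (\<Sum>e<N ^ i. f e)"
  proof (rule sum.reindex_bij_witness[where i = "\<lambda>e. g + N * e" and j = "\<lambda>c. c div N"])
    fix e assume "e \<in> {..<N ^ i}"
    hence "Suc e * N \<le> N ^ i * N" by (intro mult_right_mono) auto
    thus "g + N * e \<in> {c. c < N ^ Suc i \<and> c mod N = g}"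
      using assms by (simp add: algebra_simps)
  qed (use assms in \<open>auto simp: less_mult_imp_div_less mult.commute\<close>)
  finally show ?thesis .
qed

lemma div_less_power:
  fixes N :: nat
  assumes "c < N ^ Suc i"
  shows "c div N < N ^ i" "0 < N"
proof -
  show "0 < N" by (rule gr0I) (use assms in simp)
  show "c div N < N ^ i" using assms less_mult_imp_div_less[of c "N ^ i" N] by (simp add: mult.commute)
qed

lemma bar_support_mono:
  assumes "bar_entry N i b c \<noteq> (0 :: 'k::field)"
  shows "bar_support G N i b \<subseteq> bar_support G N (Suc i) c"
  using assms
proof (induction i arbitrary: b c)
  case (Suc i)
  show ?case
  proof (cases "b = c div N")
    case False
    hence b: "b mod N = c mod N" "bar_entry N i (b div N) (c div N) \<noteq> (0 :: 'k)"
      using Suc.prems by (auto split: if_splits)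
    show ?thesis using Suc.IH[OF b(2)] b(1) by auto
  qed auto
qed simp

lemma bar_entry_prepend:
  assumes "g < N"
  shows "(\<Sum>c<N ^ Suc i. bar_entry N i b c * (if c mod N = g then f (c div N) else (0 :: 'k::field))) =
    (\<Sum>e<N ^ i. ((if b = e then 1 else 0) -
      (case i of 0 \<Rightarrow> 0 | Suc j \<Rightarrow> if b mod N = g then bar_entry N j (b div N) e else 0)) * f e)"
proof -
  have "(\<Sum>c<N ^ Suc i. bar_entry N i b c * (if c mod N = g then f (c div N) else 0)) =
      (\<Sum>c<N ^ Suc i. if c mod N = g then ((if b = c div N then 1 else 0) -
        (case i of 0 \<Rightarrow> 0 | Suc j \<Rightarrow> if b mod N = g then bar_entry N j (b div N) (c div N) else 0)) *
        f (c div N) else 0)"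
    by (intro sum.cong refl) (auto split: nat.splits)
  also have "\<dots> = (\<Sum>e<N ^ i. ((if b = e then 1 else 0) -
      (case i of 0 \<Rightarrow> 0 | Suc j \<Rightarrow> if b mod N = g then bar_entry N j (b div N) e else 0)) * f e)"
    by (rule sum_over_last_digit[OF assms])
  finally show ?thesis .
qed

text \<open>
  If \<open>d\<close> is the map on sequences and \<open>g s\<close> denotes \<open>s\<close> with \<open>g\<close> put in front, then \<open>d (g s) = s - g (d s)\<close>, hence
  \<open>d (d (g s)) = d s - (d s - g (d (d s))) = 0\<close> by induction.
\<close>

lemma bar_entry_square_zero:
  assumes "b < N ^ i" "d < N ^ Suc (Suc i)"
  shows "(\<Sum>c<N ^ Suc i. bar_entry N i b c * bar_entry N (Suc i) c d) = (0 :: 'k::field)"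
  using assms
proof (induction i arbitrary: b d)
  case i0: 0
  have N: "d div N < N ^ Suc 0" "0 < N" using div_less_power[OF i0(2)] by auto
  have "(\<Sum>c<N ^ Suc 0. bar_entry N 0 b c * bar_entry N (Suc 0) c d) =
      (\<Sum>c<N ^ Suc 0. if c = d div N then bar_entry N 0 b c else 0) -
      (\<Sum>c<N ^ Suc 0. bar_entry N 0 b c *
        (if c mod N = d mod N then bar_entry N 0 (c div N) (d div N) else (0 :: 'k)))"
    unfolding sum_subtractf[symmetric] by (intro sum.cong refl) (simp add: algebra_simps)
  also have "(\<Sum>c<N ^ Suc 0. if c = d div N then bar_entry N 0 b c else (0 :: 'k)) = bar_entry N 0 b (d div N)"
    using N by simp
  also have "(\<Sum>c<N ^ Suc 0. bar_entry N 0 b c *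
        (if c mod N = d mod N then bar_entry N 0 (c div N) (d div N) else (0 :: 'k))) =
      bar_entry N 0 b (d div N)"
    using bar_entry_prepend[of "d mod N" N 0 b "\<lambda>e. bar_entry N 0 e (d div N) :: 'k"] N i0 by simp
  finally show ?case by simp
next
  case (Suc j)
  let ?i = "Suc j"
  have N: "d div N < N ^ Suc ?i" "0 < N" using div_less_power[OF Suc.prems(2)] by auto
  have bN: "b div N < N ^ j" using div_less_power[OF Suc.prems(1)] by auto
  have "(\<Sum>c<N ^ Suc ?i. bar_entry N ?i b c * bar_entry N (Suc ?i) c d) =
      (\<Sum>c<N ^ Suc ?i. if c = d div N then bar_entry N ?i b c else 0) -
      (\<Sum>c<N ^ Suc ?i. bar_entry N ?i b c *
        (if c mod N = d mod N then bar_entry N ?i (c div N) (d div N) else (0 :: 'k)))"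
    unfolding sum_subtractf[symmetric] bar_entry.simps(2)[of N ?i]
    by (intro sum.cong refl) (auto simp: right_diff_distrib simp del: bar_entry.simps)
  also have "(\<Sum>c<N ^ Suc ?i. if c = d div N then bar_entry N ?i b c else (0 :: 'k)) = bar_entry N ?i b (d div N)"
    using N by simp
  also have "(\<Sum>c<N ^ Suc ?i. bar_entry N ?i b c *
        (if c mod N = d mod N then bar_entry N ?i (c div N) (d div N) else (0 :: 'k))) =
      (\<Sum>e<N ^ ?i. ((if b = e then 1 else 0) - (if b mod N = d mod N then bar_entry N j (b div N) e else 0)) *
        bar_entry N ?i e (d div N))"
    using bar_entry_prepend[of "d mod N" N ?i b "\<lambda>e. bar_entry N ?i e (d div N) :: 'k"] N by simp
  also have "\<dots> = (\<Sum>e<N ^ ?i. if e = b then bar_entry N ?i b (d div N) else 0) -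
      (if b mod N = d mod N then \<Sum>e<N ^ ?i. bar_entry N j (b div N) e * bar_entry N ?i e (d div N) else 0)"
  proof -
    have "(\<Sum>e<N ^ ?i. ((if b = e then 1 else 0) -
          (if b mod N = d mod N then bar_entry N j (b div N) e else 0)) * bar_entry N ?i e (d div N)) =
        (\<Sum>e<N ^ ?i. (if e = b then bar_entry N ?i b (d div N) else 0) -
          (if b mod N = d mod N then bar_entry N j (b div N) e * bar_entry N ?i e (d div N) else (0 :: 'k)))"
      by (intro sum.cong refl) (auto simp: left_diff_distrib simp del: bar_entry.simps)
    thus ?thesis by (simp add: sum_subtractf del: bar_entry.simps power_Suc)
  qed
  also have "(\<Sum>e<N ^ ?i. bar_entry N j (b div N) e * bar_entry N ?i e (d div N)) = (0 :: 'k)"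
    by (rule Suc.IH[OF bN N(1)])
  also have "(\<Sum>e<N ^ ?i. if e = b then bar_entry N ?i b (d div N) else (0 :: 'k)) = bar_entry N ?i b (d div N)"
    using Suc.prems(1) by simp
  finally show ?case by simp
qed

text \<open>
  Putting a fixed term \<open>g\<close> in front of all sequences is a contracting homotopy, again by
  \<open>d (g s) = s - g (d s)\<close>.
\<close>

lemma bar_entry_contraction:
  fixes u :: "nat \<Rightarrow> 'k::field"
  assumes "g < N" "b < N ^ i"
    and "\<And>j. i = Suc j \<Longrightarrow> scalar_map (N ^ j) (N ^ Suc j) (bar_entry N j) u = 0"
  shows "scalar_map (N ^ i) (N ^ Suc i) (bar_entry N i) (\<lambda>c. if c mod N = g then u (c div N) else 0) b = u b"
proof -
  have "scalar_map (N ^ i) (N ^ Suc i) (bar_entry N i) (\<lambda>c. if c mod N = g then u (c div N) else 0) b =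
    (\<Sum>e<N ^ i. ((if b = e then 1 else 0) -
      (case i of 0 \<Rightarrow> 0 | Suc j \<Rightarrow> if b mod N = g then bar_entry N j (b div N) e else 0)) * u e)"
    unfolding scalar_map_def using bar_entry_prepend[OF assms(1), of i b u] assms(2) by simp
  also have "\<dots> = (\<Sum>e<N ^ i. if e = b then u b else 0) - (\<Sum>e<N ^ i.
      (case i of 0 \<Rightarrow> 0 | Suc j \<Rightarrow> if b mod N = g then bar_entry N j (b div N) e else 0) * u e)"
    unfolding sum_subtractf[symmetric] by (intro sum.cong refl) (auto simp: left_diff_distrib)
  also have "(\<Sum>e<N ^ i. if e = b then u b else 0) = u b" using assms(2) by simp
  also have "(\<Sum>e<N ^ i. (case i of 0 \<Rightarrow> 0
      | Suc j \<Rightarrow> if b mod N = g then bar_entry N j (b div N) e else 0) * u e) = 0"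
  proof (cases i)
    case (Suc j)
    have "b div N < N ^ j" using div_less_power[of b N j] assms(2) Suc by simp
    moreover have "scalar_map (N ^ j) (N ^ Suc j) (bar_entry N j) u (b div N) = 0"
      using assms(3)[OF Suc] by simp
    ultimately have "(\<Sum>e<N ^ i. bar_entry N j (b div N) e * u e) = 0"
      using Suc by (simp add: scalar_map_def)
    thus ?thesis using Suc by (cases "b mod N = g") simp_all
  qed simp
  finally show ?thesis by simp
qed

lemma exp_le_indicator_degree: "finite S \<Longrightarrow> exp_le (indicator_degree S) a \<longleftrightarrow> S \<subseteq> keys a"
  by (auto simp: exp_le_def lookup_indicator_degree in_keys_iff subset_iff Suc_le_eq)

context
  fixes m :: nat and K :: "nat set set" and G :: "nat \<Rightarrow> nat set" and N :: nat
  assumes K: "simplicial_complex m K"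
    and G: "G ` {..<N} = {\<tau>. \<tau> \<subseteq> {1..m} \<and> \<tau> \<notin> K}"
begin

abbreviation "bar_degree \<equiv> \<lambda>i b. indicator_degree (bar_support G N i b)"

lemma bar_support_subset: "b < N ^ i \<Longrightarrow> bar_support G N i b \<subseteq> {1..m}"
proof (induction i arbitrary: b)
  case (Suc i)
  have "b mod N < N" using div_less_power(2)[OF Suc.prems] by simp
  hence "G (b mod N) \<subseteq> {1..m}" using G by blast
  thus ?case using Suc.IH[of "b div N"] div_less_power(1)[OF Suc.prems] by simp
qed simp

lemma bar_support_finite: "b < N ^ i \<Longrightarrow> finite (bar_support G N i b)"
  using bar_support_subset finite_subset by blast

lemma bar_degree_in_degrees: "b < N ^ i \<Longrightarrow> bar_degree i b \<in> degrees m"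
  using bar_support_subset bar_support_finite by (simp add: degrees_def keys_indicator_degree)

lemma bar_strand_space: "u \<in> strand_space (N ^ i) (bar_degree i) a \<longleftrightarrow>
    (\<forall>b. u b \<noteq> 0 \<longrightarrow> b < N ^ i \<and> bar_support G N i b \<subseteq> keys a)"
  using exp_le_indicator_degree[OF bar_support_finite] by (auto simp: strand_space_def)

lemma bar_homogeneous:
  "homogeneous_matrix (N ^ i) (N ^ Suc i) (bar_degree i) (bar_degree (Suc i)) (bar_entry N i)
    (\<lambda>b c. single (bar_degree (Suc i) c - bar_degree i b) (bar_entry N i b c :: 'k::field))"
  unfolding homogeneous_matrix_def
proof (intro allI impI conjI refl)
  fix b c assume bc: "b < N ^ i" "c < N ^ Suc i" "bar_entry N i b c \<noteq> (0 :: 'k)"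
  show "exp_le (bar_degree i b) (bar_degree (Suc i) c)"
    unfolding exp_le_indicator_degree[OF bar_support_finite[OF bc(1)]]
      keys_indicator_degree[OF bar_support_finite[OF bc(2)]]
    by (rule bar_support_mono[OF bc(3)])
qed

text \<open>
  A union of nonfaces is not contained in a face.
\<close>

lemma bar_strands_face:
  assumes "keys a \<in> K"
  shows "strand_space (N ^ Suc i) (bar_degree (Suc i)) a = {0 :: nat \<Rightarrow> 'k::field}"
proof -
  have "u b = 0" if u: "u \<in> strand_space (N ^ Suc i) (bar_degree (Suc i)) a" for u :: "nat \<Rightarrow> 'k" and b
  proof (rule ccontr)
    assume "u b \<noteq> 0"
    hence b: "b < N ^ Suc i" "G (b mod N) \<subseteq> keys a"
      using u unfolding bar_strand_space by auto
    have "b mod N < N" using div_less_power(2)[OF b(1)] by simp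
    hence "G (b mod N) \<notin> K" using G by blast
    thus False using K assms b(2) unfolding simplicial_complex_def by blast
  qed
  moreover have "(0 :: nat \<Rightarrow> 'k) \<in> strand_space (N ^ Suc i) (bar_degree (Suc i)) a"
    by (simp add: strand_space_def)
  ultimately show ?thesis by (auto simp: fun_eq_iff)
qed

text \<open>
  In a degree whose support is a nonface, that support itself can be put in front of all sequences
  without leaving the degree.
\<close>

lemma bar_prepend_in_strand_space:
  fixes u :: "nat \<Rightarrow> 'k::field"
  assumes u: "u \<in> strand_space (N ^ i) (bar_degree i) a" and g: "g < N" "G g = keys a"
  shows "(\<lambda>c. if c mod N = g then u (c div N) else 0) \<in> strand_space (N ^ Suc i) (bar_degree (Suc i)) a"
  unfolding bar_strand_space
proof (intro allI impI)
  fix c assume nz: "(if c mod N = g then u (c div N) else 0) \<noteq> 0"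
  hence c: "c mod N = g" "c div N < N ^ i" "bar_support G N i (c div N) \<subseteq> keys a"
    using u unfolding bar_strand_space by (auto split: if_splits)
  have "c < N ^ Suc i" using c(2) g(1) by (simp add: div_less_iff_less_mult mult.commute)
  thus "c < N ^ Suc i \<and> bar_support G N (Suc i) c \<subseteq> keys a"
    using c g(2) by simp
qed

lemma bar_scalar_map_square_zero:
  "scalar_map (N ^ i) (N ^ Suc i) (bar_entry N i)
    (scalar_map (N ^ Suc i) (N ^ Suc (Suc i)) (bar_entry N (Suc i)) v) = (0 :: nat \<Rightarrow> 'k::field)"
proof
  fix b
  show "scalar_map (N ^ i) (N ^ Suc i) (bar_entry N i)
    (scalar_map (N ^ Suc i) (N ^ Suc (Suc i)) (bar_entry N (Suc i)) v) b = (0 :: nat \<Rightarrow> 'k) b"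
  proof (cases "b < N ^ i")
    case True
    have "(\<Sum>c<N ^ Suc i. bar_entry N i b c * (\<Sum>d<N ^ Suc (Suc i). bar_entry N (Suc i) c d * v d)) =
        (\<Sum>d<N ^ Suc (Suc i). (\<Sum>c<N ^ Suc i. bar_entry N i b c * bar_entry N (Suc i) c d) * v d)"
      unfolding sum_distrib_left sum_distrib_right mult.assoc[symmetric] by (rule sum.swap)
    also have "\<dots> = 0"
    proof (rule sum.neutral, rule ballI)
      fix d assume "d \<in> {..<N ^ Suc (Suc i)}"
      hence "(\<Sum>c<N ^ Suc i. bar_entry N i b c * bar_entry N (Suc i) c d) = (0 :: 'k)"
        by (intro bar_entry_square_zero[OF True]) (simp only: lessThan_iff)
      thus "(\<Sum>c<N ^ Suc i. bar_entry N i b c * bar_entry N (Suc i) c d) * v d = 0" by (simp only: mult_zero_left)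
    qed
    finally show ?thesis using True unfolding scalar_map_def by simp
  qed (simp add: scalar_map_def)
qed

lemma exact_bar_strands:
  "exact_strands m K (\<lambda>i. N ^ i) bar_degree (bar_entry N) (\<lambda>_. 1 :: 'k::field)"
  unfolding exact_strands_def
proof (intro conjI allI impI ballI)
  fix i b c assume "b < N ^ i" "c < N ^ Suc i" "bar_entry N i b c \<noteq> (0 :: 'k)"
  thus "exp_le (bar_degree i b) (bar_degree (Suc i) c)"
    using bar_homogeneous[of i, where ?'k = 'k] unfolding homogeneous_matrix_def by blast
next
  fix a :: expo assume "keys a \<in> K"
  show "\<exists>u\<in>strand_space (N ^ 0) (bar_degree 0) a. (\<Sum>b<N ^ 0. (1 :: 'k) * u b) = 1"
  proof (rule bexI[of _ "\<lambda>b. if b = 0 then 1 else 0"])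
    show "(\<lambda>b. if b = 0 then 1 else 0 :: 'k) \<in> strand_space (N ^ 0) (bar_degree 0) a"
      unfolding bar_strand_space by simp
  qed simp
next
  fix a assume a: "a \<in> degrees m"
  show "aug_kernel K (N ^ 0) (bar_degree 0) (\<lambda>_. 1 :: 'k) a =
      scalar_map (N ^ 0) (N ^ 1) (bar_entry N 0) ` strand_space (N ^ 1) (bar_degree 1) a"
  proof (cases "keys a \<in> K")
    case True
    have "aug_kernel K (N ^ 0) (bar_degree 0) (\<lambda>_. 1 :: 'k) a = {0}"
    proof (intro equalityI subsetI)
      fix u assume "u \<in> aug_kernel K (N ^ 0) (bar_degree 0) (\<lambda>_. 1 :: 'k) a"
      hence u: "u \<in> strand_space (N ^ 0) (bar_degree 0) a" and "(\<Sum>b<N ^ 0. 1 * u b) = 0"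
        using True unfolding aug_kernel_def by blast+
      have "u b = 0" for b
      proof (cases "b = 0")
        case False
        thus ?thesis using u unfolding bar_strand_space by force
      qed (use \<open>(\<Sum>b<N ^ 0. 1 * u b) = 0\<close> in simp)
      thus "u \<in> {0}" by (simp add: fun_eq_iff)
    qed (simp add: aug_kernel_def strand_space_def)
    moreover have "scalar_map (N ^ 0) (N ^ 1) (bar_entry N 0) 0 = (0 :: nat \<Rightarrow> 'k)"
      by (simp add: scalar_map_def fun_eq_iff)
    ultimately show ?thesis using bar_strands_face[OF True, of 0, where ?'k = 'k] by simp
  next
    case False
    hence "keys a \<in> G ` {..<N}" unfolding G using a by (simp add: degrees_def)
    then obtain g where g: "g < N" "G g = keys a" by auto
    have "u \<in> scalar_map (N ^ 0) (N ^ 1) (bar_entry N 0) ` strand_space (N ^ 1) (bar_degree 1) a"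
      if u: "u \<in> strand_space (N ^ 0) (bar_degree 0) a" for u :: "nat \<Rightarrow> 'k"
    proof (rule image_eqI)
      show "u = scalar_map (N ^ 0) (N ^ 1) (bar_entry N 0) (\<lambda>c. if c mod N = g then u (c div N) else 0)"
      proof
        fix b
        show "u b = scalar_map (N ^ 0) (N ^ 1) (bar_entry N 0) (\<lambda>c. if c mod N = g then u (c div N) else 0) b"
        proof (cases "b < N ^ 0")
          case True
          from bar_entry_contraction[OF g(1) this, of u] show ?thesis by simp
        next
          case False
          thus ?thesis using u unfolding bar_strand_space by (auto simp: scalar_map_def)
        qed
      qed
    qed (use bar_prepend_in_strand_space[OF u g] in simp)
    moreover have "scalar_map (N ^ 0) (N ^ 1) (bar_entry N 0) v \<in> strand_space (N ^ 0) (bar_degree 0) a"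
      if "v \<in> strand_space (N ^ 1) (bar_degree 1) a" for v :: "nat \<Rightarrow> 'k"
      using scalar_map_in_strand_space[OF bar_homogeneous[of 0]] that by simp
    ultimately show ?thesis using False unfolding aug_kernel_def by auto
  qed
next
  fix a i assume a: "a \<in> degrees m"
  show "{u \<in> strand_space (N ^ Suc i) (bar_degree (Suc i)) a.
        scalar_map (N ^ i) (N ^ Suc i) (bar_entry N i) u = (0 :: nat \<Rightarrow> 'k)} =
      scalar_map (N ^ Suc i) (N ^ Suc (Suc i)) (bar_entry N (Suc i)) `
        strand_space (N ^ Suc (Suc i)) (bar_degree (Suc (Suc i))) a" (is "?Z = ?B")
  proof (intro equalityI subsetI)
    fix u assume "u \<in> ?B"
    thus "u \<in> ?Z"
      using scalar_map_in_strand_space[OF bar_homogeneous[of "Suc i"]] bar_scalar_map_square_zero by blast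
  next
    fix u assume "u \<in> ?Z"
    hence u: "u \<in> strand_space (N ^ Suc i) (bar_degree (Suc i)) a"
      "scalar_map (N ^ i) (N ^ Suc i) (bar_entry N i) u = 0" by blast+
    show "u \<in> ?B"
    proof (cases "keys a \<in> K")
      case True
      have "u = scalar_map (N ^ Suc i) (N ^ Suc (Suc i)) (bar_entry N (Suc i)) 0"
        using u(1) unfolding bar_strands_face[OF True] by (auto simp: scalar_map_def fun_eq_iff)
      thus ?thesis using bar_strands_face[OF True, of "Suc i", where ?'k = 'k] by blast
    next
      case False
      hence "keys a \<in> G ` {..<N}" unfolding G using a by (simp add: degrees_def)
      then obtain g where g: "g < N" "G g = keys a" by auto
      show ?thesis
      proof (rule image_eqI)
        show "u = scalar_map (N ^ Suc i) (N ^ Suc (Suc i)) (bar_entry N (Suc i))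
            (\<lambda>c. if c mod N = g then u (c div N) else 0)"
        proof
          fix b
          show "u b = scalar_map (N ^ Suc i) (N ^ Suc (Suc i)) (bar_entry N (Suc i))
            (\<lambda>c. if c mod N = g then u (c div N) else 0) b"
          proof (cases "b < N ^ Suc i")
            case True
            have "scalar_map (N ^ j) (N ^ Suc j) (bar_entry N j) u = 0" if "Suc i = Suc j" for j
              using u(2) that by blast
            from bar_entry_contraction[OF g(1) True this] show ?thesis by (rule sym)
          next
            case False
            thus ?thesis using u(1) unfolding bar_strand_space scalar_map_def by auto
          qed
        qed
      qed (rule bar_prepend_in_strand_space[OF u(1) g])
    qed
  qed
qed

definition bar_resolution :: "('k::field, 'k mpoly set) resolution" where
  "bar_resolution = \<lparr>free_rank = (\<lambda>i. N ^ i), basis_deg = bar_degree,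
     diff_entry = (\<lambda>i b c. single (bar_degree (Suc i) c - bar_degree i b) (bar_entry N i b c)),
     aug = (\<lambda>b. SR_class m K (single (bar_degree 0 b) 1))\<rparr>"

lemma bar_resolution_sel [simp]:
  "free_rank bar_resolution i = N ^ i" "basis_deg bar_resolution = bar_degree"
  "diff_entry bar_resolution i b c =
    single (bar_degree (Suc i) c - bar_degree i b) (bar_entry N i b c)"
  "aug bar_resolution b = SR_class m K (single (bar_degree 0 b) 1)"
  "scalar_entry bar_resolution i b c = bar_entry N i b c"
  by (simp_all add: bar_resolution_def scalar_entry_def)

lemma bar_multigraded: "multigraded_maps m K (bar_resolution :: ('k::field, 'k mpoly set) resolution) (\<lambda>_. 1)"
proof -
  have "homogeneous_matrix (N ^ i) (N ^ Suc i) (bar_degree i) (bar_degree (Suc i))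
      (scalar_entry bar_resolution i) (diff_entry (bar_resolution :: ('k, 'k mpoly set) resolution) i)" for i
    using bar_homogeneous[of i, where ?'k = 'k] unfolding homogeneous_matrix_def by simp
  thus ?thesis unfolding multigraded_maps_def by (simp add: bar_degree_in_degrees del: power_Suc)
qed

lemma bar_resolution_free_resolution:
  "free_resolution m (stanley_reisner_module m K) (stanley_reisner_grading m K)
    (bar_resolution :: ('k::field, 'k mpoly set) resolution)"
  unfolding free_resolution_def
proof (intro conjI allI impI ballI)
  let ?F = "bar_resolution :: ('k, 'k mpoly set) resolution"
  have sc: "scalar_entry ?F = bar_entry N" by (simp add: fun_eq_iff)
  note ex = exact_bar_strands[where ?'k = 'k, unfolded exact_strands_def]
  show "{x \<in> free_module m (free_rank ?F 0).
          augmentation (stanley_reisner_module m K) ?F x = \<zero>\<^bsub>stanley_reisner_module m K\<^esub>} =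
        differential ?F (*) 0 ` free_module m (free_rank ?F 1)"
    unfolding augmentation_kernel_eq_image_iff[OF K bar_multigraded]
    unfolding sc bar_resolution_sel using ex by blast
  show "{x \<in> free_module m (free_rank ?F (Suc i)). differential ?F (*) i x = 0} =
        differential ?F (*) (Suc i) ` free_module m (free_rank ?F (Suc (Suc i)))" for i
    unfolding kernel_eq_image_iff[OF bar_multigraded]
    unfolding sc bar_resolution_sel using ex by blast
  fix i b assume b: "b < free_rank ?F i"
  show "basis_deg ?F i b \<in> degrees m" using b by (simp add: bar_degree_in_degrees)
  fix c assume c: "c < free_rank ?F (Suc i)"
  hence c': "c < N ^ Suc i" by simp
  show "diff_entry ?F i b c \<in> carrier (polynomial_ring m)"
    using degrees_diff[OF bar_degree_in_degrees[OF c']] by (simp add: polynomial_ring_def)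
  fix t assume t: "t \<in> keys (diff_entry ?F i b c)"
  hence nz: "bar_entry N i b c \<noteq> (0 :: 'k)" and t': "t = bar_degree (Suc i) c - bar_degree i b"
    by (auto split: if_splits)
  have "exp_le (bar_degree i b) (bar_degree (Suc i) c)"
    using bar_homogeneous[of i, where ?'k = 'k] b c' nz unfolding homogeneous_matrix_def by simp
  thus "t + basis_deg ?F i b = basis_deg ?F (Suc i) c"
    unfolding t' bar_resolution_sel by (rule exp_le_diff_add)
next
  let ?F = "bar_resolution :: ('k, 'k mpoly set) resolution"
  fix b assume "b < free_rank ?F 0"
  have "single (bar_degree 0 b) (1 :: 'k) \<in> carrier (polynomial_ring m)"
    by (simp add: polynomial_ring_def degrees_def indicator_degree_def)
  thus "aug ?F b \<in> carrier (stanley_reisner_module m K)"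
    and "aug ?F b \<in> stanley_reisner_grading m K (basis_deg ?F 0 b)"
    unfolding SR_carrier[OF K] stanley_reisner_grading_def bar_resolution_sel by auto
next
  let ?F = "bar_resolution :: ('k, 'k mpoly set) resolution"
  have el: "\<exists>e\<in>carrier (polynomial_ring m). augmentation (stanley_reisner_module m K) ?F x = SR_class m K e \<and>
      (\<forall>a. lookup e a = lookup (x 0) a)"
    if x: "x \<in> free_module m (free_rank ?F 0)" for x
    using augmentation_element[OF K bar_multigraded x]
    by (simp add: strand_def exp_le_def indicator_degree_def)
  show "augmentation (stanley_reisner_module m K) ?F ` free_module m (free_rank ?F 0) =
      carrier (stanley_reisner_module m K)"
  proof (intro equalityI subsetI)
    fix X assume "X \<in> augmentation (stanley_reisner_module m K) ?F ` free_module m (free_rank ?F 0)"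
    then obtain x where "x \<in> free_module m (free_rank ?F 0)"
      "X = augmentation (stanley_reisner_module m K) ?F x" by blast
    thus "X \<in> carrier (stanley_reisner_module m K)"
      unfolding SR_carrier[OF K] using el[of x] by blast
  next
    fix X :: "'k mpoly set" assume "X \<in> carrier (stanley_reisner_module m K)"
    then obtain p where p: "p \<in> carrier (polynomial_ring m)" "X = SR_class m K p"
      unfolding SR_carrier[OF K] by blast
    define x where "x b = (if b = 0 then p else 0)" for b :: nat
    have x: "x \<in> free_module m (free_rank ?F 0)" using p by (simp add: free_module_def x_def)
    obtain e where e: "augmentation (stanley_reisner_module m K) ?F x = SR_class m K e"
      "\<And>a. lookup e a = lookup (x 0) a" using el[OF x] by blast
    have "e = p" using e(2) by (intro poly_mapping_eqI) (simp add: x_def)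
    thus "X \<in> augmentation (stanley_reisner_module m K) ?F ` free_module m (free_rank ?F 0)"
      using p(2) e(1) x by blast
  qed
qed

end

theorem stanley_reisner_free_resolution_exists:
  assumes K: "simplicial_complex m K"
  shows "\<exists>F :: ('k::field, 'k mpoly set) resolution.
    free_resolution m (stanley_reisner_module m K) (stanley_reisner_grading m K) F"
proof -
  have "finite {\<tau>. \<tau> \<subseteq> {1..m} \<and> \<tau> \<notin> K}"
    by (rule finite_subset[of _ "Pow {1..m}"]) auto
  from finite_imp_nat_seg_image_inj_on[OF this]
  obtain N :: nat and G where "{\<tau>. \<tau> \<subseteq> {1..m} \<and> \<tau> \<notin> K} = G ` {i. i < N}" by blast
  hence "G ` {..<N} = {\<tau>. \<tau> \<subseteq> {1..m} \<and> \<tau> \<notin> K}" by (simp add: lessThan_def)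
  from bar_resolution_free_resolution[OF K this] show ?thesis by blast
qed


section \<open>Hochster's formula\<close>

locale resolved_full_subcomplex =
  fixes m :: nat and K :: "nat set set" and \<omega> :: "nat set"
    and n :: "nat \<Rightarrow> nat" and g :: "nat \<Rightarrow> nat \<Rightarrow> expo"
    and A :: "nat \<Rightarrow> nat \<Rightarrow> nat \<Rightarrow> 'k::field" and \<mu> :: "nat \<Rightarrow> 'k"
  assumes complex: "simplicial_complex m K" and vertices: "\<omega> \<subseteq> {1..m}"
    and exact: "exact_strands m K n g A \<mu>"
begin

text \<open>
  An element is a family of vectors in the strands of the degrees \<open>\<sigma> \<subseteq> \<omega>\<close>. The second index counts the
  vertices missing from \<open>\<sigma>\<close>, so that both differentials lower an index.
\<close>

definition C :: "nat \<Rightarrow> nat \<Rightarrow> (nat set \<Rightarrow> nat \<Rightarrow> 'k) set" where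
  "C a b = {f. \<forall>\<sigma> c. f \<sigma> c \<noteq> 0 \<longrightarrow> \<sigma> \<subseteq> \<omega> \<and> card \<sigma> + b = card \<omega> \<and>
     c < n a \<and> exp_le (g a c) (indicator_degree \<sigma>)}"

definition d :: "nat \<Rightarrow> nat \<Rightarrow> (nat set \<Rightarrow> nat \<Rightarrow> 'k) \<Rightarrow> nat set \<Rightarrow> nat \<Rightarrow> 'k" where
  "d a b f \<sigma> = scalar_map (n a) (n (Suc a)) (A a) (f \<sigma>)"

definition e :: "nat \<Rightarrow> nat \<Rightarrow> (nat set \<Rightarrow> nat \<Rightarrow> 'k) \<Rightarrow> nat set \<Rightarrow> nat \<Rightarrow> 'k" where
  "e a b f \<sigma> c = coboundary (Pow \<omega>) (\<lambda>\<tau>. f \<tau> c) \<sigma>"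

lemma finite_omega: "finite \<omega>" using vertices finite_subset by blast

lemma finite_in_omega: "\<sigma> \<subseteq> \<omega> \<Longrightarrow> finite \<sigma>" using finite_omega finite_subset by blast

lemma indicator_in_degrees: "\<sigma> \<subseteq> \<omega> \<Longrightarrow> indicator_degree \<sigma> \<in> degrees m"
  using vertices finite_in_omega by (auto simp: degrees_def keys_indicator_degree)

lemma indicator_mono: "\<sigma> \<subseteq> \<tau> \<Longrightarrow> \<tau> \<subseteq> \<omega> \<Longrightarrow> exp_le (indicator_degree \<sigma>) (indicator_degree \<tau>)"
  using finite_in_omega[of \<sigma>] finite_in_omega[of \<tau>] by (auto simp: exp_le_def lookup_indicator_degree)

lemma convex_Pow: "convex_family (Pow \<omega>)"
  using finite_omega finite_in_omega by (auto simp: convex_family_def)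

lemma entry_le: "b < n i \<Longrightarrow> c < n (Suc i) \<Longrightarrow> A i b c \<noteq> 0 \<Longrightarrow> exp_le (g i b) (g (Suc i) c)"
  using exact unfolding exact_strands_def by blast

lemma homogeneous: "homogeneous_matrix (n i) (n (Suc i)) (g i) (g (Suc i)) (A i)
    (\<lambda>b c. single (g (Suc i) c - g i b) (A i b c))"
  using entry_le by (auto simp: homogeneous_matrix_def)

lemma strand_unit: "a \<in> degrees m \<Longrightarrow> keys a \<in> K \<Longrightarrow>
    \<exists>u\<in>strand_space (n 0) (g 0) a. (\<Sum>b<n 0. \<mu> b * u b) = 1"
  using exact unfolding exact_strands_def by blast

lemma strand_aug_kernel: "a \<in> degrees m \<Longrightarrow> aug_kernel K (n 0) (g 0) \<mu> a =
    scalar_map (n 0) (n 1) (A 0) ` strand_space (n 1) (g 1) a"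
  using exact unfolding exact_strands_def by blast

lemma strand_kernel: "a \<in> degrees m \<Longrightarrow>
    {u \<in> strand_space (n (Suc i)) (g (Suc i)) a. scalar_map (n i) (n (Suc i)) (A i) u = 0} =
    scalar_map (n (Suc i)) (n (Suc (Suc i))) (A (Suc i)) ` strand_space (n (Suc (Suc i))) (g (Suc (Suc i))) a"
  using exact unfolding exact_strands_def by blast

lemma C_strand: "f \<in> C a b \<Longrightarrow> f \<sigma> \<in> strand_space (n a) (g a) (indicator_degree \<sigma>)"
  by (auto simp: C_def strand_space_def)

lemma C_outside: "f \<in> C a b \<Longrightarrow> \<not> (\<sigma> \<subseteq> \<omega> \<and> card \<sigma> + b = card \<omega>) \<Longrightarrow> f \<sigma> = (\<lambda>_. 0)"
  unfolding C_def by blast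

lemma C_I:
  assumes "\<And>\<sigma>. \<sigma> \<subseteq> \<omega> \<Longrightarrow> card \<sigma> + b = card \<omega> \<Longrightarrow> f \<sigma> \<in> strand_space (n a) (g a) (indicator_degree \<sigma>)"
    and "\<And>\<sigma>. \<not> (\<sigma> \<subseteq> \<omega> \<and> card \<sigma> + b = card \<omega>) \<Longrightarrow> f \<sigma> = (\<lambda>_. 0)"
  shows "f \<in> C a b"
proof -
  have "\<sigma> \<subseteq> \<omega> \<and> card \<sigma> + b = card \<omega> \<and> c < n a \<and> exp_le (g a c) (indicator_degree \<sigma>)"
    if "f \<sigma> c \<noteq> 0" for \<sigma> c
  proof -
    have *: "\<sigma> \<subseteq> \<omega> \<and> card \<sigma> + b = card \<omega>"
    proof (rule ccontr)
      assume "\<not> (\<sigma> \<subseteq> \<omega> \<and> card \<sigma> + b = card \<omega>)"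
      from assms(2)[OF this] that show False by simp
    qed
    from assms(1)[of \<sigma>] * have "f \<sigma> \<in> strand_space (n a) (g a) (indicator_degree \<sigma>)" by blast
    thus ?thesis using * that unfolding strand_space_def by blast
  qed
  thus ?thesis unfolding C_def by blast
qed

text \<open>
  Preimages in the strands can be chosen for one \<open>\<sigma>\<close> at a time.
\<close>

lemma C_choose:
  assumes x: "x \<in> C a' b" and "F (\<lambda>_. 0) = (\<lambda>_. 0)"
    and ex: "\<And>\<sigma>. \<sigma> \<subseteq> \<omega> \<Longrightarrow> card \<sigma> + b = card \<omega> \<Longrightarrow>
      x \<sigma> \<in> F ` strand_space (n a) (g a) (indicator_degree \<sigma>)"
  shows "\<exists>y\<in>C a b. (\<lambda>\<sigma>. F (y \<sigma>)) = x"
proof -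
  let ?in = "\<lambda>\<sigma>. \<sigma> \<subseteq> \<omega> \<and> card \<sigma> + b = card \<omega>"
  define y where "y \<sigma> = (if ?in \<sigma> then SOME v. v \<in> strand_space (n a) (g a) (indicator_degree \<sigma>) \<and> F v = x \<sigma>
     else (\<lambda>_. 0))" for \<sigma>
  have y: "y \<sigma> \<in> strand_space (n a) (g a) (indicator_degree \<sigma>) \<and> F (y \<sigma>) = x \<sigma>" if inn: "?in \<sigma>" for \<sigma>
  proof -
    obtain v where v: "x \<sigma> = F v" "v \<in> strand_space (n a) (g a) (indicator_degree \<sigma>)"
      using ex[of \<sigma>] inn by blast
    have "\<exists>v. v \<in> strand_space (n a) (g a) (indicator_degree \<sigma>) \<and> F v = x \<sigma>"
      by (rule exI[of _ v], rule conjI[OF v(2) v(1)[symmetric]])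
    from someI_ex[OF this] show ?thesis unfolding y_def if_P[OF inn] .
  qed
  have out: "y \<sigma> = (\<lambda>_. 0)" if "\<not> ?in \<sigma>" for \<sigma>
    unfolding y_def using that by (rule if_not_P)
  have "y \<in> C a b"
  proof (rule C_I)
    show "y \<sigma> \<in> strand_space (n a) (g a) (indicator_degree \<sigma>)" if "\<sigma> \<subseteq> \<omega>" "card \<sigma> + b = card \<omega>" for \<sigma>
      using y[OF conjI[OF that]] by (rule conjunct1)
  qed (rule out)
  moreover have "F (y \<sigma>) = x \<sigma>" for \<sigma>
  proof (cases "?in \<sigma>")
    case False
    show ?thesis unfolding out[OF False] C_outside[OF x False] by (rule assms(2))
  qed (use y in blast)
  ultimately show ?thesis by blast
qed

lemma C_minus:
  assumes "x \<in> C a b" "y \<in> C a b"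
  shows "x - y \<in> C a b"
  unfolding C_def
proof (intro CollectI allI impI)
  fix \<sigma> c assume "(x - y) \<sigma> c \<noteq> 0"
  hence "x \<sigma> c \<noteq> 0 \<or> y \<sigma> c \<noteq> 0" by auto
  thus "\<sigma> \<subseteq> \<omega> \<and> card \<sigma> + b = card \<omega> \<and> c < n a \<and> exp_le (g a c) (indicator_degree \<sigma>)"
    using assms unfolding C_def by blast
qed

lemma C_plus:
  assumes "x \<in> C a b" "y \<in> C a b"
  shows "x + y \<in> C a b"
  unfolding C_def
proof (intro CollectI allI impI)
  fix \<sigma> c assume "(x + y) \<sigma> c \<noteq> 0"
  hence "x \<sigma> c \<noteq> 0 \<or> y \<sigma> c \<noteq> 0" by auto
  thus "\<sigma> \<subseteq> \<omega> \<and> card \<sigma> + b = card \<omega> \<and> c < n a \<and> exp_le (g a c) (indicator_degree \<sigma>)"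
    using assms unfolding C_def by blast
qed

lemma C_scale: "x \<in> C a b \<Longrightarrow> (\<lambda>\<sigma> c. k * x \<sigma> c) \<in> C a b"
  by (auto simp: C_def)

lemma scalar_map_linear:
  "scalar_map l k M (u - v) = scalar_map l k M u - scalar_map l k M v"
  "scalar_map l k M (u + v) = scalar_map l k M u + scalar_map l k M v"
  "scalar_map l k M (\<lambda>c. z * u c) = (\<lambda>b. z * scalar_map l k M u b)"
  "scalar_map l k M (\<lambda>_. 0) = (\<lambda>_. 0)"
  by (auto simp: scalar_map_def fun_eq_iff algebra_simps sum_subtractf sum.distrib sum_distrib_left)

lemma d_linear:
  "d a b (x - y) = d a b x - d a b y" "d a b (x + y) = d a b x + d a b y"
  "d a b (\<lambda>\<sigma> c. z * x \<sigma> c) = (\<lambda>\<sigma> c. z * d a b x \<sigma> c)"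
  by (rule ext, simp add: d_def scalar_map_linear[unfolded])+

lemma e_linear:
  "e a b (x - y) = e a b x - e a b y" "e a b (x + y) = e a b x + e a b y"
  "e a b (\<lambda>\<sigma> c. z * x \<sigma> c) = (\<lambda>\<sigma> c. z * e a b x \<sigma> c)"
  using coboundary_diff[of "Pow \<omega>"] coboundary_add[of "Pow \<omega>"] coboundary_scale[of "Pow \<omega>"]
  by (auto simp: e_def fun_eq_iff coboundary_eq sum_subtractf sum.distrib sum_distrib_left algebra_simps)

lemma d_in_C: "x \<in> C (Suc a) b \<Longrightarrow> d a b x \<in> C a b"
proof (rule C_I)
  fix \<sigma> assume "x \<in> C (Suc a) b"
  thus "d a b x \<sigma> \<in> strand_space (n a) (g a) (indicator_degree \<sigma>)"
    unfolding d_def by (intro scalar_map_in_strand_space[OF homogeneous] C_strand)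
next
  fix \<sigma> assume x: "x \<in> C (Suc a) b" and "\<not> (\<sigma> \<subseteq> \<omega> \<and> card \<sigma> + b = card \<omega>)"
  from C_outside[OF this] show "d a b x \<sigma> = (\<lambda>_. 0)" by (simp add: d_def scalar_map_linear(4))
qed

lemma e_in_C:
  assumes x: "x \<in> C a (Suc b)"
  shows "e a b x \<in> C a b"
proof -
  have "\<sigma> \<subseteq> \<omega> \<and> card \<sigma> + b = card \<omega> \<and> c < n a \<and> exp_le (g a c) (indicator_degree \<sigma>)"
    if nz: "e a b x \<sigma> c \<noteq> 0" for \<sigma> c
  proof -
    have s: "\<sigma> \<subseteq> \<omega>" using nz by (auto simp: e_def coboundary_eq split: if_splits)
    hence "(\<Sum>v\<in>\<sigma>. incidence_sign \<sigma> v * x (\<sigma> - {v}) c) \<noteq> 0" using nz by (simp add: e_def coboundary_eq)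
    from sum.not_neutral_contains_not_neutral[OF this] obtain v where v: "v \<in> \<sigma>" "x (\<sigma> - {v}) c \<noteq> 0" by auto
    hence "card (\<sigma> - {v}) + Suc b = card \<omega>" "c < n a" "exp_le (g a c) (indicator_degree (\<sigma> - {v}))"
      using x unfolding C_def by blast+
    moreover have "Suc (card (\<sigma> - {v})) = card \<sigma>" using v(1) finite_in_omega[OF s] by (intro card_Suc_Diff1)
    moreover have "exp_le (indicator_degree (\<sigma> - {v})) (indicator_degree \<sigma>)" by (rule indicator_mono) (use s in auto)
    ultimately show ?thesis using s exp_le_trans by auto
  qed
  thus ?thesis by (simp add: C_def)
qed

lemma d_e_commute: "d a b (e (Suc a) b x) = e a b (d a b' x)"
proof (rule ext, rule ext)
  fix \<sigma> c
  show "d a b (e (Suc a) b x) \<sigma> c = e a b (d a b' x) \<sigma> c"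
  proof (cases "\<sigma> \<subseteq> \<omega> \<and> c < n a")
    case True
    have "(\<Sum>j<n (Suc a). A a c j * (\<Sum>v\<in>\<sigma>. incidence_sign \<sigma> v * x (\<sigma> - {v}) j)) =
        (\<Sum>v\<in>\<sigma>. incidence_sign \<sigma> v * (\<Sum>j<n (Suc a). A a c j * x (\<sigma> - {v}) j))"
      unfolding sum_distrib_left by (subst sum.swap) (simp add: algebra_simps)
    thus ?thesis using True by (simp add: d_def e_def scalar_map_def coboundary_eq)
  qed (auto simp: d_def e_def scalar_map_def coboundary_eq)
qed

lemma d_d_zero:
  assumes x: "x \<in> C (Suc (Suc a)) b"
  shows "d a b' (d (Suc a) b x) = 0"
proof
  fix \<sigma>
  show "d a b' (d (Suc a) b x) \<sigma> = 0 \<sigma>"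
  proof (cases "\<sigma> \<subseteq> \<omega>")
    case True
    have "d (Suc a) b x \<sigma> \<in> {u \<in> strand_space (n (Suc a)) (g (Suc a)) (indicator_degree \<sigma>).
        scalar_map (n a) (n (Suc a)) (A a) u = 0}"
      unfolding strand_kernel[OF indicator_in_degrees[OF True]] d_def using C_strand[OF x] by (rule imageI)
    thus ?thesis by (simp add: d_def)
  next
    case False
    hence "x \<sigma> = (\<lambda>_. 0)" using C_outside[OF x] by blast
    thus ?thesis by (simp add: d_def scalar_map_linear(4) zero_fun_def)
  qed
qed

lemma e_e_zero:
  assumes x: "x \<in> C a b"
  shows "e a b'' (e a b' x) = 0"
proof (rule ext, rule ext)
  fix \<sigma> c
  have "coboundary (Pow \<omega>) (coboundary (Pow \<omega>) (\<lambda>\<tau>. x \<tau> c)) = (\<lambda>_. 0)"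
    by (rule coboundary_coboundary[OF convex_Pow]) (use x in \<open>auto simp: C_def\<close>)
  thus "e a b'' (e a b' x) \<sigma> c = 0 \<sigma> c" by (simp add: e_def fun_eq_iff)
qed

lemma d_exactness:
  assumes x: "x \<in> C (Suc a) b" and z: "d a b x = 0"
  shows "x \<in> d (Suc a) b ` C (Suc (Suc a)) b"
proof -
  have "x \<sigma> \<in> scalar_map (n (Suc a)) (n (Suc (Suc a))) (A (Suc a)) `
      strand_space (n (Suc (Suc a))) (g (Suc (Suc a))) (indicator_degree \<sigma>)" if s: "\<sigma> \<subseteq> \<omega>" for \<sigma>
  proof -
    have "scalar_map (n a) (n (Suc a)) (A a) (x \<sigma>) = 0" using fun_cong[OF z, of \<sigma>] by (simp add: d_def)
    thus ?thesis unfolding strand_kernel[OF indicator_in_degrees[OF s], symmetric] using C_strand[OF x] by blast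
  qed
  from C_choose[OF x scalar_map_linear(4) this] show ?thesis unfolding d_def by fastforce
qed

text \<open>
  The degree of a generator that contributes is at most \<open>\<omega>\<close>. Unless it equals \<open>\<omega>\<close>, it misses some
  vertex of \<open>\<omega>\<close>, which can serve as the apex of a cone.
\<close>

lemma apex_exists:
  assumes x: "x \<in> C a b" and nz: "x \<tau> c \<noteq> 0" and top: "g a c = indicator_degree \<omega> \<Longrightarrow> x \<omega> c = 0"
  shows "\<exists>z\<in>\<omega>. lookup (g a c) z = 0"
proof (rule ccontr)
  assume "\<not> ?thesis"
  hence pos: "0 < lookup (g a c) z" if "z \<in> \<omega>" for z using that by auto
  have t: "\<tau> \<subseteq> \<omega>" "exp_le (g a c) (indicator_degree \<tau>)" using x nz unfolding C_def by blast+
  have le: "lookup (g a c) z \<le> (if z \<in> \<tau> then 1 else 0)" for z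
    using t(2)[unfolded exp_le_def, rule_format, of z]
      lookup_indicator_degree[OF finite_in_omega[OF t(1)], of z] by (simp only:)
  have "\<omega> \<subseteq> \<tau>"
  proof
    fix z assume "z \<in> \<omega>"
    thus "z \<in> \<tau>" using pos[of z] le[of z] by (auto split: if_splits)
  qed
  hence t': "\<tau> = \<omega>" using t(1) by blast
  have "g a c = indicator_degree \<omega>"
  proof (rule poly_mapping_eqI)
    fix z
    show "lookup (g a c) z = lookup (indicator_degree \<omega>) z"
      using pos[of z] le[of z] t' lookup_indicator_degree[OF finite_omega, of z] by (auto split: if_splits)
  qed
  thus False using top nz t' by blast
qed

text \<open>
  For a fixed generator, the sets \<open>\<sigma>\<close> whose strand contains it form a cone over the vertex found above. The
  one exception is a generator of degree \<open>\<omega>\<close>, which lives at \<open>\<sigma> = \<omega>\<close> only; the hypothesis \<open>top\<close> takes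
  care of it.
\<close>

lemma e_exactness:
  assumes x: "x \<in> C a b" and z: "\<And>\<sigma> c. coboundary (Pow \<omega>) (\<lambda>\<tau>. x \<tau> c) \<sigma> = 0"
    and top: "\<And>c. g a c = indicator_degree \<omega> \<Longrightarrow> x \<omega> c = 0"
  shows "x \<in> e a b ` C a (Suc b)"
proof -
  have "\<forall>c. \<exists>z. (\<exists>\<tau>. x \<tau> c \<noteq> 0) \<longrightarrow> z \<in> \<omega> \<and> lookup (g a c) z = 0"
    using apex_exists[OF x _ top] by blast
  then obtain z where z': "\<And>c \<tau>. x \<tau> c \<noteq> 0 \<Longrightarrow> z c \<in> \<omega> \<and> lookup (g a c) (z c) = 0"
    by metis
  define y where "y \<sigma> c = (if z c \<notin> \<sigma> then incidence_sign \<sigma> (z c) * x (insert (z c) \<sigma>) c else 0)" for \<sigma> c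
  have "\<sigma> \<subseteq> \<omega> \<and> card \<sigma> + Suc b = card \<omega> \<and> c < n a \<and> exp_le (g a c) (indicator_degree \<sigma>)"
    if "y \<sigma> c \<noteq> 0" for \<sigma> c
  proof -
    have zs: "z c \<notin> \<sigma>" and nz: "x (insert (z c) \<sigma>) c \<noteq> 0" using that by (auto simp: y_def split: if_splits)
    have s: "insert (z c) \<sigma> \<subseteq> \<omega>" "card (insert (z c) \<sigma>) + b = card \<omega>" "c < n a"
      "exp_le (g a c) (indicator_degree (insert (z c) \<sigma>))"
      using x nz unfolding C_def by blast+
    have "finite \<sigma>" using s(1) finite_in_omega by blast
    moreover have "exp_le (g a c) (indicator_degree \<sigma>)"
      unfolding exp_le_def
    proof
      fix v
      show "lookup (g a c) v \<le> lookup (indicator_degree \<sigma>) v"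
        using s(4)[unfolded exp_le_def, rule_format, of v] z'[OF nz] \<open>finite \<sigma>\<close>
        by (cases "v = z c") (auto simp: lookup_indicator_degree split: if_splits)
    qed
    ultimately show ?thesis using s zs by auto
  qed
  hence "y \<in> C a (Suc b)" by (simp add: C_def)
  moreover have "e a b y \<sigma> c = x \<sigma> c" for \<sigma> c
  proof (cases "\<exists>\<tau>. x \<tau> c \<noteq> 0")
    case True
    hence zc: "z c \<in> \<omega>" using z' by blast
    have "coboundary (Pow \<omega>) (\<lambda>\<sigma>. if z c \<notin> \<sigma> then incidence_sign \<sigma> (z c) * x (insert (z c) \<sigma>) c else 0) =
        (\<lambda>\<tau>. x \<tau> c)"
      by (rule coboundary_cone_exact[of "Pow \<omega>" "z c" "\<lambda>\<tau>. x \<tau> c"])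
        (use zc finite_in_omega x z in \<open>auto simp: C_def\<close>)
    thus ?thesis unfolding e_def y_def by (rule fun_cong)
  next
    case False
    hence "(\<lambda>\<tau>. y \<tau> c) = (\<lambda>_. 0)" by (auto simp: y_def)
    thus ?thesis using False by (simp add: e_def coboundary_zero)
  qed
  ultimately show ?thesis by (metis ext image_eqI)
qed

sublocale exact_double_complex C d e
proof
  fix a b and x :: "nat set \<Rightarrow> nat \<Rightarrow> 'k"
  assume x: "x \<in> C a (Suc b)" and z: "e a b x = 0"
  show "x \<in> e a (Suc b) ` C a (Suc (Suc b))"
  proof (rule e_exactness[OF x])
    show "coboundary (Pow \<omega>) (\<lambda>\<tau>. x \<tau> c) \<sigma> = 0" for \<sigma> c
      using fun_cong[OF fun_cong[OF z], of \<sigma> c] by (simp add: e_def)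
    show "x \<omega> c = 0" for c using C_outside[OF x, of \<omega>] by simp
  qed
qed (rule C_minus d_in_C e_in_C d_linear(1) e_linear(1) d_e_commute d_d_zero e_e_zero d_exactness;
    assumption)+


text \<open>
  The edge obtained by dividing out the image of \<open>d\<close>: the augmentation maps onto the cochains of the full subcomplex.
\<close>

definition augment :: "(nat set \<Rightarrow> nat \<Rightarrow> 'k) \<Rightarrow> nat set \<Rightarrow> 'k" where
  "augment f \<sigma> = (if \<sigma> \<in> K then \<Sum>c<n 0. \<mu> c * f \<sigma> c else 0)"

abbreviation "Q \<equiv> full_subcomplex K \<omega>"

text \<open>
  A family with \<open>i\<close> missing vertices lives on sets with \<open>\<bar>\<omega>\<bar> - i\<close> elements, that is, on simplices of this dimension.
\<close>

definition codegree :: "nat \<Rightarrow> int" where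
  "codegree i = int (card \<omega>) - int i - 1"

lemma down_closed: "\<sigma> \<in> K \<Longrightarrow> \<tau> \<subseteq> \<sigma> \<Longrightarrow> \<tau> \<in> K"
  using complex by (auto simp: simplicial_complex_def)

lemma convex_Q: "convex_family Q"
proof (rule convex_family_subset[OF convex_Pow])
  fix \<sigma> \<rho> \<tau> assume "\<rho> \<in> Q" "\<tau> \<subseteq> \<rho>"
  thus "\<tau> \<in> Q" using down_closed by (auto simp: full_subcomplex_def)
qed (auto simp: full_subcomplex_def)

lemma augment_linear: "augment (x + y) = augment x + augment y" "augment (x - y) = augment x - augment y"
  "augment (\<lambda>\<sigma> c. z * x \<sigma> c) = (\<lambda>\<sigma>. z * augment x \<sigma>)"
  by (auto simp: augment_def fun_eq_iff sum.distrib sum_subtractf sum_distrib_left algebra_simps)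

lemma augment_in_cochains:
  assumes x: "x \<in> C 0 i"
  shows "augment x \<in> cochains Q (codegree i)"
  unfolding cochains_def
proof (intro CollectI allI impI)
  fix \<sigma> assume nz: "augment x \<sigma> \<noteq> 0"
  hence s: "\<sigma> \<in> K" "(\<Sum>c<n 0. \<mu> c * x \<sigma> c) \<noteq> 0" by (auto simp: augment_def split: if_splits)
  from sum.not_neutral_contains_not_neutral[OF s(2)] obtain c where "x \<sigma> c \<noteq> 0" by auto
  hence "\<sigma> \<subseteq> \<omega>" "card \<sigma> + i = card \<omega>" using x unfolding C_def by blast+
  thus "\<sigma> \<in> Q \<and> int (card \<sigma>) = codegree i + 1"
    using s(1) by (auto simp: full_subcomplex_def codegree_def)
qed

lemma augment_surj:
  assumes p: "\<phi> \<in> cochains Q (codegree i)"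
  shows "\<exists>x\<in>C 0 i. augment x = \<phi>"
proof -
  have "\<forall>\<sigma>. \<exists>u. \<sigma> \<in> Q \<longrightarrow> u \<in> strand_space (n 0) (g 0) (indicator_degree \<sigma>) \<and> (\<Sum>b<n 0. \<mu> b * u b) = 1"
  proof
    fix \<sigma>
    show "\<exists>u. \<sigma> \<in> Q \<longrightarrow> u \<in> strand_space (n 0) (g 0) (indicator_degree \<sigma>) \<and> (\<Sum>b<n 0. \<mu> b * u b) = 1"
    proof (cases "\<sigma> \<in> Q")
      case True
      hence s: "\<sigma> \<in> K" "\<sigma> \<subseteq> \<omega>" by (auto simp: full_subcomplex_def)
      show ?thesis using strand_unit[OF indicator_in_degrees[OF s(2)]] s(1)
          keys_indicator_degree[OF finite_in_omega[OF s(2)]] by auto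
    qed blast
  qed
  then obtain u where u: "\<And>\<sigma>. \<sigma> \<in> Q \<Longrightarrow>
      u \<sigma> \<in> strand_space (n 0) (g 0) (indicator_degree \<sigma>) \<and> (\<Sum>b<n 0. \<mu> b * u \<sigma> b) = 1" by metis
  define x where "x \<sigma> c = \<phi> \<sigma> * u \<sigma> c" for \<sigma> c
  have "x \<in> C 0 i"
    unfolding C_def
  proof (intro CollectI allI impI)
    fix \<sigma> c assume "x \<sigma> c \<noteq> 0"
    hence nz: "\<phi> \<sigma> \<noteq> 0" "u \<sigma> c \<noteq> 0" by (auto simp: x_def)
    hence s: "\<sigma> \<in> Q" "int (card \<sigma>) = codegree i + 1" using p unfolding cochains_def by blast+
    thus "\<sigma> \<subseteq> \<omega> \<and> card \<sigma> + i = card \<omega> \<and> c < n 0 \<and> exp_le (g 0 c) (indicator_degree \<sigma>)"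
      using u[OF s(1)] nz(2) by (auto simp: full_subcomplex_def codegree_def strand_space_def)
  qed
  moreover have "augment x \<sigma> = \<phi> \<sigma>" for \<sigma>
  proof (cases "\<sigma> \<in> Q")
    case True
    hence "augment x \<sigma> = \<phi> \<sigma> * (\<Sum>c<n 0. \<mu> c * u \<sigma> c)"
      by (simp add: augment_def x_def full_subcomplex_def sum_distrib_left algebra_simps)
    thus ?thesis using u[OF True] by simp
  next
    case False
    hence "\<phi> \<sigma> = 0" using p unfolding cochains_def by blast
    thus ?thesis by (simp add: augment_def x_def)
  qed
  ultimately show ?thesis by blast
qed

lemma augment_d:
  assumes x: "x \<in> C (Suc 0) i"
  shows "augment (d 0 b x) = 0"
proof
  fix \<sigma>
  show "augment (d 0 b x) \<sigma> = 0 \<sigma>"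
  proof (cases "\<sigma> \<in> K \<and> \<sigma> \<subseteq> \<omega>")
    case True
    have "d 0 b x \<sigma> \<in> aug_kernel K (n 0) (g 0) \<mu> (indicator_degree \<sigma>)"
      using C_strand[OF x, of \<sigma>] True strand_aug_kernel[OF indicator_in_degrees, of \<sigma>] by (simp add: d_def)
    thus ?thesis using True keys_indicator_degree[OF finite_in_omega, of \<sigma>] by (simp add: aug_kernel_def augment_def)
  next
    case False
    hence "\<sigma> \<in> K \<longrightarrow> x \<sigma> = (\<lambda>_. 0)" using C_outside[OF x] by blast
    thus ?thesis by (auto simp: augment_def d_def scalar_map_linear(4))
  qed
qed

lemma augment_exact:
  assumes x: "x \<in> C 0 i" and z: "augment x = 0"
  shows "x \<in> d 0 i ` C (Suc 0) i"
proof -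
  have "x \<sigma> \<in> scalar_map (n 0) (n (Suc 0)) (A 0) ` strand_space (n (Suc 0)) (g (Suc 0)) (indicator_degree \<sigma>)"
    if s: "\<sigma> \<subseteq> \<omega>" for \<sigma>
  proof -
    have "\<sigma> \<in> K \<longrightarrow> (\<Sum>c<n 0. \<mu> c * x \<sigma> c) = 0" using fun_cong[OF z, of \<sigma>]
      by (auto simp: augment_def split: if_splits)
    hence "x \<sigma> \<in> aug_kernel K (n 0) (g 0) \<mu> (indicator_degree \<sigma>)"
      using C_strand[OF x, of \<sigma>] keys_indicator_degree[OF finite_in_omega[OF s]] by (simp add: aug_kernel_def)
    thus ?thesis using strand_aug_kernel[OF indicator_in_degrees[OF s]] by simp
  qed
  from C_choose[OF x scalar_map_linear(4) this] show ?thesis unfolding d_def by fastforce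
qed

lemma augment_e: "coboundary Q (augment x) = augment (e 0 b x)"
proof
  fix \<sigma>
  show "coboundary Q (augment x) \<sigma> = augment (e 0 b x) \<sigma>"
  proof (cases "\<sigma> \<in> Q")
    case True
    hence s: "\<sigma> \<in> K" "\<sigma> \<subseteq> \<omega>" by (auto simp: full_subcomplex_def)
    have "\<sigma> - {v} \<in> K" for v using down_closed[OF s(1)] by blast
    hence "coboundary Q (augment x) \<sigma> = (\<Sum>v\<in>\<sigma>. \<Sum>c<n 0. incidence_sign \<sigma> v * (\<mu> c * x (\<sigma> - {v}) c))"
      using True by (simp add: coboundary_eq augment_def sum_distrib_left)
    also have "\<dots> = (\<Sum>c<n 0. \<mu> c * (\<Sum>v\<in>\<sigma>. incidence_sign \<sigma> v * x (\<sigma> - {v}) c))"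
      unfolding sum_distrib_left by (subst sum.swap) (simp add: algebra_simps)
    finally show ?thesis using s by (simp add: augment_def e_def coboundary_eq)
  next
    case False
    thus ?thesis by (auto simp: augment_def e_def coboundary_eq full_subcomplex_def)
  qed
qed

text \<open>
  The edge obtained by dividing out the image of \<open>e\<close>: the components of degree \<open>\<omega>\<close> of the resolution modulo the
  variables, where only the generators of degree \<open>\<omega>\<close> and the constant entries of the matrices survive.
\<close>

definition residue_space :: "nat \<Rightarrow> (nat \<Rightarrow> 'k) set" where
  "residue_space i = {y. \<forall>c. y c \<noteq> 0 \<longrightarrow> c < n i \<and> g i c = indicator_degree \<omega>}"

definition residue_map :: "nat \<Rightarrow> (nat \<Rightarrow> 'k) \<Rightarrow> nat \<Rightarrow> 'k" where
  "residue_map i = scalar_map (n i) (n (Suc i)) (\<lambda>b c. if g i b = g (Suc i) c then A i b c else 0)"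

definition top_part :: "nat \<Rightarrow> (nat set \<Rightarrow> nat \<Rightarrow> 'k) \<Rightarrow> nat \<Rightarrow> 'k" where
  "top_part i x c = (if g i c = indicator_degree \<omega> then x \<omega> c else 0)"

lemma residue_space_subspace: "fn.subspace (residue_space i)"
proof (rule fn.subspaceI)
  fix x y assume "x \<in> residue_space i" "y \<in> residue_space i"
  moreover have "x c \<noteq> 0 \<or> y c \<noteq> 0" if "(x + y) c \<noteq> 0" for c using that by auto
  ultimately show "x + y \<in> residue_space i" unfolding residue_space_def by blast
qed (auto simp: residue_space_def)

lemma residue_map_linear:
  "residue_map i (x + y) = residue_map i x + residue_map i y"
  "residue_map i (\<lambda>c. z * y c) = (\<lambda>b. z * residue_map i y b)"
  "residue_map i 0 = 0"
  by (simp_all add: residue_map_def scalar_map_linear zero_fun_def)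

lemma top_part_linear: "top_part i (x + y) = top_part i x + top_part i y"
  "top_part i (x - y) = top_part i x - top_part i y"
  "top_part i (\<lambda>\<sigma> c. z * x \<sigma> c) = (\<lambda>c. z * top_part i x c)"
  by (auto simp: top_part_def fun_eq_iff)

lemma top_part_in_residue_space: "x \<in> C i 0 \<Longrightarrow> top_part i x \<in> residue_space i"
  by (auto simp: C_def residue_space_def top_part_def)

lemma top_part_surj:
  assumes y: "y \<in> residue_space i"
  shows "\<exists>x\<in>C i 0. top_part i x = y"
proof
  let ?x = "\<lambda>\<sigma> c. if \<sigma> = \<omega> then y c else 0"
  show "top_part i ?x = y" using y by (auto simp: top_part_def residue_space_def fun_eq_iff)
  show "?x \<in> C i 0" using y by (auto simp: C_def residue_space_def split: if_splits)
qed

text \<open>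
  A nonzero entry from a generator of degree at most \<open>\<omega>\<close> to one of degree \<open>\<omega>\<close> is constant.
\<close>

lemma top_part_d:
  assumes x: "x \<in> C (Suc i) 0"
  shows "top_part i (d i 0 x) = residue_map i (top_part (Suc i) x)"
proof
  fix b
  show "top_part i (d i 0 x) b = residue_map i (top_part (Suc i) x) b"
  proof (cases "b < n i \<and> g i b = indicator_degree \<omega>")
    case True
    have "A i b c * x \<omega> c = (if g i b = g (Suc i) c then A i b c else 0) * top_part (Suc i) x c"
      if c: "c < n (Suc i)" for c
    proof (cases "A i b c * x \<omega> c = 0")
      case False
      hence "exp_le (indicator_degree \<omega>) (g (Suc i) c)" "exp_le (g (Suc i) c) (indicator_degree \<omega>)"
        using entry_le[of b i c] True c x by (auto simp: C_def)
      hence "g (Suc i) c = indicator_degree \<omega>" by (intro exp_le_antisym)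
      thus ?thesis using True by (simp add: top_part_def)
    qed (auto simp: top_part_def)
    thus ?thesis using True by (simp add: top_part_def d_def residue_map_def scalar_map_def)
  next
    case False
    have "(if g i b = g (Suc i) c then A i b c else 0) * top_part (Suc i) x c = 0" if "b < n i" for c
      using False that by (auto simp: top_part_def)
    hence "residue_map i (top_part (Suc i) x) b = 0"
      unfolding residue_map_def scalar_map_def by (auto intro: sum.neutral)
    thus ?thesis using False by (auto simp: top_part_def d_def scalar_map_def)
  qed
qed

lemma top_part_e:
  assumes x: "x \<in> C i (Suc 0)"
  shows "top_part i (e i 0 x) = 0"
proof
  fix c
  have "x (\<omega> - {v}) c = 0" if v: "v \<in> \<omega>" and c: "g i c = indicator_degree \<omega>" for v
  proof (rule ccontr)
    assume "x (\<omega> - {v}) c \<noteq> 0"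
    hence "exp_le (indicator_degree \<omega>) (indicator_degree (\<omega> - {v}))" using x c unfolding C_def by force
    thus False
      unfolding exp_le_def using v finite_omega lookup_indicator_degree[of "\<omega> - {v}" v] lookup_indicator_degree[of \<omega> v]
      by (auto dest: spec[of _ v])
  qed
  thus "top_part i (e i 0 x) c = 0 c" by (simp add: top_part_def e_def coboundary_eq)
qed

lemma top_part_exact:
  assumes x: "x \<in> C i 0" and z: "top_part i x = 0"
  shows "x \<in> e i 0 ` C i (Suc 0)"
proof (rule e_exactness[OF x])
  show "x \<omega> c = 0" if "g i c = indicator_degree \<omega>" for c
    using fun_cong[OF z, of c] that by (simp add: top_part_def)
  show "coboundary (Pow \<omega>) (\<lambda>\<tau>. x \<tau> c) \<sigma> = 0" for \<sigma> c
  proof (cases "\<sigma> \<subseteq> \<omega>")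
    case True
    have "x (\<sigma> - {v}) = (\<lambda>_. 0)" if "v \<in> \<sigma>" for v
    proof (rule C_outside[OF x])
      have "card (\<sigma> - {v}) < card \<omega>"
        using True that finite_omega by (intro psubset_card_mono) auto
      thus "\<not> (\<sigma> - {v} \<subseteq> \<omega> \<and> card (\<sigma> - {v}) + 0 = card \<omega>)" by simp
    qed
    thus ?thesis by (simp add: coboundary_eq)
  qed (simp add: coboundary_eq)
qed


definition residue_cycles :: "nat \<Rightarrow> (nat \<Rightarrow> 'k) set" where
  "residue_cycles i = {y \<in> residue_space i. i > 0 \<longrightarrow> residue_map (i - 1) y = 0}"

definition residue_boundaries :: "nat \<Rightarrow> (nat \<Rightarrow> 'k) set" where
  "residue_boundaries i = residue_map i ` residue_space (Suc i)"

lemma residue_map_in_residue_space: "y \<in> residue_space (Suc i) \<Longrightarrow> residue_map i y \<in> residue_space i"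
  using top_part_surj[of y "Suc i"] top_part_d top_part_in_residue_space d_in_C by metis

lemma residue_map_square_zero:
  assumes "y \<in> residue_space (Suc (Suc i))"
  shows "residue_map i (residue_map (Suc i) y) = 0"
proof -
  obtain x where x: "x \<in> C (Suc (Suc i)) 0" "top_part (Suc (Suc i)) x = y"
    using top_part_surj[OF assms] by blast
  have "residue_map i (residue_map (Suc i) y) = top_part i (d i 0 (d (Suc i) 0 x))"
    using top_part_d[OF x(1)] top_part_d[OF d_in_C[OF x(1)]] x(2) by simp
  also have "\<dots> = 0" unfolding d_d_zero[OF x(1)] by (simp add: top_part_def fun_eq_iff)
  finally show ?thesis .
qed

lemma finite_quotient_residue: "finite_quotient (residue_cycles i) (residue_boundaries i)"
  unfolding finite_quotient_def
proof (intro conjI)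
  show "fn.subspace (residue_cycles i)"
  proof (rule fn.subspaceI)
    show "0 \<in> residue_cycles i"
      using fn.subspace_0[OF residue_space_subspace] by (simp add: residue_cycles_def residue_map_linear(3))
  next
    fix x y assume "x \<in> residue_cycles i" "y \<in> residue_cycles i"
    thus "x + y \<in> residue_cycles i"
      using fn.subspace_add[OF residue_space_subspace[of i], of x y]
      by (simp add: residue_cycles_def residue_map_linear(1))
  next
    fix k x assume "x \<in> residue_cycles i"
    thus "(\<lambda>c. k * x c) \<in> residue_cycles i"
      using fn.subspace_scale[OF residue_space_subspace[of i], of x k]
      by (simp add: residue_cycles_def residue_map_linear(2) zero_fun_def)
  qed
  show "fn.subspace (residue_boundaries i)"
  proof (rule fn.subspaceI)
    show "0 \<in> residue_boundaries i"
      unfolding residue_boundaries_def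
      by (rule image_eqI, rule residue_map_linear(3)[symmetric], rule fn.subspace_0[OF residue_space_subspace])
  next
    fix x y assume "x \<in> residue_boundaries i" "y \<in> residue_boundaries i"
    then obtain u v where uv: "u \<in> residue_space (Suc i)" "v \<in> residue_space (Suc i)" "x = residue_map i u" "y = residue_map i v"
      unfolding residue_boundaries_def by blast
    show "x + y \<in> residue_boundaries i"
      unfolding residue_boundaries_def uv(3,4) residue_map_linear(1)[symmetric]
      using fn.subspace_add[OF residue_space_subspace uv(1,2)] by (rule imageI)
  next
    fix k x assume "x \<in> residue_boundaries i"
    then obtain u where u: "u \<in> residue_space (Suc i)" "x = residue_map i u"
      unfolding residue_boundaries_def by blast
    show "(\<lambda>c. k * x c) \<in> residue_boundaries i"
      unfolding residue_boundaries_def u(2) residue_map_linear(2)[symmetric]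
      using fn.subspace_scale[OF residue_space_subspace u(1)] by (rule imageI)
  qed
  show "residue_boundaries i \<subseteq> residue_cycles i"
  proof
    fix y assume "y \<in> residue_boundaries i"
    then obtain u where u: "u \<in> residue_space (Suc i)" "y = residue_map i u"
      unfolding residue_boundaries_def by blast
    have "residue_map (i - 1) y = 0" if "i > 0"
      using residue_map_square_zero[of u "i - 1"] u that by simp
    thus "y \<in> residue_cycles i"
      using residue_map_in_residue_space[OF u(1)] u(2) by (simp add: residue_cycles_def)
  qed
  show "\<exists>B. finite B \<and> (\<forall>f\<in>residue_cycles i. \<forall>x. f x \<noteq> 0 \<longrightarrow> x \<in> B)"
    by (intro exI[of _ "{..<n i}"]) (auto simp: residue_cycles_def residue_space_def)
qed

text \<open>
  The relation between cocycles of the full subcomplex and cycles of the residue complex that induces the isomorphism.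
\<close>

definition linked :: "nat \<Rightarrow> (nat set \<Rightarrow> 'k) \<Rightarrow> (nat \<Rightarrow> 'k) \<Rightarrow> bool" where
  "linked i \<phi> y \<longleftrightarrow> (\<exists>f. zigzag i f \<and> \<phi> = augment (f 0) \<and> y = top_part i (f i))"

lemma linked_add:
  assumes "linked i \<phi> y" "linked i \<psi> z"
  shows "linked i (\<phi> + \<psi>) (y + z)"
proof -
  obtain f h where fh: "zigzag i f" "zigzag i h" "\<phi> = augment (f 0)" "y = top_part i (f i)"
    "\<psi> = augment (h 0)" "z = top_part i (h i)" using assms unfolding linked_def by blast
  have "zigzag i (\<lambda>a. f a + h a)"
    using fh(1,2) unfolding zigzag_def by (simp add: C_plus d_linear(2) e_linear(2))
  thus ?thesis unfolding linked_def fh(3-) augment_linear(1)[symmetric] top_part_linear(1)[symmetric] by blast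
qed

lemma linked_scale:
  assumes "linked i \<phi> y"
  shows "linked i (\<lambda>\<sigma>. k * \<phi> \<sigma>) (\<lambda>c. k * y c)"
proof -
  obtain f where f: "zigzag i f" "\<phi> = augment (f 0)" "y = top_part i (f i)"
    using assms unfolding linked_def by blast
  have "zigzag i (\<lambda>a \<sigma> c. k * f a \<sigma> c)"
    using f(1) unfolding zigzag_def by (simp add: C_scale d_linear(3) e_linear(3))
  thus ?thesis unfolding linked_def f(2,3) augment_linear(3)[symmetric] top_part_linear(3)[symmetric] by blast
qed

lemma zigzagD:
  assumes "zigzag i f"
  shows "f 0 \<in> C 0 i" "f i \<in> C i 0"
    and "\<And>b. i = Suc b \<Longrightarrow> d 0 b (f (Suc 0)) = e 0 b (f 0)" "\<And>b. i = Suc b \<Longrightarrow> f (Suc 0) \<in> C (Suc 0) b"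
    and "\<And>b. i = Suc b \<Longrightarrow> d b 0 (f i) = e b 0 (f b)" "\<And>b. i = Suc b \<Longrightarrow> f b \<in> C b (Suc 0)"
  using assms unfolding zigzag_def
  by (auto dest: spec[of _ 0] spec[of _ i] spec[of _ "Suc 0"] spec[of _ "i - 1"])

text \<open>
  A face on all of \<open>\<omega>\<close> has no coface in the full subcomplex.
\<close>

lemma top_boundary_zero:
  assumes "x \<in> C 0 0"
  shows "coboundary Q (augment x) = 0"
proof -
  have "e 0 0 x = 0"
  proof (rule ext, rule ext)
    fix \<sigma> c
    have "x (\<sigma> - {v}) c = 0" if "v \<in> \<sigma>" "\<sigma> \<subseteq> \<omega>" for v
    proof -
      have "card (\<sigma> - {v}) < card \<omega>"
        using that finite_omega by (intro psubset_card_mono) auto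
      thus ?thesis using C_outside[OF assms, of "\<sigma> - {v}"] by simp
    qed
    thus "e 0 0 x \<sigma> c = 0 \<sigma> c" by (auto simp: e_def coboundary_eq intro!: sum.neutral)
  qed
  thus ?thesis using augment_e[of x 0] by (simp add: augment_def fun_eq_iff)
qed

lemma linked_cocycle:
  assumes f: "zigzag i f"
  shows "augment (f 0) \<in> cocycles Q (codegree i)"
proof -
  have "coboundary Q (augment (f 0)) = 0"
  proof (cases i)
    case 0
    thus ?thesis using zigzagD(1)[OF f] top_boundary_zero by simp
  next
    case (Suc b)
    thus ?thesis using zigzagD(3)[OF f Suc] augment_d[OF zigzagD(4)[OF f Suc], of b] augment_e[of "f 0" b] by simp
  qed
  thus ?thesis using augment_in_cochains[OF zigzagD(1)[OF f]] by simp
qed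

lemma linked_residue_cycle:
  assumes f: "zigzag i f"
  shows "top_part i (f i) \<in> residue_cycles i"
proof -
  have "residue_map b (top_part i (f i)) = 0" if "i = Suc b" for b
    using top_part_d[of "f i" b] zigzagD(2,5,6)[OF f] top_part_e[of "f b" b] that by simp
  hence "i > 0 \<longrightarrow> residue_map (i - 1) (top_part i (f i)) = 0" by (cases i) simp_all
  thus ?thesis using top_part_in_residue_space[OF zigzagD(2)[OF f]] by (simp add: residue_cycles_def)
qed

lemma linked_left_total:
  assumes "\<phi> \<in> cocycles Q (codegree i)"
  shows "\<exists>y\<in>residue_cycles i. linked i \<phi> y"
proof -
  obtain x where x: "x \<in> C 0 i" "augment x = \<phi>" using assms augment_surj by blast
  have "e 0 b x \<in> d 0 b ` C (Suc 0) b" if "i = Suc b" for b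
    using augment_exact[OF e_in_C] augment_e[of x b] x that assms by simp
  from zigzag_from_first[OF x(1) this] obtain f where "zigzag i f" "f 0 = x" by blast
  thus ?thesis using linked_residue_cycle x(2) unfolding linked_def by blast
qed

lemma linked_right_total:
  assumes y: "y \<in> residue_cycles i"
  shows "\<exists>\<phi>\<in>cocycles Q (codegree i). linked i \<phi> y"
proof -
  have yW: "y \<in> residue_space i" using y by (simp add: residue_cycles_def)
  obtain x where x: "x \<in> C i 0" "top_part i x = y" using top_part_surj[OF yW] by blast
  have "d b 0 x \<in> e b 0 ` C b (Suc 0)" if "i = Suc b" for b
    using top_part_exact[OF d_in_C] top_part_d[of x b] x that y by (simp add: residue_cycles_def)
  from zigzag_from_last[OF x(1) this] obtain f where "zigzag i f" "f i = x" by blast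
  thus ?thesis using linked_cocycle x(2) unfolding linked_def by blast
qed

text \<open>
  Being a boundary on either edge means being a sum of a \<open>d\<close>-image and an \<open>e\<close>-image, and this property
  travels along a zigzag in both directions.
\<close>

lemma linked_coboundary_iff:
  assumes "linked i \<phi> y"
  shows "\<phi> \<in> coboundaries Q (codegree i) \<longleftrightarrow> y \<in> residue_boundaries i"
proof -
  obtain f where f: "zigzag i f" "\<phi> = augment (f 0)" "y = top_part i (f i)"
    using assms unfolding linked_def by blast
  have deg: "codegree i - 1 = codegree (Suc i)" by (simp add: codegree_def)
  show ?thesis
  proof
    assume "\<phi> \<in> coboundaries Q (codegree i)"
    then obtain \<psi> where \<psi>: "\<psi> \<in> cochains Q (codegree (Suc i))" "\<phi> = coboundary Q \<psi>" unfolding deg by blast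
    obtain u where u: "u \<in> C 0 (Suc i)" "augment u = \<psi>" using augment_surj[OF \<psi>(1)] by blast
    have "augment (f 0 - e 0 i u) = 0"
      unfolding augment_linear(2) augment_e[symmetric] u(2) using f(2) \<psi>(2) by simp
    then obtain v where v: "v \<in> C (Suc 0) i" "f 0 - e 0 i u = d 0 i v"
      using augment_exact[OF C_minus[OF zigzagD(1)[OF f(1)] e_in_C[OF u(1)]]] by blast
    have "f 0 = e 0 i u + d 0 i v" using v(2) by (simp add: algebra_simps)
    from zigzag_boundary[OF f(1) this u(1) v(1)] obtain u' v' where
      uv: "u' \<in> C i (Suc 0)" "v' \<in> C (Suc i) 0" "f i = e i 0 u' + d i 0 v'" by blast
    have "y = residue_map i (top_part (Suc i) v')"
      unfolding f(3) uv(3) top_part_linear(1) top_part_e[OF uv(1)] top_part_d[OF uv(2)] by simp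
    thus "y \<in> residue_boundaries i"
      unfolding residue_boundaries_def using top_part_in_residue_space[OF uv(2)] by (rule image_eqI)
  next
    assume "y \<in> residue_boundaries i"
    then obtain w where w: "w \<in> residue_space (Suc i)" "y = residue_map i w" unfolding residue_boundaries_def by blast
    obtain v where v: "v \<in> C (Suc i) 0" "top_part (Suc i) v = w" using top_part_surj[OF w(1)] by blast
    have "top_part i (f i - d i 0 v) = 0"
      unfolding top_part_linear(2) top_part_d[OF v(1)] v(2) using f(3) w(2) by simp
    then obtain u where u: "u \<in> C i (Suc 0)" "f i - d i 0 v = e i 0 u"
      using top_part_exact[OF C_minus[OF zigzagD(2)[OF f(1)] d_in_C[OF v(1)]]] by blast
    have "f i = e i 0 u + d i 0 v" using u(2) by (simp add: algebra_simps)
    from zigzag_boundary_last[OF f(1) this u(1) v(1)] obtain u' v' where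
      uv: "u' \<in> C 0 (Suc i)" "v' \<in> C (Suc 0) i" "f 0 = e 0 i u' + d 0 i v'" by blast
    have "\<phi> = coboundary Q (augment u')"
      unfolding f(2) uv(3) augment_linear(1) augment_d[OF uv(2)] augment_e[of u' i] by simp
    thus "\<phi> \<in> coboundaries Q (codegree i)"
      unfolding deg using augment_in_cochains[OF uv(1)] by (rule image_eqI)
  qed
qed

lemma residue_homology_dim:
  "qdim (residue_cycles i) (residue_boundaries i) = hdim TYPE('k) Q (codegree i)"
proof (rule order_antisym)
  note fq = finite_quotient_cohomology[OF convex_Q, of "codegree i", where ?'k = 'k]
  show "hdim TYPE('k) Q (codegree i) \<ge> qdim (residue_cycles i) (residue_boundaries i)"
    unfolding hdim_eq
    by (rule qdim_le_by_relation[OF finite_quotient_residue fq, where R = "\<lambda>y \<phi>. linked i \<phi> y"])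
      (use linked_right_total linked_coboundary_iff in \<open>blast intro: linked_add linked_scale\<close>)+
  show "hdim TYPE('k) Q (codegree i) \<le> qdim (residue_cycles i) (residue_boundaries i)"
    unfolding hdim_eq
    by (rule qdim_le_by_relation[OF fq finite_quotient_residue, where R = "linked i"])
      (use linked_left_total linked_coboundary_iff in \<open>blast intro: linked_add linked_scale\<close>)+
qed

end

text \<open>
  Acting on the residue field keeps the constant terms of the matrices.
\<close>

lemma residue_differential:
  assumes F: "multigraded_maps m K (F :: ('k::field, 'k mpoly set) resolution) \<mu>"
    and R: "resolved_full_subcomplex m K \<omega> (free_rank F) (basis_deg F) (scalar_entry F) \<mu>"
  shows "differential F residue_action i =
    resolved_full_subcomplex.residue_map (free_rank F) (basis_deg F) (scalar_entry F) i"
proof (rule ext, rule ext)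
  interpret R: resolved_full_subcomplex m K \<omega> "free_rank F" "basis_deg F" "scalar_entry F" \<mu> by (rule R)
  fix x b
  have "lookup (diff_entry F i b c) 0 =
      (if basis_deg F i b = basis_deg F (Suc i) c then scalar_entry F i b c else 0)"
    if bc: "b < free_rank F i" "c < free_rank F (Suc i)" for c
  proof -
    have D: "diff_entry F i b c = single (basis_deg F (Suc i) c - basis_deg F i b) (scalar_entry F i b c)"
      and le: "scalar_entry F i b c \<noteq> 0 \<Longrightarrow> exp_le (basis_deg F i b) (basis_deg F (Suc i) c)"
      using F bc unfolding multigraded_maps_def homogeneous_matrix_def by blast+
    show ?thesis
    proof (cases "scalar_entry F i b c = 0")
      case False
      thus ?thesis unfolding D lookup_single using exp_diff_eq_0_iff[OF le] by (auto simp: when_def)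
    qed (simp add: D)
  qed
  thus "differential F residue_action i x b = R.residue_map i x b"
    by (simp add: differential_def matrix_map_def R.residue_map_def scalar_map_def residue_action_def)
qed

text \<open>
  One edge of the double complex is the complex that computes Tor from the chosen resolution, the other
  is the cochain complex of the full subcomplex.
\<close>

theorem betti_eq_reduced_cohomology_dim:
  assumes K: "simplicial_complex m K" and \<omega>: "\<omega> \<subseteq> {1..m}"
  shows "betti TYPE('k::field) m K i \<omega> =
    hdim TYPE('k) (full_subcomplex K \<omega>) (int (card \<omega>) - int i - 1)"
proof -
  define F :: "('k, 'k mpoly set) resolution" where
    "F = (SOME F. free_resolution m (stanley_reisner_module m K) (stanley_reisner_grading m K) F)"
  have "free_resolution m (stanley_reisner_module m K) (stanley_reisner_grading m K) F"
    unfolding F_def by (rule someI_ex) (rule stanley_reisner_free_resolution_exists[OF K])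
  from free_resolution_exact_strands[OF K this] obtain \<mu> where
    F: "multigraded_maps m K F \<mu>" and
    ex: "exact_strands m K (free_rank F) (basis_deg F) (scalar_entry F) \<mu>" by blast
  have loc: "resolved_full_subcomplex m K \<omega> (free_rank F) (basis_deg F) (scalar_entry F) \<mu>"
    by unfold_locales fact+
  interpret R: resolved_full_subcomplex m K \<omega> "free_rank F" "basis_deg F" "scalar_entry F" \<mu> by (rule loc)
  have T: "tensor_component F residue_grading i (indicator_degree \<omega>) = R.residue_space i" for i
    unfolding tensor_component_def R.residue_space_def
    by (auto simp: residue_grading_def not_less[symmetric] split: if_splits)
  have scale: "(\<lambda>(c :: 'k) x b. residue_action (const_poly c) (x b)) = (\<lambda>c (x :: nat \<Rightarrow> 'k) b. c * x b)"
    by (simp add: fun_eq_iff residue_action_def const_poly_def)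
  have "betti TYPE('k) m K i \<omega> = qdim (R.residue_cycles i) (R.residue_boundaries i)"
    unfolding betti_def tor_dim_def F_def[symmetric] tensor_homology_dim_def T scale
      residue_differential[OF F loc] R.residue_cycles_def R.residue_boundaries_def ..
  thus ?thesis unfolding R.residue_homology_dim R.codegree_def .
qed


section \<open>Partitions and the inequalities\<close>

definition colours :: "nat \<Rightarrow> (nat \<Rightarrow> nat set) \<Rightarrow> nat set \<Rightarrow> nat set" where
  "colours r \<alpha> \<sigma> = {i \<in> {1..r}. \<alpha> i \<inter> \<sigma> \<noteq> {}}"

context
  fixes m r :: nat and K :: "nat set set" and \<alpha> :: "nat \<Rightarrow> nat set"
  assumes K: "simplicial_complex m K" and part: "indexed_partition m r \<alpha>"
    and nondeg: "nondegenerate K r \<alpha>"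
begin

lemma blocks: "inj_on \<alpha> {1..r}" "disjoint (\<alpha> ` {1..r})" "\<Union> (\<alpha> ` {1..r}) = {1..m}" "{} \<notin> \<alpha> ` {1..r}"
  using part by (auto simp: indexed_partition_def partition_on_def)

lemma block_disjoint:
  assumes "i \<in> {1..r}" "j \<in> {1..r}" "v \<in> \<alpha> i" "v \<in> \<alpha> j"
  shows "i = j"
proof -
  have "\<alpha> i = \<alpha> j"
  proof (rule ccontr)
    assume "\<alpha> i \<noteq> \<alpha> j"
    from disjointD[OF blocks(2) imageI[OF assms(1)] imageI[OF assms(2)] this] assms(3,4)
    show False by blast
  qed
  from inj_onD[OF blocks(1) this assms(1,2)] show ?thesis .
qed

lemma block_cover: "v \<in> {1..m} \<Longrightarrow> \<exists>i\<in>{1..r}. v \<in> \<alpha> i"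
  unfolding blocks(3)[symmetric] by blast

lemma block_subset: "i \<in> {1..r} \<Longrightarrow> \<alpha> i \<subseteq> {1..m}"
  unfolding blocks(3)[symmetric] by blast

lemma block_nonempty: "i \<in> {1..r} \<Longrightarrow> \<alpha> i \<noteq> {}"
  using blocks(4) by (metis imageI)

lemma complex_convex: "convex_family K"
proof -
  have sub: "K \<subseteq> Pow {1..m}" and down: "\<And>\<sigma> \<tau>. \<sigma> \<in> K \<Longrightarrow> \<tau> \<subseteq> \<sigma> \<Longrightarrow> \<tau> \<in> K"
    using K by (simp_all add: simplicial_complex_def)
  have "finite K" using finite_subset[OF sub] by simp
  moreover have "finite \<sigma>" if "\<sigma> \<in> K" for \<sigma>
    using finite_subset[of \<sigma> "{1..m}"] sub that by blast
  moreover have "\<tau> \<in> K" if "\<rho> \<in> K" "\<tau> \<subseteq> \<rho>" for \<rho> \<tau> using down[OF that] .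
  ultimately show ?thesis unfolding convex_family_def by simp
qed

lemma face_subset: "\<sigma> \<in> K \<Longrightarrow> \<sigma> \<subseteq> {1..m}"
  using K by (auto simp: simplicial_complex_def)

lemma mono_colours: "mono (colours r \<alpha>)"
  by (rule monoI) (auto simp: colours_def)

text \<open>
  Two vertices of a face span an edge, so nondegeneracy puts them into different blocks.
\<close>

lemma card_colours:
  assumes s: "\<sigma> \<in> K"
  shows "card (colours r \<alpha> \<sigma>) = card \<sigma>"
proof -
  define b where "b v = (THE i. i \<in> {1..r} \<and> v \<in> \<alpha> i)" for v
  have b: "b v \<in> {1..r} \<and> v \<in> \<alpha> (b v)" if "v \<in> \<sigma>" for v
  proof -
    have "\<exists>!i. i \<in> {1..r} \<and> v \<in> \<alpha> i"
      using block_cover[of v] block_disjoint face_subset[OF s] that by blast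
    from theI'[OF this] show ?thesis by (simp add: b_def)
  qed
  have "bij_betw b \<sigma> (colours r \<alpha> \<sigma>)"
  proof (rule bij_betw_imageI)
    show "inj_on b \<sigma>"
    proof (rule inj_onI, rule ccontr)
      fix x y assume xy: "x \<in> \<sigma>" "y \<in> \<sigma>" "b x = b y" "x \<noteq> y"
      have "{x, y} \<in> K" using K s xy by (auto simp: simplicial_complex_def)
      thus False using nondeg b[OF xy(1)] b[OF xy(2)] xy unfolding nondegenerate_def by metis
    qed
    show "b ` \<sigma> = colours r \<alpha> \<sigma>"
    proof (intro equalityI subsetI)
      fix i assume "i \<in> colours r \<alpha> \<sigma>"
      then obtain v where v: "i \<in> {1..r}" "v \<in> \<alpha> i" "v \<in> \<sigma>" by (auto simp: colours_def)
      hence "i = b v" using block_disjoint b[OF v(3)] by blast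
      thus "i \<in> b ` \<sigma>" using v(3) by blast
    qed (use b in \<open>auto simp: colours_def\<close>)
  qed
  thus ?thesis by (simp add: bij_betw_same_card)
qed

lemma full_subcomplex_band:
  assumes L: "L \<subseteq> {1..r}"
  shows "full_subcomplex K (block_union \<alpha> L) = colour_band K (colours r \<alpha>) {} L"
proof -
  have "\<sigma> \<subseteq> block_union \<alpha> L \<longleftrightarrow> colours r \<alpha> \<sigma> \<subseteq> L" if s: "\<sigma> \<in> K" for \<sigma>
  proof
    assume *: "\<sigma> \<subseteq> block_union \<alpha> L"
    show "colours r \<alpha> \<sigma> \<subseteq> L"
    proof
      fix i assume "i \<in> colours r \<alpha> \<sigma>"
      then obtain v where v: "i \<in> {1..r}" "v \<in> \<alpha> i" "v \<in> \<sigma>" by (auto simp: colours_def)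
      then obtain j where "j \<in> L" "v \<in> \<alpha> j" using * by (auto simp: block_union_def)
      thus "i \<in> L" using block_disjoint[of i j v] v L by blast
    qed
  next
    assume *: "colours r \<alpha> \<sigma> \<subseteq> L"
    show "\<sigma> \<subseteq> block_union \<alpha> L"
    proof
      fix v assume v: "v \<in> \<sigma>"
      then obtain i where "i \<in> {1..r}" "v \<in> \<alpha> i" using block_cover face_subset[OF s] by blast
      hence "i \<in> L" using * v by (auto simp: colours_def)
      thus "v \<in> block_union \<alpha> L" using \<open>v \<in> \<alpha> i\<close> by (auto simp: block_union_def)
    qed
  qed
  thus ?thesis by (auto simp: full_subcomplex_def colour_band_def)
qed

lemma card_le_card_block_union:
  assumes L: "L \<subseteq> {1..r}"
  shows "card L \<le> card (block_union \<alpha> L)"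
proof -
  have finL: "finite L" using L finite_subset by blast
  have fin: "finite (\<alpha> i)" if "i \<in> L" for i using block_subset[of i] L that finite_subset by blast
  have "card (block_union \<alpha> L) = (\<Sum>i\<in>L. card (\<alpha> i))"
    unfolding block_union_def
  proof (rule card_UN_disjoint[OF finL])
    show "\<forall>i\<in>L. finite (\<alpha> i)" using fin by (rule ballI)
    show "\<forall>i\<in>L. \<forall>j\<in>L. i \<noteq> j \<longrightarrow> \<alpha> i \<inter> \<alpha> j = {}"
    proof (intro ballI impI equals0I)
      fix i j v assume "i \<in> L" "j \<in> L" "i \<noteq> j" "v \<in> \<alpha> i \<inter> \<alpha> j"
      thus False using block_disjoint[of i j v] subsetD[OF L] by blast
    qed
  qed
  moreover have "1 \<le> card (\<alpha> i)" if "i \<in> L" for i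
    using block_nonempty[OF subsetD[OF L that]] fin[OF that] by (simp add: Suc_le_eq card_gt_0_iff)
  hence "card L \<le> (\<Sum>i\<in>L. card (\<alpha> i))"
    using sum_bounded_below[of L 1 "\<lambda>i. card (\<alpha> i)"] by simp
  ultimately show ?thesis by (simp only:)
qed

lemma complex_dim_facet: "\<exists>\<sigma>\<in>K. complex_dim K = int (card \<sigma>) - 1 \<and> (\<forall>\<tau>\<in>K. card \<tau> \<le> card \<sigma>)"
proof -
  have "finite K" using complex_convex unfolding convex_family_def by (rule conjunct1)
  hence fin: "finite ((\<lambda>\<sigma>. int (card \<sigma>) - 1) ` K)" by (rule finite_imageI)
  have "{} \<in> K" using K unfolding simplicial_complex_def by blast
  hence ne: "K \<noteq> {}" by blast
  have "complex_dim K \<in> (\<lambda>\<sigma>. int (card \<sigma>) - 1) ` K"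
    unfolding complex_dim_def using fin ne by (intro Max_in) auto
  then obtain \<sigma> where s: "\<sigma> \<in> K" "complex_dim K = int (card \<sigma>) - 1" by blast
  have "card \<tau> \<le> card \<sigma>" if "\<tau> \<in> K" for \<tau>
  proof -
    have "int (card \<tau>) - 1 \<le> complex_dim K"
      unfolding complex_dim_def using fin that by (intro Max_ge) auto
    thus ?thesis unfolding s(2) by linarith
  qed
  thus ?thesis using s by blast
qed

text \<open>
  The colours of a face of maximal dimension are added to the colour filtration one by one.
\<close>

lemma sum_cohomology_ge_choose:
  "nat (int r - complex_dim K - 1) choose q \<le>
    (\<Sum>L\<in>Pow {1..r}. hdim TYPE('k::field) (full_subcomplex K (block_union \<alpha> L)) (int (card L) - int q - 1))"
proof -
  obtain \<sigma> where s: "\<sigma> \<in> K" "complex_dim K = int (card \<sigma>) - 1" "\<And>\<tau>. \<tau> \<in> K \<Longrightarrow> card \<tau> \<le> card \<sigma>"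
    using complex_dim_facet by blast
  have "nat (int r - complex_dim K - 1) = card {1..r} - card \<sigma>" using s(2) by simp
  moreover have "(card {1..r} - card \<sigma>) choose q \<le>
      band_betti_sum TYPE('k) K (colours r \<alpha>) {1..r} q (colours r \<alpha> \<sigma>)"
  proof (rule band_betti_sum_facet[OF complex_convex _ _ mono_colours s(1)])
    show "card (colours r \<alpha> \<tau>) = card \<tau> \<and> colours r \<alpha> \<tau> \<subseteq> {1..r}" if "\<tau> \<in> K" for \<tau>
      using card_colours[OF that] by (auto simp: colours_def)
  qed (simp_all add: s(3))
  ultimately have "nat (int r - complex_dim K - 1) choose q \<le>
      band_betti_sum TYPE('k) K (colours r \<alpha>) {1..r} q (colours r \<alpha> \<sigma>)" by simp
  also have "\<dots> \<le> band_betti_sum TYPE('k) K (colours r \<alpha>) {1..r} q {}"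
    by (rule band_betti_sum_le[OF complex_convex mono_colours]) (auto simp: colours_def)
  also have "\<dots> = (\<Sum>L\<in>Pow {1..r}.
      hdim TYPE('k) (full_subcomplex K (block_union \<alpha> L)) (int (card L) - int q - 1))"
    unfolding band_betti_sum_def by (intro sum.cong) (auto simp: full_subcomplex_band)
  finally show ?thesis .
qed

lemma sum_betti_eq_sum_cohomology:
  "(\<Sum>L\<in>Pow {1..r}. betti TYPE('k::field) m K
      (q + card (block_union \<alpha> L) - card L) (block_union \<alpha> L)) =
   (\<Sum>L\<in>Pow {1..r}. hdim TYPE('k) (full_subcomplex K (block_union \<alpha> L)) (int (card L) - int q - 1))"
proof (rule sum.cong[OF refl])
  fix L assume "L \<in> Pow {1..r}"
  hence L: "L \<subseteq> {1..r}" by blast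
  have "block_union \<alpha> L \<subseteq> {1..m}" using L block_subset unfolding block_union_def by blast
  thus "betti TYPE('k) m K (q + card (block_union \<alpha> L) - card L) (block_union \<alpha> L) =
      hdim TYPE('k) (full_subcomplex K (block_union \<alpha> L)) (int (card L) - int q - 1)"
    unfolding betti_eq_reduced_cohomology_dim[OF K \<open>block_union \<alpha> L \<subseteq> {1..m}\<close>]
    using card_le_card_block_union[OF L] by (simp add: of_nat_diff)
qed

text \<open>
  The binomial coefficients add up to the power of two. After exchanging the sums, the substitution
  \<open>j = \<bar>L\<bar> - q - 1\<close> matches \<open>q \<le> \<bar>L\<bar>\<close> with the given range of degrees; for larger \<open>q\<close> the degree is below \<open>-1\<close>.
\<close>

lemma total_cohomology_ge_power:
  "2 ^ nat (int r - complex_dim K - 1) \<le>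
    (\<Sum>L\<in>Pow {1..r}. \<Sum>j = -1..int (card L) - 1.
      hdim TYPE('k::field) (full_subcomplex K (block_union \<alpha> L)) j)"
proof -
  let ?d = "nat (int r - complex_dim K - 1)"
  let ?h = "\<lambda>L j. hdim TYPE('k) (full_subcomplex K (block_union \<alpha> L)) j"
  have "complex_dim K \<ge> -1" using complex_dim_facet by force
  hence "?d \<le> r" by simp
  have "(2 :: nat) ^ ?d = (\<Sum>q\<le>?d. ?d choose q)" by (rule choose_row_sum[symmetric])
  also have "\<dots> \<le> (\<Sum>q\<le>?d. \<Sum>L\<in>Pow {1..r}. ?h L (int (card L) - int q - 1))"
    by (intro sum_mono sum_cohomology_ge_choose)
  also have "\<dots> = (\<Sum>L\<in>Pow {1..r}. \<Sum>q\<le>?d. ?h L (int (card L) - int q - 1))"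
    by (rule sum.swap)
  also have "\<dots> \<le> (\<Sum>L\<in>Pow {1..r}. \<Sum>j = -1..int (card L) - 1. ?h L j)"
  proof (rule sum_mono)
    fix L assume "L \<in> Pow {1..r}"
    hence L: "L \<subseteq> {1..r}" by blast
    have zero: "?h L (int (card L) - int q - 1) = 0" if "card L < q" for q
      unfolding full_subcomplex_band[OF L] using that
      by (intro hdim_empty_degree convex_colour_band[OF complex_convex mono_colours]) auto
    have "(\<Sum>q\<le>?d. ?h L (int (card L) - int q - 1)) \<le>
        (\<Sum>q\<le>max ?d (card L). ?h L (int (card L) - int q - 1))"
      by (intro sum_mono2) auto
    also have "\<dots> = (\<Sum>q\<le>card L. ?h L (int (card L) - int q - 1))"
      using zero by (intro sum.mono_neutral_right) auto
    also have "\<dots> = (\<Sum>j = -1..int (card L) - 1. ?h L j)"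
      by (rule sum.reindex_bij_witness[where i = "\<lambda>j. nat (int (card L) - 1 - j)" and
            j = "\<lambda>q. int (card L) - int q - 1"]) auto
    finally show "(\<Sum>q\<le>?d. ?h L (int (card L) - int q - 1)) \<le> (\<Sum>j = -1..int (card L) - 1. ?h L j)" .
  qed
  finally show ?thesis .
qed

end

theorem theorem1p3:
  fixes m r :: nat and K :: "nat set set" and \<alpha> :: "nat \<Rightarrow> nat set"
  assumes "simplicial_complex m K"
    and "indexed_partition m r \<alpha>"
    and "nondegenerate K r \<alpha>"
  shows "(\<forall>q::nat.
            (\<Sum>L\<in>Pow {1..r}. betti TYPE('k::field) m K
                (q + card (block_union \<alpha> L) - card L) (block_union \<alpha> L))
            = (\<Sum>L\<in>Pow {1..r}. reduced_cohomology_dim TYPE('k)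
                (full_subcomplex K (block_union \<alpha> L)) (int (card L) - int q - 1))
          \<and> (\<Sum>L\<in>Pow {1..r}. reduced_cohomology_dim TYPE('k)
                (full_subcomplex K (block_union \<alpha> L)) (int (card L) - int q - 1))
            \<ge> nat (int r - complex_dim K - 1) choose q)
       \<and> (\<Sum>L\<in>Pow {1..r}. \<Sum>j = -1..int (card L) - 1. reduced_cohomology_dim TYPE('k)
                (full_subcomplex K (block_union \<alpha> L)) j)
            \<ge> 2 ^ nat (int r - complex_dim K - 1)"
proof (rule conjI[OF allI[OF conjI]])
qed (rule sum_betti_eq_sum_cohomology[OF assms] sum_cohomology_ge_choose[OF assms]
      total_cohomology_ge_power[OF assms])+

end
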